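(* Let $\mathbf X=(X(\mathbf t),\ \mathbf t\in T)$ be a centered real-valued Gaussian random field with continuous sample paths on a compact set $T\subset\mathbb R^d$. Let $\mathcal C$ be a collection of ordered pairs $(K_1,K_2)$ of nonempty compact subsets of $T$ which is compact in the product Hausdorff distance. Then for every $0<r\le 1$, $$-\frac12\lim_{\tau\uparrow r}D_{\mathcal C}(\tau)\ \le\ \liminf_{u\to\infty}\frac1{u^2}\log\Psi_{\mathcal C}(u;r)\ \le\ \limsup_{u\to\infty}\frac1{u^2}\log\Psi_{\mathcal C}(u;r)\ \le\ -\frac12 D_{\mathcal C}(r),$$ where $$\Psi_{\mathcal C}(u;r)=P\bigl(\text{there is }(K_1,K_2)\in\mathcal C\text{ such that }X(\mathbf t)>u\text{ for each }\mathbf t\in K_1\text{ and }X(\mathbf t)<ru\text{ for each }\mathbf t\in K_2\bigr)$$ and, for $r>0$, $$D_{\mathcal C}(r)=\inf\bigl\{E(H^2):\ H\in\mathcal L\text{ and, for some }(K_1,K_2)\in\mathcal C,\ E(X(\mathbf t)H)\ge 1\ \text{for each }\mathbf t\in K_1\text{ and }E(X(\mathbf t)H)\le r\ \text{for each }\mathbf t\in K_2\bigr\}.$$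
   Context: $\mathcal L$ denotes the closure in mean square (i.e. in $L^2(P)$) of the space of finite linear combinations $\sum_{j=1}^k a_jX(\mathbf t_j)$, $a_j\in\mathbb R$, $\mathbf t_j\in T$, $k\ge1$. The infimum over the empty set is $+\infty$, and $\log 0=-\infty$. The product Hausdorff distance is the product metric on pairs of nonempty compact sets obtained from the Hausdorff distance in each coordinate. *)

theory Defs
  imports "HOL-Probability.Probability"
begin

definition compact_subsets :: "'a::metric_space set \<Rightarrow> 'a set set" where
  "compact_subsets T = {K. compact K \<and> K \<noteq> {} \<and> K \<subseteq> T}"

text \<open>The value 0 outside the nonempty compact sets is only there because the library's
  \<^locale>\<open>Metric_space\<close> requires nonnegativity and symmetry on the whole type.\<close>

definition hausdorff_dist :: "'a::metric_space set \<Rightarrow> 'a set \<Rightarrow> real" where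
  "hausdorff_dist A B =
     (if A \<in> compact_subsets UNIV \<and> B \<in> compact_subsets UNIV
      then max (SUP a\<in>A. infdist a B) (SUP b\<in>B. infdist b A) else 0)"

definition hausdorff_metric :: "'a::metric_space set \<Rightarrow> 'a set metric" where
  "hausdorff_metric T = metric (compact_subsets T, hausdorff_dist)"

lemma bdd_above_infdist_image:
  "compact A \<Longrightarrow> bdd_above ((\<lambda>a. infdist a B) ` A)"
  by (intro bounded_imp_bdd_above compact_imp_bounded compact_continuous_image continuous_intros)

lemma infdist_le_hausdorff_dist:
  assumes "A \<in> compact_subsets UNIV" "B \<in> compact_subsets UNIV" "a \<in> A"
  shows "infdist a B \<le> hausdorff_dist A B"
proof -
  have "infdist a B \<le> (SUP a\<in>A. infdist a B)"
    using assms by (intro cSUP_upper bdd_above_infdist_image) (auto simp: compact_subsets_def)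
  then show ?thesis using assms by (simp add: hausdorff_dist_def)
qed

lemma hausdorff_dist_commute: "hausdorff_dist A B = hausdorff_dist B A"
  by (auto simp: hausdorff_dist_def max.commute)

lemma hausdorff_dist_leI:
  assumes "A \<in> compact_subsets UNIV" "B \<in> compact_subsets UNIV"
    and "\<And>a. a \<in> A \<Longrightarrow> infdist a B \<le> c" "\<And>b. b \<in> B \<Longrightarrow> infdist b A \<le> c"
  shows "hausdorff_dist A B \<le> c"
  using assms by (auto simp: hausdorff_dist_def compact_subsets_def intro!: cSUP_least)

lemma hausdorff_dist_nonneg: "0 \<le> hausdorff_dist A B"
proof (cases "A \<in> compact_subsets UNIV \<and> B \<in> compact_subsets UNIV")
  case True
  then obtain a where "a \<in> A" by (auto simp: compact_subsets_def)
  with True show ?thesis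
    using infdist_le_hausdorff_dist[of A B a] infdist_nonneg[of a B] by linarith
qed (auto simp: hausdorff_dist_def)

lemma infdist_triangle_hausdorff_dist:
  assumes "A \<in> compact_subsets UNIV" "B \<in> compact_subsets UNIV" "C \<in> compact_subsets UNIV"
    and "a \<in> A"
  shows "infdist a C \<le> hausdorff_dist A B + hausdorff_dist B C"
proof -
  have B: "B \<noteq> {}" using assms by (auto simp: compact_subsets_def)
  have "infdist a C - hausdorff_dist B C \<le> dist a b" if "b \<in> B" for b
    using infdist_triangle[of a C b] infdist_le_hausdorff_dist[OF assms(2,3) that] by linarith
  then have "infdist a C - hausdorff_dist B C \<le> infdist a B"
    unfolding infdist_notempty[OF B] by (intro cINF_greatest B)
  with infdist_le_hausdorff_dist[OF assms(1,2,4)] show ?thesis by linarith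
qed

lemma Metric_space_hausdorff: "Metric_space (compact_subsets T) hausdorff_dist"
proof
  have sub: "A \<in> compact_subsets UNIV" if "A \<in> compact_subsets T" for A
    using that by (auto simp: compact_subsets_def)
  fix A B C :: "'a set"
  show "0 \<le> hausdorff_dist A B" by (rule hausdorff_dist_nonneg)
  show "hausdorff_dist A B = hausdorff_dist B A" by (rule hausdorff_dist_commute)
  assume A: "A \<in> compact_subsets T" and B: "B \<in> compact_subsets T"
  have mem: "x \<in> Q" if "hausdorff_dist P Q = 0" "x \<in> P"
      "P \<in> compact_subsets T" "Q \<in> compact_subsets T" for P Q and x :: 'a
  proof -
    have "infdist x Q = 0"
      using infdist_le_hausdorff_dist[OF sub sub, of P Q x] infdist_nonneg[of x Q] that by simp
    with that show ?thesis
      using in_closed_iff_infdist_zero[of Q x]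
      by (auto simp: compact_subsets_def compact_imp_closed)
  qed
  have "hausdorff_dist A A \<le> 0"
    using A by (intro hausdorff_dist_leI sub) auto
  then have "hausdorff_dist A A = 0" using hausdorff_dist_nonneg[of A A] by linarith
  then show "hausdorff_dist A B = 0 \<longleftrightarrow> A = B"
    using mem[of A B] mem[of B A] A B hausdorff_dist_commute[of A B] by auto
  assume C: "C \<in> compact_subsets T"
  show "hausdorff_dist A C \<le> hausdorff_dist A B + hausdorff_dist B C"
  proof (rule hausdorff_dist_leI[OF sub[OF A] sub[OF C]])
    show "infdist c A \<le> hausdorff_dist A B + hausdorff_dist B C" if "c \<in> C" for c
      using infdist_triangle_hausdorff_dist[OF sub[OF C] sub[OF B] sub[OF A] that]
      by (simp add: hausdorff_dist_commute add.commute)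
  qed (rule infdist_triangle_hausdorff_dist[OF sub[OF A] sub[OF B] sub[OF C]])
qed

lemma mspace_hausdorff_metric [simp]: "mspace (hausdorff_metric T) = compact_subsets T"
  by (simp add: hausdorff_metric_def Metric_space.mspace_metric[OF Metric_space_hausdorff])

lemma mdist_hausdorff_metric [simp]: "mdist (hausdorff_metric T) = hausdorff_dist"
  by (simp add: hausdorff_metric_def Metric_space.mdist_metric[OF Metric_space_hausdorff])

text \<open>Constants count as (degenerate) Gaussian variables.\<close>

definition gaussian_rv :: "'w measure \<Rightarrow> ('w \<Rightarrow> real) \<Rightarrow> bool" where
  "gaussian_rv M Y \<longleftrightarrow> Y \<in> borel_measurable M \<and>
     (\<exists>\<mu>. (AE \<omega> in M. Y \<omega> = \<mu>) \<or> (\<exists>\<sigma>>0. distributed M lborel Y (normal_density \<mu> \<sigma>)))"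

definition linear_combinations :: "'t set \<Rightarrow> ('t \<Rightarrow> 'w \<Rightarrow> real) \<Rightarrow> ('w \<Rightarrow> real) set" where
  "linear_combinations T X =
     {\<lambda>\<omega>. \<Sum>j=1..k. a j * X (t j) \<omega> | (k::nat) (a::nat \<Rightarrow> real) t. 1 \<le> k \<and> t ` {1..k} \<subseteq> T}"

definition gaussian_field :: "'w measure \<Rightarrow> 't set \<Rightarrow> ('t \<Rightarrow> 'w \<Rightarrow> real) \<Rightarrow> bool" where
  "gaussian_field M T X \<longleftrightarrow> (\<forall>Y\<in>linear_combinations T X. gaussian_rv M Y)"

definition centered_field :: "'w measure \<Rightarrow> 't set \<Rightarrow> ('t \<Rightarrow> 'w \<Rightarrow> real) \<Rightarrow> bool" where
  "centered_field M T X \<longleftrightarrow> (\<forall>t\<in>T. integrable M (X t) \<and> integral\<^sup>L M (X t) = 0)"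

text \<open>Elements of \<open>L\<^sup>2\<close> are represented by functions, not by classes modulo null sets.\<close>

definition mean_square_closure :: "'w measure \<Rightarrow> ('w \<Rightarrow> real) set \<Rightarrow> ('w \<Rightarrow> real) set" where
  "mean_square_closure M S =
     {H \<in> borel_measurable M. integrable M (\<lambda>\<omega>. (H \<omega>)\<^sup>2) \<and>
        (\<forall>\<epsilon>>0. \<exists>Y\<in>S. integrable M (\<lambda>\<omega>. (H \<omega> - Y \<omega>)\<^sup>2) \<and> (LINT \<omega>|M. (H \<omega> - Y \<omega>)\<^sup>2) < \<epsilon>)}"

definition field_L2_space :: "'w measure \<Rightarrow> 't set \<Rightarrow> ('t \<Rightarrow> 'w \<Rightarrow> real) \<Rightarrow> ('w \<Rightarrow> real) set" where
  "field_L2_space M T X = mean_square_closure M (linear_combinations T X)"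

definition log_prob :: "real \<Rightarrow> ereal" where
  "log_prob p = (if p = 0 then -\<infinity> else ereal (ln p))"

definition excursion_prob ::
  "'w measure \<Rightarrow> ('t \<Rightarrow> 'w \<Rightarrow> real) \<Rightarrow> ('t set \<times> 't set) set \<Rightarrow> real \<Rightarrow> real \<Rightarrow> real" where
  "excursion_prob M X \<C> u r = measure M {\<omega> \<in> space M. \<exists>(K1, K2)\<in>\<C>.
      (\<forall>t\<in>K1. X t \<omega> > u) \<and> (\<forall>t\<in>K2. X t \<omega> < r * u)}"

definition excursion_rate ::
  "'w measure \<Rightarrow> 't set \<Rightarrow> ('t \<Rightarrow> 'w \<Rightarrow> real) \<Rightarrow> ('t set \<times> 't set) set \<Rightarrow> real \<Rightarrow> ereal" where
  "excursion_rate M T X \<C> r = Inf {ereal (LINT \<omega>|M. (H \<omega>)\<^sup>2) | H.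
      H \<in> field_L2_space M T X \<and> (\<exists>(K1, K2)\<in>\<C>.
        (\<forall>t\<in>K1. (LINT \<omega>|M. X t \<omega> * H \<omega>) \<ge> 1) \<and>
        (\<forall>t\<in>K2. (LINT \<omega>|M. X t \<omega> * H \<omega>) \<le> r))}"

end

(* Lower bound: approximate an admissible H with E(H^2) < x by a finite linear combination Y of the field
   and write X(t) = E(X(t)Y) Y / E(Y^2) + R(t). The remainder R is uncorrelated with Y, hence independent
   of it, so it stays below a small multiple of u with probability near 1, and it suffices that
   Y / E(Y^2) lies in an interval slightly above u; this has probability about exp(-x u^2 / 2).
   The strict inequality tau < r absorbs the errors.

   Upper bound: if no H with E(H^2) <= d^2 is admissible at (K1, K2), then by completeness of L^2 none is
   admissible for slightly relaxed constraints on finite nets of K1 and K2. Convex duality then gives a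
   nonnegative combination of the finitely many constraints whose Gaussian tail is at most
   exp(-d^2 u^2 / 2). Fernique's inequality, applied to the increments of X over short distances, makes
   the passage to all pairs in a Hausdorff neighbourhood cost no more than that, with arbitrarily fast
   Gaussian decay as the distance shrinks. Compactness of the collection reduces to finitely many such
   neighbourhoods.

   Gaussianity of all linear combinations determines joint laws through the Cramer-Wold device, which is
   derived from the one-dimensional uniqueness theorem of Levy. *)

theory Submission
  imports Defs
begin

section \<open>Square-integrable functions\<close>

text \<open>The oscillation of the paths has to be negligible at every rate
  \<open>A * u\<^sup>2\<close>. Fernique's inequality achieves this because its exponent is
  \<open>t\<^sup>2 / (32 * s\<^sup>2)\<close>, where \<open>s\<close> is any level that the
  increments respect with probability \<open>3 / 4\<close>; path continuity makes \<open>s\<close>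
  as small as desired at short distances. Levels and errors both scale linearly in \<open>u\<close>,
  so the oscillation enters the constraints as a fixed slack. Exact duality would ask for attained
  optima in the closure of the linear combinations. Instead the upper bound carries a slack
  \<open>e\<close> throughout: duality is approximate and stays within finite combinations, and the
  closure enters only when infeasibility of all its elements is turned into infeasibility with slack
  of finite combinations. Suprema over compact sets are taken over countable dense subsets, which
  gives measurability and access to statements about sequences. Strict inequalities do not survive
  limits, so they are always proved with a margin.\<close>

definition square_integrable :: "'w measure \<Rightarrow> ('w \<Rightarrow> real) \<Rightarrow> bool" where
  "square_integrable M f \<longleftrightarrow> f \<in> borel_measurable M \<and> integrable M (\<lambda>x. (f x)\<^sup>2)"

definition rms :: "'w measure \<Rightarrow> ('w \<Rightarrow> real) \<Rightarrow> real" where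
  "rms M f = sqrt (LINT x|M. (f x)\<^sup>2)"

lemma rms_nonneg [simp]: "0 \<le> rms M f"
  by (simp add: rms_def)

lemma rms_square: "(rms M f)\<^sup>2 = (LINT x|M. (f x)\<^sup>2)"
  by (simp add: rms_def)

lemma square_integrable_mult:
  assumes "square_integrable M f" "square_integrable M g"
  shows "integrable M (\<lambda>x. f x * g x)"
proof (rule Bochner_Integration.integrable_bound)
  show "integrable M (\<lambda>x. (f x)\<^sup>2 + (g x)\<^sup>2)"
    using assms by (simp add: square_integrable_def)
  show "(\<lambda>x. f x * g x) \<in> borel_measurable M"
    using assms unfolding square_integrable_def by (intro borel_measurable_times) auto
  show "AE x in M. norm (f x * g x) \<le> norm ((f x)\<^sup>2 + (g x)\<^sup>2)"
  proof (rule AE_I2)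
    fix x
    have "0 \<le> (\<bar>f x\<bar> - \<bar>g x\<bar>)\<^sup>2" by simp
    then have "2 * (\<bar>f x\<bar> * \<bar>g x\<bar>) \<le> (f x)\<^sup>2 + (g x)\<^sup>2"
      by (simp add: power2_diff)
    moreover have "0 \<le> \<bar>f x\<bar> * \<bar>g x\<bar>" by simp
    ultimately have "\<bar>f x\<bar> * \<bar>g x\<bar> \<le> (f x)\<^sup>2 + (g x)\<^sup>2" by linarith
    then show "norm (f x * g x) \<le> norm ((f x)\<^sup>2 + (g x)\<^sup>2)"
      by (simp add: abs_mult)
  qed
qed

lemma square_integrable_add:
  assumes "square_integrable M f" "square_integrable M g"
  shows "square_integrable M (\<lambda>x. f x + g x)"
  using assms square_integrable_mult[OF assms]
  by (auto simp: square_integrable_def power2_sum mult.assoc)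

lemma square_integrable_scale:
  "square_integrable M f \<Longrightarrow> square_integrable M (\<lambda>x. c * f x)"
  by (auto simp: square_integrable_def power_mult_distrib)

lemma square_integrable_diff:
  assumes "square_integrable M f" "square_integrable M g"
  shows "square_integrable M (\<lambda>x. f x - g x)"
  using square_integrable_add[OF assms(1) square_integrable_scale[OF assms(2), of "-1"]] by simp

lemma integral_square_add_scale:
  assumes "square_integrable M f" "square_integrable M g"
  shows "(LINT x|M. (f x + c * g x)\<^sup>2)
    = (LINT x|M. (f x)\<^sup>2) + 2 * c * (LINT x|M. f x * g x) + c\<^sup>2 * (LINT x|M. (g x)\<^sup>2)"
proof -
  have "(\<lambda>x. (f x + c * g x)\<^sup>2) = (\<lambda>x. (f x)\<^sup>2 + (2 * c) * (f x * g x) + c\<^sup>2 * (g x)\<^sup>2)"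
    by (auto simp: power2_eq_square algebra_simps)
  then show ?thesis
    using assms square_integrable_mult[OF assms] by (simp add: square_integrable_def)
qed

lemma Cauchy_Schwarz_integral:
  assumes f: "square_integrable M f" and g: "square_integrable M g"
  shows "\<bar>LINT x|M. f x * g x\<bar> \<le> rms M f * rms M g"
proof -
  define A B C where "A = (LINT x|M. (f x)\<^sup>2)" and "B = (LINT x|M. (g x)\<^sup>2)"
    and "C = (LINT x|M. f x * g x)"
  have quad: "0 \<le> A + 2 * c * C + c\<^sup>2 * B" for c
  proof -
    have "0 \<le> (LINT x|M. (f x + c * g x)\<^sup>2)" by simp
    then show ?thesis
      by (simp only: integral_square_add_scale[OF f g] A_def B_def C_def)
  qed
  have "A \<ge> 0" "B \<ge> 0" by (simp_all add: A_def B_def)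
  have "C\<^sup>2 \<le> A * B"
  proof (cases "B = 0")
    case True
    have "C = 0"
    proof (rule ccontr)
      assume "C \<noteq> 0"
      \<comment> \<open>For \<open>B = 0\<close> the quadratic is affine in \<open>c\<close>, and
        this \<open>c\<close> gives it the value \<open>-1\<close>.\<close>
      with quad[of "- (A + 1) / (2 * C)"] True show False by (simp add: field_simps)
    qed
    with True show ?thesis by simp
  next
    case False
    with \<open>B \<ge> 0\<close> have "B > 0" by simp
    have "A + 2 * (- C / B) * C + (- C / B)\<^sup>2 * B = (A * B - C\<^sup>2) / B"
      using \<open>B > 0\<close> by (simp add: field_simps power2_eq_square)
    with quad[of "- C / B"] \<open>B > 0\<close> show ?thesis by (simp add: zero_le_divide_iff)
  qed
  then have "\<bar>C\<bar> \<le> sqrt (A * B)" by (simp add: real_le_rsqrt)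
  then show ?thesis by (simp add: A_def B_def C_def rms_def real_sqrt_mult)
qed

lemma rms_add:
  assumes f: "square_integrable M f" and g: "square_integrable M g"
  shows "rms M (\<lambda>x. f x + g x) \<le> rms M f + rms M g"
proof -
  have "(rms M (\<lambda>x. f x + g x))\<^sup>2 = (rms M f)\<^sup>2 + 2 * (LINT x|M. f x * g x) + (rms M g)\<^sup>2"
    using integral_square_add_scale[OF f g, of 1] by (simp add: rms_square)
  also have "\<dots> \<le> (rms M f)\<^sup>2 + 2 * (rms M f * rms M g) + (rms M g)\<^sup>2"
    using Cauchy_Schwarz_integral[OF f g] by simp
  also have "\<dots> = (rms M f + rms M g)\<^sup>2" by (simp add: power2_sum)
  finally show ?thesis by (rule power2_le_imp_le) simp
qed

lemma rms_scale: "rms M (\<lambda>x. c * f x) = \<bar>c\<bar> * rms M f"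
  by (simp add: rms_def power_mult_distrib real_sqrt_mult)

lemma rms_diff_commute: "rms M (\<lambda>x. f x - g x) = rms M (\<lambda>x. g x - f x)"
  by (simp add: rms_def power2_commute)

lemma (in prob_space) expectation_abs_le_rms:
  assumes "square_integrable M f"
  shows "expectation (\<lambda>x. \<bar>f x\<bar>) \<le> rms M f" "integrable M f"
proof -
  have a: "square_integrable M (\<lambda>x. \<bar>f x\<bar>)" using assms by (auto simp: square_integrable_def)
  have 1: "square_integrable M (\<lambda>x. 1)" by (simp add: square_integrable_def)
  show "expectation (\<lambda>x. \<bar>f x\<bar>) \<le> rms M f"
    using Cauchy_Schwarz_integral[OF a 1] by (simp add: rms_def prob_space)
  show "integrable M f" using square_integrable_mult[OF assms 1] by simp
qed

text \<open>Riesz-Fischer for the seminorm \<open>rms\<close>. A subsequence whose increments have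
  L1 norm at most \<open>(1/2)^k\<close> converges almost everywhere; Fatou's lemma along it then
  bounds the distance of the limit to every late \<open>F n\<close>, not only to members of the
  subsequence.\<close>

lemma (in prob_space) square_integrable_complete:
  fixes F :: "nat \<Rightarrow> 'a \<Rightarrow> real"
  assumes F: "\<And>n. square_integrable M (F n)"
    and cauchy: "\<And>e. 0 < e \<Longrightarrow> \<exists>N. \<forall>m\<ge>N. \<forall>n\<ge>N. expectation (\<lambda>x. (F m x - F n x)\<^sup>2) < e"
  obtains H where "square_integrable M H" "(\<lambda>n. rms M (\<lambda>x. H x - F n x)) \<longlonglongrightarrow> 0"
proof -
  have [measurable]: "F n \<in> borel_measurable M" for n using F by (simp add: square_integrable_def)
  have "\<forall>k. \<exists>N. \<forall>m\<ge>N. \<forall>n\<ge>N. expectation (\<lambda>x. (F m x - F n x)\<^sup>2) < (1/4)^k"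
    by (intro allI cauchy) simp
  then obtain N0 where N0:
    "\<And>k m n. N0 k \<le> m \<Longrightarrow> N0 k \<le> n \<Longrightarrow> expectation (\<lambda>x. (F m x - F n x)\<^sup>2) < (1/4)^k"
    by metis
  \<comment> \<open>Adding the partial sums of \<open>N0\<close> makes \<open>r\<close> increasing
    and at least both \<open>N0 k\<close> and \<open>k\<close>, with no recursive choice.\<close>
  define r where "r k = k + (\<Sum>i\<le>k. N0 i)" for k
  have rN: "N0 k \<le> r k" for k
    unfolding r_def by (rule trans_le_add2, rule member_le_sum) auto
  have r_Suc: "r k \<le> r (Suc k)" for k by (simp add: r_def)
  have r_ge: "k \<le> r k" for k by (simp add: r_def)
  define G where "G k x = F (r (Suc k)) x - F (r k) x" for k x
  have G: "square_integrable M (G k)" for k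
    unfolding G_def by (intro square_integrable_diff F)
  have [measurable]: "G k \<in> borel_measurable M" for k using G by (simp add: square_integrable_def)
  have rmsG: "expectation (\<lambda>x. \<bar>G k x\<bar>) \<le> (1/2)^k" for k
  proof -
    have "expectation (\<lambda>x. (G k x)\<^sup>2) \<le> (1/4)^k"
      using N0[of k "r (Suc k)" "r k"] rN[of k] r_Suc[of k] by (simp add: G_def)
    moreover have "(1/4::real)^k = ((1/2)^k)\<^sup>2"
      by (subst power_mult[symmetric], subst mult.commute, subst power_mult) (simp add: power2_eq_square)
    ultimately have "rms M (G k) \<le> (1/2)^k"
      unfolding rms_def by (intro real_le_lsqrt) auto
    with expectation_abs_le_rms[OF G[of k]] show ?thesis by linarith
  qed
  have "(\<integral>\<^sup>+x. (\<Sum>k. ennreal \<bar>G k x\<bar>) \<partial>M) = (\<Sum>k. \<integral>\<^sup>+x. ennreal \<bar>G k x\<bar> \<partial>M)"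
    by (rule nn_integral_suminf) measurable
  also have "\<dots> \<le> (\<Sum>k. ennreal ((1/2)^k))"
  proof (rule suminf_le)
    fix k
    have "(\<integral>\<^sup>+x. ennreal \<bar>G k x\<bar> \<partial>M) = ennreal (expectation (\<lambda>x. \<bar>G k x\<bar>))"
      using expectation_abs_le_rms[OF G[of k]] by (intro nn_integral_eq_integral) auto
    also have "\<dots> \<le> ennreal ((1/2)^k)" by (intro ennreal_leI rmsG)
    finally show "(\<integral>\<^sup>+x. ennreal \<bar>G k x\<bar> \<partial>M) \<le> ennreal ((1/2)^k)" .
  qed auto
  also have "\<dots> = ennreal (\<Sum>k. (1/2)^k)"
    by (rule suminf_ennreal2) (auto intro: summable_geometric)
  also have "\<dots> < \<infinity>" by simp
  finally have "(\<integral>\<^sup>+x. (\<Sum>k. ennreal \<bar>G k x\<bar>) \<partial>M) \<noteq> \<infinity>" by simp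
  then have "AE x in M. (\<Sum>k. ennreal \<bar>G k x\<bar>) \<noteq> \<infinity>"
    by (intro nn_integral_noteq_infinite) measurable
  then have conv: "AE x in M. convergent (\<lambda>k. F (r k) x)"
  proof (rule AE_mp, intro AE_I2 impI)
    fix x assume "(\<Sum>k. ennreal \<bar>G k x\<bar>) \<noteq> \<infinity>"
    then have "summable (\<lambda>k. \<bar>G k x\<bar>)"
      by (intro summable_suminf_not_top) auto
    then have "summable (\<lambda>k. G k x)" by (rule summable_rabs_cancel)
    moreover have "(\<Sum>k<n. G k x) = F (r n) x - F (r 0) x" for n
      unfolding G_def by (rule sum_lessThan_telescope)
    ultimately have "convergent (\<lambda>n. F (r n) x - F (r 0) x)"
      by (simp add: summable_iff_convergent)
    then show "convergent (\<lambda>k. F (r k) x)"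
      using convergent_add[OF _ convergent_const, of _ "F (r 0) x"] by fastforce
  qed
  define H where "H x = lim (\<lambda>k. F (r k) x)" for x
  have H[measurable]: "H \<in> borel_measurable M"
    unfolding H_def by measurable
  have limH: "AE x in M. (\<lambda>k. F (r k) x) \<longlonglongrightarrow> H x"
    using conv by eventually_elim (simp add: H_def convergent_LIMSEQ_iff)
  have fatou: "square_integrable M (\<lambda>x. H x - F n x) \<and> expectation (\<lambda>x. (H x - F n x)\<^sup>2) \<le> e"
    if e: "0 < e" and N: "\<forall>m\<ge>N. \<forall>n\<ge>N. expectation (\<lambda>x. (F m x - F n x)\<^sup>2) < e" and "n \<ge> N"
    for e N n
  proof -
    have "(\<integral>\<^sup>+x. ennreal ((H x - F n x)\<^sup>2) \<partial>M)
        = (\<integral>\<^sup>+x. liminf (\<lambda>k. ennreal ((F (r k) x - F n x)\<^sup>2)) \<partial>M)"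
    proof (rule nn_integral_cong_AE, use limH in eventually_elim)
      fix x assume "(\<lambda>k. F (r k) x) \<longlonglongrightarrow> H x"
      then have "(\<lambda>k. ennreal ((F (r k) x - F n x)\<^sup>2)) \<longlonglongrightarrow> ennreal ((H x - F n x)\<^sup>2)"
        by (intro tendsto_ennrealI tendsto_intros)
      then show "ennreal ((H x - F n x)\<^sup>2) = liminf (\<lambda>k. ennreal ((F (r k) x - F n x)\<^sup>2))"
        by (intro lim_imp_Liminf[symmetric]) auto
    qed
    also have "\<dots> \<le> liminf (\<lambda>k. \<integral>\<^sup>+x. ennreal ((F (r k) x - F n x)\<^sup>2) \<partial>M)"
      by (rule nn_integral_liminf) measurable
    also have "\<dots> \<le> liminf (\<lambda>k. ennreal e)"
    proof (rule Liminf_mono, rule eventually_sequentiallyI[of N])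
      fix k assume "k \<ge> N"
      have "integrable M (\<lambda>x. (F (r k) x - F n x)\<^sup>2)"
        using square_integrable_diff[OF F F] by (simp add: square_integrable_def)
      then have "(\<integral>\<^sup>+x. ennreal ((F (r k) x - F n x)\<^sup>2) \<partial>M)
          = ennreal (expectation (\<lambda>x. (F (r k) x - F n x)\<^sup>2))"
        by (intro nn_integral_eq_integral) auto
      also have "\<dots> \<le> ennreal e"
        using N \<open>n \<ge> N\<close> \<open>k \<ge> N\<close> r_ge[of k] by (intro ennreal_leI) (meson less_imp_le order_trans)
      finally show "(\<integral>\<^sup>+x. ennreal ((F (r k) x - F n x)\<^sup>2) \<partial>M) \<le> ennreal e" .
    qed
    also have "\<dots> = ennreal e" by (simp add: Liminf_const)
    finally have le: "(\<integral>\<^sup>+x. ennreal ((H x - F n x)\<^sup>2) \<partial>M) \<le> ennreal e" .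
    then have int: "integrable M (\<lambda>x. (H x - F n x)\<^sup>2)"
      by (intro integrableI_nonneg) (auto simp: le_less_trans)
    moreover have "expectation (\<lambda>x. (H x - F n x)\<^sup>2) \<le> e"
      using le e nn_integral_eq_integral[OF int] by (simp add: ennreal_le_iff)
    ultimately show ?thesis by (simp add: square_integrable_def)
  qed
  obtain N where "\<forall>m\<ge>N. \<forall>n\<ge>N. expectation (\<lambda>x. (F m x - F n x)\<^sup>2) < 1"
    using cauchy[of 1] by auto
  with fatou[of 1 N N] have "square_integrable M (\<lambda>x. H x - F N x)" by simp
  from square_integrable_add[OF this F[of N]] have "square_integrable M H" by simp
  moreover have "(\<lambda>n. rms M (\<lambda>x. H x - F n x)) \<longlonglongrightarrow> 0"
  proof (rule LIMSEQ_I)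
    fix \<epsilon> :: real assume "0 < \<epsilon>"
    then have e: "0 < (\<epsilon> / 2)\<^sup>2" by simp
    obtain N where N: "\<forall>m\<ge>N. \<forall>n\<ge>N. expectation (\<lambda>x. (F m x - F n x)\<^sup>2) < (\<epsilon> / 2)\<^sup>2"
      using cauchy[OF e] by auto
    have "rms M (\<lambda>x. H x - F n x) \<le> \<epsilon> / 2" if "n \<ge> N" for n
      unfolding rms_def using fatou[OF e N that] \<open>0 < \<epsilon>\<close> by (intro real_le_lsqrt) auto
    then show "\<exists>N. \<forall>n\<ge>N. norm (rms M (\<lambda>x. H x - F n x) - 0) < \<epsilon>"
      using \<open>0 < \<epsilon>\<close> by (intro exI[of _ N]) (fastforce simp: abs_of_nonneg)
  qed
  ultimately show ?thesis by (rule that)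
qed

section \<open>Uniqueness of joint laws\<close>

text \<open>Divided by their common mass \<open>\<kappa>\<close> the weights become probability
  densities. The images of these measures under \<open>V\<close> and \<open>W\<close> are laws on
  the line, and the given integrals, divided by \<open>\<kappa>\<close>, are the real and imaginary
  parts of their characteristic functions. The masses agree by the cosine hypothesis at
  \<open>s = 0\<close>.\<close>

lemma weighted_Levy_uniqueness:
  fixes w :: "'a \<Rightarrow> real" and w' :: "'b \<Rightarrow> real"
  assumes "prob_space M" "prob_space N"
    and [measurable]: "w \<in> borel_measurable M" "w' \<in> borel_measurable N"
      "V \<in> borel_measurable M" "W \<in> borel_measurable N"
    and w: "\<And>x. 0 \<le> w x" "\<And>x. w x \<le> K" and w': "\<And>x. 0 \<le> w' x" "\<And>x. w' x \<le> K"
    and c: "\<And>s. (LINT x|M. w x * cos (s * V x)) = (LINT x|N. w' x * cos (s * W x))"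
    and s: "\<And>s. (LINT x|M. w x * sin (s * V x)) = (LINT x|N. w' x * sin (s * W x))"
    and B: "B \<in> sets borel"
  shows "(LINT x|M. w x * indicator B (V x)) = (LINT x|N. w' x * indicator B (W x))"
proof -
  interpret M: prob_space M by fact
  interpret N: prob_space N by fact
  define \<kappa> where "\<kappa> = (LINT x|M. w x)"
  have \<kappa>': "\<kappa> = (LINT x|N. w' x)" using c[of 0] by (simp add: \<kappa>_def)
  have intw: "integrable M (\<lambda>x. w x * f x)" if [measurable]: "f \<in> borel_measurable M"
    and f: "\<And>x. \<bar>f x\<bar> \<le> 1" for f
  proof (rule M.integrable_const_bound[where B = K])
    show "AE x in M. norm (w x * f x) \<le> K"
    proof (rule AE_I2)
      fix x
      have "w x * \<bar>f x\<bar> \<le> w x" by (rule mult_left_le[OF f w(1)])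
      with w[of x] show "norm (w x * f x) \<le> K" by (simp add: abs_mult)
    qed
  qed measurable
  have intw': "integrable N (\<lambda>x. w' x * f x)" if [measurable]: "f \<in> borel_measurable N"
    and f: "\<And>x. \<bar>f x\<bar> \<le> 1" for f
  proof (rule N.integrable_const_bound[where B = K])
    show "AE x in N. norm (w' x * f x) \<le> K"
    proof (rule AE_I2)
      fix x
      have "w' x * \<bar>f x\<bar> \<le> w' x" by (rule mult_left_le[OF f w'(1)])
      with w'[of x] show "norm (w' x * f x) \<le> K" by (simp add: abs_mult)
    qed
  qed measurable
  have iw: "integrable M w" "integrable N w'"
    using intw[of "\<lambda>_. 1"] intw'[of "\<lambda>_. 1"] by auto
  show ?thesis
  proof (cases "\<kappa> = 0")
    \<comment> \<open>Zero mass admits no normalisation, but then both weights vanish almost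
      everywhere.\<close>
    case True
    have "AE x in M. w x = 0"
      using True iw w integral_nonneg_eq_0_iff_AE[of M w] by (simp add: \<kappa>_def)
    then have "(LINT x|M. w x * indicator B (V x)) = (LINT x|M. 0)"
      by (intro integral_cong_AE) (use B in auto)
    moreover have "AE x in N. w' x = 0"
      using True iw w' integral_nonneg_eq_0_iff_AE[of N w'] by (simp add: \<kappa>')
    then have "(LINT x|N. w' x * indicator B (W x)) = (LINT x|N. 0)"
      by (intro integral_cong_AE) (use B in auto)
    ultimately show ?thesis by simp
  next
    case False
    then have pos: "\<kappa> > 0" using w by (simp add: \<kappa>_def less_le)
    define \<mu> where "\<mu> = distr (density M (\<lambda>x. ennreal (w x / \<kappa>))) borel V"
    define \<nu> where "\<nu> = distr (density N (\<lambda>x. ennreal (w' x / \<kappa>))) borel W"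
    have "(\<integral>\<^sup>+x. ennreal (w x / \<kappa>) \<partial>M) = ennreal (LINT x|M. w x / \<kappa>)"
      using iw w pos by (intro nn_integral_eq_integral) auto
    then have "emeasure (density M (\<lambda>x. ennreal (w x / \<kappa>))) (space M) = 1"
      using pos by (simp add: emeasure_density \<kappa>_def[symmetric] cong: nn_integral_cong_simp)
    then have "prob_space (density M (\<lambda>x. ennreal (w x / \<kappa>)))" by (intro prob_spaceI) simp
    then have "prob_space \<mu>" unfolding \<mu>_def by (rule prob_space.prob_space_distr) simp
    then have \<mu>: "real_distribution \<mu>" by (simp add: real_distribution_def real_distribution_axioms_def \<mu>_def)
    have "(\<integral>\<^sup>+x. ennreal (w' x / \<kappa>) \<partial>N) = ennreal (LINT x|N. w' x / \<kappa>)"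
      using iw w' pos by (intro nn_integral_eq_integral) auto
    then have "emeasure (density N (\<lambda>x. ennreal (w' x / \<kappa>))) (space N) = 1"
      using pos by (simp add: emeasure_density \<kappa>'[symmetric] cong: nn_integral_cong_simp)
    then have "prob_space (density N (\<lambda>x. ennreal (w' x / \<kappa>)))" by (intro prob_spaceI) simp
    then have "prob_space \<nu>" unfolding \<nu>_def by (rule prob_space.prob_space_distr) simp
    then have \<nu>: "real_distribution \<nu>" by (simp add: real_distribution_def real_distribution_axioms_def \<nu>_def)
    have "char \<mu> = char \<nu>"
    proof
      fix t
      have iexp: "iexp y = complex_of_real (cos y) + \<i> * complex_of_real (sin y)" for y
        by (simp flip: cis_conv_exp add: complex_eq_iff)
      have "char \<mu> t = (LINT x|M. (w x / \<kappa>) *\<^sub>R iexp (t * V x))"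
        unfolding char_def \<mu>_def using w pos
        by (subst integral_distr) (auto simp: integral_density)
      also have "\<dots> = (LINT x|M. complex_of_real (w x * cos (t * V x)) / \<kappa>
          + \<i> * complex_of_real (w x * sin (t * V x)) / \<kappa>)"
        by (intro Bochner_Integration.integral_cong refl)
           (simp only: iexp, simp add: scaleR_conv_of_real field_simps add_divide_distrib)
      also have "\<dots> = complex_of_real (LINT x|M. w x * cos (t * V x)) / \<kappa>
          + \<i> * complex_of_real (LINT x|M. w x * sin (t * V x)) / \<kappa>"
        using intw[of "\<lambda>x. cos (t * V x)"] intw[of "\<lambda>x. sin (t * V x)"]
        by (subst Bochner_Integration.integral_add) (auto simp del: of_real_mult)
      also have "\<dots> = complex_of_real (LINT x|N. w' x * cos (t * W x)) / \<kappa>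
          + \<i> * complex_of_real (LINT x|N. w' x * sin (t * W x)) / \<kappa>"
        by (simp only: c s)
      also have "\<dots> = (LINT x|N. complex_of_real (w' x * cos (t * W x)) / \<kappa>
          + \<i> * complex_of_real (w' x * sin (t * W x)) / \<kappa>)"
        using intw'[of "\<lambda>x. cos (t * W x)"] intw'[of "\<lambda>x. sin (t * W x)"]
        by (subst Bochner_Integration.integral_add) (auto simp del: of_real_mult)
      also have "\<dots> = (LINT x|N. (w' x / \<kappa>) *\<^sub>R iexp (t * W x))"
        by (intro Bochner_Integration.integral_cong refl)
           (simp only: iexp, simp add: scaleR_conv_of_real field_simps add_divide_distrib)
      also have "\<dots> = char \<nu> t"
        unfolding char_def \<nu>_def using w' pos
        by (subst integral_distr) (auto simp: integral_density)
      finally show "char \<mu> t = char \<nu> t" .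
    qed
    then have eq: "\<mu> = \<nu>" by (rule Levy_uniqueness[OF \<mu> \<nu>])
    have "(LINT y|\<mu>. indicator B y) = (LINT x|M. (w x / \<kappa>) * indicator B (V x))"
      unfolding \<mu>_def using w pos B
      by (subst integral_distr) (auto simp: integral_density)
    moreover have "(LINT y|\<nu>. indicator B y) = (LINT x|N. (w' x / \<kappa>) * indicator B (W x))"
      unfolding \<nu>_def using w' pos B
      by (subst integral_distr) (auto simp: integral_density)
    ultimately have "(LINT x|M. w x * indicator B (V x)) / \<kappa> = (LINT x|N. w' x * indicator B (W x)) / \<kappa>"
      using eq by simp
    then show ?thesis using pos by simp
  qed
qed

text \<open>Product-to-sum formulas. The first two parts express the cosine and sine transforms of
  \<open>Y\<close> under the weight \<open>w * (1 + cos (S + b))\<close> by integrals of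
  \<open>w\<close> against cosines of affine phases, the only integrals about which the Cramer-Wold
  hypothesis speaks; a sine is a cosine shifted by \<open>pi / 2\<close>. The third part recovers
  \<open>cos (S + b)\<close> from two nonnegative weights, as adding \<open>pi\<close> to
  \<open>b\<close> flips the sign. The literal \<open>0 +\<close> gives all phases one shape for
  rewriting.\<close>

lemma integral_weight_cos_times:
  assumes "prob_space M"
    and [measurable]: "w \<in> borel_measurable M" "Y \<in> borel_measurable M" "S \<in> borel_measurable M"
      "g \<in> borel_measurable M"
    and w: "\<And>x. 0 \<le> w x" "\<And>x. w x \<le> (K::real)" and g: "\<And>x. \<bar>g x\<bar> \<le> (1::real)"
  shows "(LINT x|M. (w x * (1 + cos (S x + b))) * cos (s * Y x))
      = (LINT x|M. w x * cos (s * Y x + (0 + 0))) + (LINT x|M. w x * cos (s * Y x + (S x + b))) / 2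
        + (LINT x|M. w x * cos (- s * Y x + (S x + b))) / 2" (is ?A)
    and "(LINT x|M. (w x * (1 + cos (S x + b))) * sin (s * Y x))
      = (LINT x|M. w x * cos (s * Y x + (0 + - (pi / 2))))
        + (LINT x|M. w x * cos (s * Y x + (S x + (b - pi / 2)))) / 2
        - (LINT x|M. w x * cos (- s * Y x + (S x + (b - pi / 2)))) / 2" (is ?B)
    and "(LINT x|M. (w x * g x) * cos (S x + b))
      = ((LINT x|M. (w x * (1 + cos (S x + b))) * g x)
        - (LINT x|M. (w x * (1 + cos (S x + (b + pi)))) * g x)) / 2" (is ?C)
proof -
  interpret prob_space M by fact
  have int: "integrable M (\<lambda>x. w x * f x)" if [measurable]: "f \<in> borel_measurable M"
    and f: "\<And>x. \<bar>f x\<bar> \<le> 2" for f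
  proof (rule integrable_const_bound[where B = "K * 2"])
    show "AE x in M. norm (w x * f x) \<le> K * 2"
    proof (rule AE_I2)
      fix x
      have "w x * \<bar>f x\<bar> \<le> K * 2"
        using w f by (intro mult_mono) (auto intro: order_trans)
      with w show "norm (w x * f x) \<le> K * 2" by (simp add: abs_mult)
    qed
  qed measurable
  have int_cos: "integrable M (\<lambda>x. w x * cos (f x))" if [measurable]: "f \<in> borel_measurable M" for f
    by (rule int) (auto intro: order_trans[OF abs_cos_le_one])
  have cc: "w x * (1 + cos z) * cos y
      = w x * cos (y + (0 + 0)) + w x * cos (y + z) / 2 + w x * cos (- y + z) / 2" for x y z
    by (simp add: cos_add cos_diff field_simps)
  have shift: "cos (u + (v - pi / 2)) = sin (u + v)" for u v
    by (simp add: cos_diff sin_diff cos_add sin_add)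
  have shift0: "cos (u + (0 + - (pi / 2))) = sin u" for u
    by (simp add: cos_diff)
  have cs: "w x * (1 + cos z) * sin y
      = w x * cos (y + (0 + - (pi / 2))) + w x * cos (y + (z - pi / 2)) / 2
        - w x * cos (- y + (z - pi / 2)) / 2" for x y z
    by (simp only: shift shift0) (simp add: sin_add sin_diff field_simps)
  show ?A using int_cos by (simp only: cc mult_minus_left) (simp add: int_cos)
  have [simp]: "S x + (b - pi / 2) = (S x + b) - pi / 2" for x by simp
  show ?B using int_cos by (simp only: cs mult_minus_left \<open>\<And>x. S x + (b - pi / 2) = (S x + b) - pi / 2\<close>)
    (simp add: int_cos)
  have bd: "\<bar>(1 + cos y) * g x\<bar> \<le> 2" for x y
  proof -
    have "\<bar>1 + cos y\<bar> \<le> 2" using cos_le_one[of y] cos_ge_minus_one[of y] by linarith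
    then have "\<bar>1 + cos y\<bar> * \<bar>g x\<bar> \<le> 2 * 1" by (rule mult_mono[OF _ g]) auto
    then show ?thesis by (simp add: abs_mult)
  qed
  have eq: "(w x * g x) * cos (S x + b)
      = (w x * ((1 + cos (S x + b)) * g x) - w x * ((1 + cos (S x + (b + pi))) * g x)) / 2" for x
  proof -
    have "cos (S x + (b + pi)) = - cos (S x + b)"
      by (simp only: add.assoc[symmetric] cos_periodic_pi)
    then show ?thesis by (simp only:) (simp add: field_simps)
  qed
  have "integrable M (\<lambda>x. w x * ((1 + cos (S x + b)) * g x))"
    "integrable M (\<lambda>x. w x * ((1 + cos (S x + (b + pi))) * g x))"
    by (intro int bd; measurable)+
  then show ?C by (simp only: eq) (simp only: mult.assoc integral_divide_zero Bochner_Integration.integral_diff)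
qed

text \<open>Induction on the number of coordinates: the weights \<open>w * (1 + cos (S + b))\<close> are nonnegative, so the
  one-dimensional theorem applies to the new coordinate; subtracting the cases \<open>b\<close> and \<open>b + pi\<close>
  recovers the hypothesis for the remaining coordinates with an indicator added to the weight.\<close>

lemma weighted_Cramer_Wold:
  fixes V :: "'i \<Rightarrow> 'a \<Rightarrow> real" and W :: "'i \<Rightarrow> 'b \<Rightarrow> real"
  assumes "finite I" and M: "prob_space M" and N: "prob_space N"
    and "\<And>i. i \<in> I \<Longrightarrow> V i \<in> borel_measurable M" "\<And>i. i \<in> I \<Longrightarrow> W i \<in> borel_measurable N"
    and "\<And>i. i \<in> I \<Longrightarrow> B i \<in> sets borel"
    and "w \<in> borel_measurable M" "w' \<in> borel_measurable N"
    and "\<And>x. 0 \<le> w x" "\<And>x. w x \<le> (1::real)" "\<And>x. 0 \<le> w' x" "\<And>x. w' x \<le> (1::real)"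
    and "\<And>a b. (LINT x|M. w x * cos ((\<Sum>i\<in>I. a i * V i x) + b))
      = (LINT x|N. w' x * cos ((\<Sum>i\<in>I. a i * W i x) + b))"
  shows "(LINT x|M. w x * (\<Prod>i\<in>I. indicator (B i) (V i x)))
      = (LINT x|N. w' x * (\<Prod>i\<in>I. indicator (B i) (W i x)))"
  using assms(1,4-)
proof (induction I arbitrary: w w' rule: finite_induct)
  case empty
  from empty(10)[of _ 0] show ?case by simp
next
  case (insert j I)
  note [measurable] = insert.prems(4,5)
  have [measurable]: "V j \<in> borel_measurable M" "W j \<in> borel_measurable N" "B j \<in> sets borel"
    using insert.prems by auto
  have VI[measurable]: "(\<lambda>x. \<Sum>i\<in>I. a i * V i x) \<in> borel_measurable M"
    and WI[measurable]: "(\<lambda>x. \<Sum>i\<in>I. a i * W i x) \<in> borel_measurable N" for a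
    using insert.prems by (auto intro!: borel_measurable_sum borel_measurable_times)
  \<comment> \<open>The new coordinate is singled out by prescribing its coefficient as
    \<open>c\<close>; \<open>eq0\<close> is the case in which the other coordinates are
    absent.\<close>
  have eq: "(LINT x|M. w x * cos (c * V j x + ((\<Sum>i\<in>I. a i * V i x) + b)))
      = (LINT x|N. w' x * cos (c * W j x + ((\<Sum>i\<in>I. a i * W i x) + b)))" for a b c
  proof -
    have "(\<Sum>i\<in>I. (if i = j then c else a i) * f i) = (\<Sum>i\<in>I. a i * f i)" for f :: "'i \<Rightarrow> real"
      using insert.hyps by (intro sum.cong) auto
    then show ?thesis
      using insert.prems(10)[of "\<lambda>i. if i = j then c else a i" b] insert.hyps
      by (simp add: add.assoc)
  qed
  have eq0: "(LINT x|M. w x * cos (c * V j x + (0 + b)))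
      = (LINT x|N. w' x * cos (c * W j x + (0 + b)))" for b c
    using eq[of c "\<lambda>_. 0" b] by simp
  have step: "(LINT x|M. (w x * (1 + cos ((\<Sum>i\<in>I. a i * V i x) + b))) * indicator (B j) (V j x))
      = (LINT x|N. (w' x * (1 + cos ((\<Sum>i\<in>I. a i * W i x) + b))) * indicator (B j) (W j x))" for a b
  proof (rule weighted_Levy_uniqueness[OF M N, where K = 2])
    have bd: "0 \<le> u * (1 + cos y) \<and> u * (1 + cos y) \<le> 2" if "0 \<le> u" "u \<le> 1" for u y :: real
    proof -
      have n: "0 \<le> 1 + cos y" "1 + cos y \<le> 2"
        using cos_ge_minus_one[of y] cos_le_one[of y] by linarith+
      have "u * (1 + cos y) \<le> 1 * 2"
        using that n by (intro mult_mono) linarith+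
      then show ?thesis using that n by (simp add: mult_nonneg_nonneg)
    qed
    show "0 \<le> w x * (1 + cos ((\<Sum>i\<in>I. a i * V i x) + b))"
      "w x * (1 + cos ((\<Sum>i\<in>I. a i * V i x) + b)) \<le> 2" for x
      using bd insert.prems by auto
    show "0 \<le> w' x * (1 + cos ((\<Sum>i\<in>I. a i * W i x) + b))"
      "w' x * (1 + cos ((\<Sum>i\<in>I. a i * W i x) + b)) \<le> 2" for x
      using bd insert.prems by auto
    have one: "\<bar>1 :: real\<bar> \<le> 1" by simp
    note m = integral_weight_cos_times[OF M insert.prems(4) \<open>V j \<in> _\<close> VI
        borel_measurable_const insert.prems(6,7) one]
    note n = integral_weight_cos_times[OF N insert.prems(5) \<open>W j \<in> _\<close> WI
        borel_measurable_const insert.prems(8,9) one]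
    fix s
    show "(LINT x|M. (w x * (1 + cos ((\<Sum>i\<in>I. a i * V i x) + b))) * cos (s * V j x))
      = (LINT x|N. (w' x * (1 + cos ((\<Sum>i\<in>I. a i * W i x) + b))) * cos (s * W j x))"
      by (simp only: m(1) n(1) eq eq0)
    show "(LINT x|M. (w x * (1 + cos ((\<Sum>i\<in>I. a i * V i x) + b))) * sin (s * V j x))
      = (LINT x|N. (w' x * (1 + cos ((\<Sum>i\<in>I. a i * W i x) + b))) * sin (s * W j x))"
      by (simp only: m(2) n(2) eq eq0)
  qed measurable
  have ind: "\<bar>indicator (B j) y :: real\<bar> \<le> 1" for y by simp
  have gM: "(\<lambda>x. indicator (B j) (V j x) :: real) \<in> borel_measurable M"
    and gN: "(\<lambda>x. indicator (B j) (W j x) :: real) \<in> borel_measurable N" by measurable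
  note m3 = integral_weight_cos_times(3)[OF M insert.prems(4) \<open>V j \<in> _\<close> VI gM insert.prems(6,7) ind]
  note n3 = integral_weight_cos_times(3)[OF N insert.prems(5) \<open>W j \<in> _\<close> WI gN insert.prems(8,9) ind]
  \<comment> \<open>With the indicator absorbed the weight still lies between \<open>0\<close> and
    \<open>1\<close>, so the induction hypothesis applies to it.\<close>
  have "(LINT x|M. (w x * indicator (B j) (V j x)) * (\<Prod>i\<in>I. indicator (B i) (V i x)))
      = (LINT x|N. (w' x * indicator (B j) (W j x)) * (\<Prod>i\<in>I. indicator (B i) (W i x)))"
  proof (rule insert.IH)
    fix a b
    show "(LINT x|M. w x * indicator (B j) (V j x) * cos ((\<Sum>i\<in>I. a i * V i x) + b))
      = (LINT x|N. w' x * indicator (B j) (W j x) * cos ((\<Sum>i\<in>I. a i * W i x) + b))"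
      by (simp only: m3 n3 step)
  qed (use insert.prems in \<open>auto intro: mult_le_one simp: indicator_def\<close>)
  then show ?case using insert.hyps by (simp add: mult.assoc)
qed

text \<open>The factor \<open>1\<close> is the constant weight at which
  \<open>weighted_Cramer_Wold\<close> is applied.\<close>

lemma measure_box_eq_integral:
  fixes U :: "'i \<Rightarrow> 'c \<Rightarrow> real"
  assumes L: "prob_space L" and I: "finite I" and U: "\<And>i. i \<in> I \<Longrightarrow> U i \<in> borel_measurable L"
    and B: "\<And>i. i \<in> I \<Longrightarrow> B i \<in> sets borel"
  shows "measure L {x \<in> space L. \<forall>i\<in>I. U i x \<in> B i}
    = (LINT x|L. 1 * (\<Prod>i\<in>I. indicator (B i) (U i x)))"
proof -
  interpret prob_space L by fact
  have [measurable]: "{x \<in> space L. \<forall>i\<in>I. U i x \<in> B i} \<in> sets L"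
    using I U B by measurable
  have ind: "1 * (\<Prod>i\<in>I. indicator (B i) (U i x))
      = (indicator {x \<in> space L. \<forall>i\<in>I. U i x \<in> B i} x :: real)" if "x \<in> space L" for x
  proof (cases "\<forall>i\<in>I. U i x \<in> B i")
    case False
    then have "(\<Prod>i\<in>I. indicator (B i) (U i x) :: real) = 0"
      by (intro prod_zero I) (auto simp: indicator_def)
    with False show ?thesis by (simp add: indicator_def)
  qed (use that in \<open>simp add: indicator_def\<close>)
  have "(LINT x|L. 1 * (\<Prod>i\<in>I. indicator (B i) (U i x)))
      = (LINT x|L. (indicator {x \<in> space L. \<forall>i\<in>I. U i x \<in> B i} x :: real))"
    by (rule Bochner_Integration.integral_cong[OF refl ind])
  then show ?thesis by simp
qed

text \<open>The free phase \<open>b\<close> lets one real hypothesis carry the whole joint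
  characteristic function: \<open>b = 0\<close> gives its real part, \<open>b = - pi / 2\<close> its
  imaginary part.\<close>

theorem Cramer_Wold:
  fixes V :: "'i \<Rightarrow> 'a \<Rightarrow> real" and W :: "'i \<Rightarrow> 'b \<Rightarrow> real"
  assumes I: "finite I" and M: "prob_space M" and N: "prob_space N"
    and V: "\<And>i. i \<in> I \<Longrightarrow> V i \<in> borel_measurable M"
    and W: "\<And>i. i \<in> I \<Longrightarrow> W i \<in> borel_measurable N"
    and B: "\<And>i. i \<in> I \<Longrightarrow> B i \<in> sets borel"
    and eq: "\<And>a b. (LINT x|M. cos ((\<Sum>i\<in>I. a i * V i x) + b))
      = (LINT x|N. cos ((\<Sum>i\<in>I. a i * W i x) + b))"
  shows "measure M {x \<in> space M. \<forall>i\<in>I. V i x \<in> B i} = measure N {x \<in> space N. \<forall>i\<in>I. W i x \<in> B i}"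
proof -
  have "(LINT x|M. 1 * (\<Prod>i\<in>I. indicator (B i) (V i x)))
      = (LINT x|N. 1 * (\<Prod>i\<in>I. indicator (B i) (W i x) :: real))"
    by (rule weighted_Cramer_Wold[where w = "\<lambda>_. 1" and w' = "\<lambda>_. 1", OF I M N V W B])
      (auto simp: eq)
  then show ?thesis
    using measure_box_eq_integral[OF M I V B] measure_box_eq_integral[OF N I W B] by simp
qed

section \<open>Centered Gaussian systems\<close>

text \<open>Up to the finite-dimensional duality only linearity, Gaussianity and centering of the
  family matter, so the index set is abstracted away. \<open>S\<close> may be empty, as the linear
  combinations over an empty \<open>T\<close> are; hence the explicit premises
  \<open>S \<noteq> {}\<close> below.\<close>

locale centered_gaussian_system = prob_space M for M :: "'w measure" +
  fixes S :: "('w \<Rightarrow> real) set"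
  assumes add: "f \<in> S \<Longrightarrow> g \<in> S \<Longrightarrow> (\<lambda>x. f x + g x) \<in> S"
    and scale: "f \<in> S \<Longrightarrow> (\<lambda>x. c * f x) \<in> S"
    and gaussian: "f \<in> S \<Longrightarrow> gaussian_rv M f"
    and centered: "f \<in> S \<Longrightarrow> integrable M f" "f \<in> S \<Longrightarrow> expectation f = 0"
begin

lemma diff: "f \<in> S \<Longrightarrow> g \<in> S \<Longrightarrow> (\<lambda>x. f x - g x) \<in> S"
  using add[of f "\<lambda>x. (-1) * g x"] scale[of g "-1"] by simp

lemma sum_mem: "finite I \<Longrightarrow> I \<noteq> {} \<Longrightarrow> (\<And>i. i \<in> I \<Longrightarrow> f i \<in> S) \<Longrightarrow> (\<lambda>x. \<Sum>i\<in>I. f i x) \<in> S"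
  by (induction I rule: finite_ne_induct) (auto intro: add)

lemma combination_mem:
  assumes "finite I" "S \<noteq> {}" "\<And>i. i \<in> I \<Longrightarrow> f i \<in> S"
  shows "(\<lambda>x. \<Sum>i\<in>I. a i * f i x) \<in> S"
proof (cases "I = {}")
  case True
  from \<open>S \<noteq> {}\<close> obtain g where "g \<in> S" by auto
  from scale[OF this, of 0] True show ?thesis by simp
qed (use assms in \<open>auto intro!: sum_mem scale\<close>)

lemma borel_measurable [measurable_dest]: "f \<in> S \<Longrightarrow> f \<in> borel_measurable M"
  using gaussian by (auto simp: gaussian_rv_def)

text \<open>Centering forces the mean in \<open>gaussian_rv\<close> to be \<open>0\<close> and
  identifies the standard deviation with \<open>rms M f\<close>, so the law of a member of
  \<open>S\<close> is fixed by its second moment.\<close>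

lemma gaussian_cases [consumes 1, case_names null normal]:
  assumes "f \<in> S"
  obtains "AE x in M. f x = 0" "square_integrable M f" "rms M f = 0"
    | "distributed M lborel f (normal_density 0 (rms M f))" "square_integrable M f" "0 < rms M f"
proof -
  note [measurable] = borel_measurable[OF assms]
  from gaussian[OF assms] consider \<mu> where "AE x in M. f x = \<mu>"
    | \<mu> \<sigma> where "0 < \<sigma>" "distributed M lborel f (normal_density \<mu> \<sigma>)"
    unfolding gaussian_rv_def by blast
  then show thesis
  proof cases
    case (1 \<mu>)
    then have "expectation f = expectation (\<lambda>x. \<mu>)" by (intro integral_cong_AE) auto
    with centered[OF assms] have "\<mu> = 0" by (simp add: prob_space)
    with 1 have f0: "AE x in M. f x = 0" by simp
    then have "integrable M (\<lambda>x. (f x)\<^sup>2) \<longleftrightarrow> integrable M (\<lambda>x. 0 :: real)"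
      by (intro integrable_cong_AE) auto
    moreover have "expectation (\<lambda>x. (f x)\<^sup>2) = expectation (\<lambda>x. 0)"
      using f0 by (intro integral_cong_AE) auto
    ultimately show thesis using f0 that(1) by (simp add: square_integrable_def rms_def)
  next
    case (2 \<mu> \<sigma>)
    have "\<mu> = 0" using normal_distributed_expectation[OF 2] centered[OF assms] by simp
    then have D: "distributed M lborel f (normal_density 0 \<sigma>)" using 2 by simp
    have "expectation (\<lambda>x. (f x)\<^sup>2) = \<sigma>\<^sup>2"
      using normal_distributed_variance[OF 2] centered[OF assms] by simp
    with 2 have rms: "rms M f = \<sigma>" by (simp add: rms_def)
    have "integrable M (\<lambda>x. (f x)\<^sup>2)"
      using distributed_integrable[OF D, of "\<lambda>x. x\<^sup>2"] integrable_normal_moment[OF 2(1), of 0 2]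
      by simp
    with rms D 2 show thesis using that(2) by (simp add: square_integrable_def)
  qed
qed

lemma square_integrable: "f \<in> S \<Longrightarrow> square_integrable M f"
  by (erule gaussian_cases)

text \<open>The value depends on \<open>f\<close> through \<open>rms M f\<close> alone. Joint laws
  of members of \<open>S\<close> can therefore be compared by comparing second moments of linear
  combinations.\<close>

lemma expectation_cos:
  assumes "f \<in> S"
  shows "expectation (\<lambda>x. cos (f x + b)) = exp (- (rms M f)\<^sup>2 / 2) * cos b"
  using assms
proof (cases rule: gaussian_cases)
  case null
  note [measurable] = borel_measurable[OF assms]
  have "expectation (\<lambda>x. cos (f x + b)) = expectation (\<lambda>x. cos b)"
    using null by (intro integral_cong_AE) auto
  with null show ?thesis by (simp add: prob_space)
next
  case normal
  define \<sigma> where "\<sigma> = rms M f"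
  have "0 < \<sigma>" using normal by (simp add: \<sigma>_def)
  have D: "distributed M lborel (\<lambda>x. f x / \<sigma>) std_normal_density"
    using normal normal_standard_normal_convert[OF \<open>0 < \<sigma>\<close>, of f 0] by (simp add: \<sigma>_def)
  interpret N: real_distribution std_normal_distribution by (rule real_dist_normal_dist)
  have int: "complex_integrable std_normal_distribution (\<lambda>x. iexp (\<sigma> * x))"
    by (rule N.integrable_const_bound[where B = 1]) auto
  have char: "(LINT x|std_normal_distribution. iexp (\<sigma> * x)) = exp (- \<sigma>\<^sup>2 / 2)"
    using char_std_normal_distribution by (simp add: char_def fun_eq_iff)
  have c: "(LINT x|std_normal_distribution. cos (\<sigma> * x)) = exp (- \<sigma>\<^sup>2 / 2)"
    using integral_Re[OF int] unfolding char by (simp add: Re_exp)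
  have s: "(LINT x|std_normal_distribution. sin (\<sigma> * x)) = 0"
    using integral_Im[OF int] unfolding char by (simp add: Im_exp)
  have "expectation (\<lambda>x. cos (f x + b)) = expectation (\<lambda>x. cos (\<sigma> * (f x / \<sigma>) + b))"
    using \<open>0 < \<sigma>\<close> by simp
  also have "\<dots> = (LINT x|lborel. std_normal_density x * cos (\<sigma> * x + b))"
    by (rule distributed_integral[OF D, symmetric]) auto
  also have "\<dots> = (LINT x|std_normal_distribution. cos (\<sigma> * x + b))"
    by (subst integral_density) auto
  also have "\<dots> = (LINT x|std_normal_distribution. cos (\<sigma> * x) * cos b - sin (\<sigma> * x) * sin b)"
    by (simp add: cos_add)
  also have "\<dots> = exp (- \<sigma>\<^sup>2 / 2) * cos b"
  proof (subst Bochner_Integration.integral_diff)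
    show "integrable std_normal_distribution (\<lambda>x. cos (\<sigma> * x) * cos b)"
      "integrable std_normal_distribution (\<lambda>x. sin (\<sigma> * x) * sin b)"
      by (auto intro!: integrable_mult_left N.integrable_const_bound[where B = 1])
  qed (simp add: c s)
  finally show ?thesis by (simp add: \<sigma>_def)
qed

text \<open>The form \<open>d * rms M f \<le> y\<close> avoids dividing by \<open>rms M f\<close>,
  which may vanish. There is no prefactor because beyond \<open>y\<close> the density is dominated
  by a multiple of the normal density centred at \<open>y\<close>, whose total mass is one.\<close>

lemma prob_ge_le:
  assumes "f \<in> S" and d: "0 \<le> d" "0 < y" "d * rms M f \<le> y"
  shows "prob {x \<in> space M. y \<le> f x} \<le> exp (- d\<^sup>2 / 2)"
  using assms(1)
proof (cases rule: gaussian_cases)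
  case null
  note [measurable] = borel_measurable[OF assms(1)]
  have "AE x in M. \<not> y \<le> f x" using null(1) \<open>0 < y\<close> by auto
  then have "prob {x \<in> space M. y \<le> f x} = 0" by (intro prob_eq_0[THEN iffD2]) auto
  then show ?thesis by simp
next
  case normal
  note [measurable] = borel_measurable[OF assms(1)]
  define \<sigma> where "\<sigma> = rms M f"
  have \<sigma>: "0 < \<sigma>" using normal by (simp add: \<sigma>_def)
  have "prob {x \<in> space M. y \<le> f x} = expectation (indicator {x \<in> space M. y \<le> f x})" by simp
  also have "\<dots> = expectation (\<lambda>x. indicator {y..} (f x))"
    by (intro Bochner_Integration.integral_cong) (auto simp: indicator_def)
  also have "\<dots> = (LINT x|lborel. normal_density 0 \<sigma> x * indicator {y..} x)"
    unfolding \<sigma>_def by (rule distributed_integral[OF normal(1), symmetric]) auto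
  also have "\<dots> \<le> (LINT x|lborel. exp (- y\<^sup>2 / (2 * \<sigma>\<^sup>2)) * normal_density y \<sigma> x)"
  proof (rule integral_mono)
    show "integrable lborel (\<lambda>x. normal_density 0 \<sigma> x * indicator {y..} x)"
      using \<sigma> by (intro integrable_real_mult_indicator) auto
    show "integrable lborel (\<lambda>x. exp (- y\<^sup>2 / (2 * \<sigma>\<^sup>2)) * normal_density y \<sigma> x)"
      using \<sigma> by (intro integrable_mult_right integrable_normal_density)
    fix x
    show "normal_density 0 \<sigma> x * indicator {y..} x \<le> exp (- y\<^sup>2 / (2 * \<sigma>\<^sup>2)) * normal_density y \<sigma> x"
    proof (cases "y \<le> x")
      case True
      \<comment> \<open>The cross term in \<open>x\<^sup>2 = (y + (x - y))\<^sup>2\<close> is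
        nonnegative; dropping it compares the two densities.\<close>
      have "0 \<le> y * (x - y)" using True d by simp
      then have "y\<^sup>2 + (x - y)\<^sup>2 \<le> x\<^sup>2" by (simp add: power2_eq_square algebra_simps)
      then have "(y\<^sup>2 + (x - y)\<^sup>2) / (2 * \<sigma>\<^sup>2) \<le> x\<^sup>2 / (2 * \<sigma>\<^sup>2)"
        by (rule divide_right_mono) simp
      then have "- x\<^sup>2 / (2 * \<sigma>\<^sup>2) \<le> - y\<^sup>2 / (2 * \<sigma>\<^sup>2) + - (x - y)\<^sup>2 / (2 * \<sigma>\<^sup>2)"
        by (simp add: add_divide_distrib)
      then have "exp (- x\<^sup>2 / (2 * \<sigma>\<^sup>2)) \<le> exp (- y\<^sup>2 / (2 * \<sigma>\<^sup>2)) * exp (- (x - y)\<^sup>2 / (2 * \<sigma>\<^sup>2))"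
        by (simp add: mult_exp_exp)
      then show ?thesis using True \<sigma>
        by (simp add: normal_density_def divide_right_mono)
    qed simp
  qed
  also have "\<dots> = exp (- y\<^sup>2 / (2 * \<sigma>\<^sup>2))" using \<sigma> by simp
  also have "\<dots> \<le> exp (- d\<^sup>2 / 2)"
  proof -
    have "(d * \<sigma>)\<^sup>2 \<le> y\<^sup>2" using d \<sigma> by (intro power_mono) (auto simp: \<sigma>_def)
    then show ?thesis using \<sigma> by (simp add: field_simps power_mult_distrib)
  qed
  finally show ?thesis .
qed

text \<open>On an interval of the nonnegative half-line the density is smallest at the right
  end.\<close>

lemma prob_Icc_ge:
  assumes "f \<in> S" "0 < rms M f" "0 \<le> a" "a \<le> b"
  shows "(b - a) * normal_density 0 (rms M f) b \<le> prob {x \<in> space M. a \<le> f x \<and> f x \<le> b}"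
  using assms(1)
proof (cases rule: gaussian_cases)
  case null
  with assms show ?thesis by simp
next
  case normal
  note [measurable] = borel_measurable[OF assms(1)]
  define \<sigma> where "\<sigma> = rms M f"
  have \<sigma>: "0 < \<sigma>" using normal by (simp add: \<sigma>_def)
  have "(b - a) * normal_density 0 \<sigma> b = (LINT x|lborel. normal_density 0 \<sigma> b * indicator {a..b} x)"
    using assms by simp
  also have "\<dots> \<le> (LINT x|lborel. normal_density 0 \<sigma> x * indicator {a..b} x)"
  proof (rule integral_mono)
    show "integrable lborel (\<lambda>x. normal_density 0 \<sigma> x * indicator {a..b} x)"
      using \<sigma> by (intro integrable_real_mult_indicator) auto
    show "integrable lborel (\<lambda>x. normal_density 0 \<sigma> b * indicator {a..b} x)"
      by (intro integrable_mult_right integrable_real_indicator) (auto simp: emeasure_lborel_Icc_eq)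
    fix x
    show "normal_density 0 \<sigma> b * indicator {a..b} x \<le> normal_density 0 \<sigma> x * indicator {a..b} x"
    proof (cases "x \<in> {a..b}")
      case True
      then have "x\<^sup>2 \<le> b\<^sup>2" using assms by (intro power_mono) auto
      then have "exp (- b\<^sup>2 / (2 * \<sigma>\<^sup>2)) \<le> exp (- x\<^sup>2 / (2 * \<sigma>\<^sup>2))"
        using \<sigma> by (simp add: divide_right_mono)
      then show ?thesis using True
        by (simp add: normal_density_def divide_right_mono)
    qed simp
  qed
  also have "\<dots> = expectation (\<lambda>x. indicator {a..b} (f x))"
    unfolding \<sigma>_def by (rule distributed_integral[OF normal(1)]) auto
  also have "\<dots> = expectation (indicator {x \<in> space M. a \<le> f x \<and> f x \<le> b})"
    by (intro Bochner_Integration.integral_cong) (auto simp: indicator_def)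
  also have "\<dots> = prob {x \<in> space M. a \<le> f x \<and> f x \<le> b}" by simp
  finally show ?thesis by (simp add: \<sigma>_def)
qed

end

section \<open>Independence and the inequality of Fernique\<close>

context centered_gaussian_system
begin

lemma prob_space_pair: "prob_space (M \<Otimes>\<^sub>M M)"
proof -
  interpret P: pair_prob_space M M ..
  show ?thesis by unfold_locales
qed

lemma measure_pair_Times:
  assumes "A \<in> sets M" "B \<in> sets M"
  shows "measure (M \<Otimes>\<^sub>M M) (A \<times> B) = prob A * prob B"
  using emeasure_pair_measure_Times[OF assms] by (simp add: measure_def enn2real_mult)

text \<open>Independent copies are modelled by the two coordinates of the product space; Fubini's
  theorem makes the variances add.\<close>

lemma expectation_cos_pair:
  assumes "f \<in> S" "g \<in> S"
  shows "(LINT z|(M \<Otimes>\<^sub>M M). cos ((f (fst z) + g (snd z)) + b))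
    = exp (- ((rms M f)\<^sup>2 + (rms M g)\<^sup>2) / 2) * cos b"
proof -
  interpret P: pair_prob_space M M ..
  note [measurable] = borel_measurable[OF assms(1)] borel_measurable[OF assms(2)]
  have "integrable (M \<Otimes>\<^sub>M M) (\<lambda>z. cos ((f (fst z) + g (snd z)) + b))"
    by (rule P.P.integrable_const_bound[where B = 1]) auto
  from P.integral_fst'[OF this]
  have "(LINT z|(M \<Otimes>\<^sub>M M). cos ((f (fst z) + g (snd z)) + b))
      = expectation (\<lambda>x. expectation (\<lambda>y. cos (g y + (f x + b))))"
    by (simp add: ac_simps)
  also have "\<dots> = expectation (\<lambda>x. exp (- (rms M g)\<^sup>2 / 2) * cos (f x + b))"
    by (simp only: expectation_cos[OF assms(2)])
  also have "\<dots> = exp (- (rms M g)\<^sup>2 / 2) * (exp (- (rms M f)\<^sup>2 / 2) * cos b)"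
    by (simp only: integral_mult_right_zero expectation_cos[OF assms(1)])
  also have "\<dots> = exp (- ((rms M f)\<^sup>2 + (rms M g)\<^sup>2) / 2) * cos b"
    by (simp add: mult_exp_exp diff_divide_distrib)
  finally show ?thesis .
qed

text \<open>A pair of independent copies is invariant under rotation by 45 degrees. By Cramer-Wold
  it suffices that linear combinations keep their variance under the rotation, and this is the
  parallelogram identity.\<close>

lemma rotation_invariance:
  fixes Y :: "nat \<Rightarrow> 'w \<Rightarrow> real"
  assumes Y: "\<And>k. Y k \<in> S" and [measurable]: "B \<in> sets borel" "C \<in> sets borel"
  shows "measure (M \<Otimes>\<^sub>M M) {z \<in> space (M \<Otimes>\<^sub>M M).
      (\<forall>k<n. (Y k (fst z) - Y k (snd z)) / sqrt 2 \<in> B) \<and> (\<forall>k<n. (Y k (fst z) + Y k (snd z)) / sqrt 2 \<in> C)}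
    = prob {x \<in> space M. \<forall>k<n. Y k x \<in> B} * prob {x \<in> space M. \<forall>k<n. Y k x \<in> C}" (is "?L = _")
proof -
  have [measurable]: "Y k \<in> borel_measurable M" for k using borel_measurable Y by auto
  have ne: "S \<noteq> {}" using Y by auto
  define I :: "(nat + nat) set" where "I = {..<n} <+> {..<n}"
  define V where "V = case_sum (\<lambda>(k::nat) z. (Y k (fst z) - Y k (snd z)) / sqrt 2)
    (\<lambda>(k::nat) z. (Y k (fst z) + Y k (snd z)) / sqrt 2)"
  define W where "W = case_sum (\<lambda>(k::nat) z. Y k (fst z)) (\<lambda>(k::nat) (z :: 'w \<times> 'w). Y k (snd z))"
  define D where "D = case_sum (\<lambda>k :: nat. B) (\<lambda>k :: nat. C)"
  have all_I: "(\<forall>i\<in>I. Q i) \<longleftrightarrow> (\<forall>k<n. Q (Inl k)) \<and> (\<forall>k<n. Q (Inr k))" for Q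
    by (auto simp: I_def)
  have sum_I: "(\<Sum>i\<in>I. h i) = (\<Sum>k<n. h (Inl k)) + (\<Sum>k<n. h (Inr k))" for h :: "nat + nat \<Rightarrow> real"
    unfolding I_def by (simp add: sum.Plus o_def)
  have "measure (M \<Otimes>\<^sub>M M) {z \<in> space (M \<Otimes>\<^sub>M M). \<forall>i\<in>I. V i z \<in> D i}
      = measure (M \<Otimes>\<^sub>M M) {z \<in> space (M \<Otimes>\<^sub>M M). \<forall>i\<in>I. W i z \<in> D i}"
  proof (rule Cramer_Wold[OF _ prob_space_pair prob_space_pair])
    fix a :: "nat + nat \<Rightarrow> real" and b :: real
    \<comment> \<open>\<open>g\<close> and \<open>h\<close> collect the coefficients of the rotated
      differences and sums. Regrouped by coordinate, \<open>p\<close> is what falls on the first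
      copy and \<open>m\<close> on the second.\<close>
    define g where "g = (\<lambda>x. \<Sum>k<n. a (Inl k) * Y k x)"
    define h where "h = (\<lambda>x. \<Sum>k<n. a (Inr k) * Y k x)"
    have gh: "g \<in> S" "h \<in> S" unfolding g_def h_def using Y ne by (auto intro!: combination_mem)
    define p where "p = (\<lambda>x. 1 / sqrt 2 * (h x + g x))"
    define m where "m = (\<lambda>x. 1 / sqrt 2 * (h x - g x))"
    have pm: "p \<in> S" "m \<in> S" unfolding p_def m_def by (intro scale add diff gh)+
    have V: "(\<Sum>i\<in>I. a i * V i z) = p (fst z) + m (snd z)" for z
      by (simp add: sum_I V_def p_def m_def g_def h_def sum.distrib[symmetric] sum_subtractf[symmetric]
          sum_distrib_left) (simp add: sum.distrib[symmetric] field_simps)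
    have W: "(\<Sum>i\<in>I. a i * W i z) = g (fst z) + h (snd z)" for z
      by (simp add: sum_I W_def g_def h_def)
    note sq = square_integrable[OF gh(1)] square_integrable[OF gh(2)]
    have "(rms M p)\<^sup>2 + (rms M m)\<^sup>2
        = (rms M (\<lambda>x. h x + 1 * g x))\<^sup>2 / 2 + (rms M (\<lambda>x. h x + (-1) * g x))\<^sup>2 / 2"
      unfolding p_def m_def rms_scale by (simp add: power_mult_distrib power_divide)
    also have "\<dots> = (rms M g)\<^sup>2 + (rms M h)\<^sup>2"
      unfolding rms_square integral_square_add_scale[OF sq(2,1)] by (simp add: field_simps)
    finally have "(rms M p)\<^sup>2 + (rms M m)\<^sup>2 = (rms M g)\<^sup>2 + (rms M h)\<^sup>2" .
    then show "(LINT z|(M \<Otimes>\<^sub>M M). cos ((\<Sum>i\<in>I. a i * V i z) + b))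
        = (LINT z|(M \<Otimes>\<^sub>M M). cos ((\<Sum>i\<in>I. a i * W i z) + b))"
      by (simp only: V W expectation_cos_pair gh pm)
  next
    show "finite I" by (simp add: I_def)
    fix i
    show "V i \<in> borel_measurable (M \<Otimes>\<^sub>M M)" by (cases i) (simp_all add: V_def)
    show "W i \<in> borel_measurable (M \<Otimes>\<^sub>M M)" by (cases i) (simp_all add: W_def)
    show "D i \<in> sets borel" by (cases i) (simp_all add: D_def)
  qed
  also have "{z \<in> space (M \<Otimes>\<^sub>M M). \<forall>i\<in>I. W i z \<in> D i}
      = {x \<in> space M. \<forall>k<n. Y k x \<in> B} \<times> {x \<in> space M. \<forall>k<n. Y k x \<in> C}"
    by (auto simp: all_I W_def D_def space_pair_measure)
  also have "measure (M \<Otimes>\<^sub>M M) \<dots>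
      = prob {x \<in> space M. \<forall>k<n. Y k x \<in> B} * prob {x \<in> space M. \<forall>k<n. Y k x \<in> C}"
    by (rule measure_pair_Times) measurable
  finally show ?thesis by (simp add: all_I V_def D_def)
qed

text \<open>With vanishing covariances the variance of \<open>g + h\<close> is the sum of the two
  variances. Hence \<open>f\<close> and the \<open>Y k\<close> have on \<open>M\<close> the joint
  law that \<open>f\<close> on the first and the \<open>Y k\<close> on the second coordinate have on
  the product space, where the measure of a rectangle factors.\<close>

lemma uncorrelated_imp_independent:
  fixes Y :: "nat \<Rightarrow> 'w \<Rightarrow> real"
  assumes f: "f \<in> S" and Y: "\<And>k. Y k \<in> S" and cov: "\<And>k. expectation (\<lambda>x. f x * Y k x) = 0"
    and [measurable]: "B \<in> sets borel" "C \<in> sets borel"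
  shows "prob {x \<in> space M. f x \<in> B \<and> (\<forall>k<n. Y k x \<in> C)}
    = prob {x \<in> space M. f x \<in> B} * prob {x \<in> space M. \<forall>k<n. Y k x \<in> C}"
proof -
  have [measurable]: "Y k \<in> borel_measurable M" "f \<in> borel_measurable M" for k
    using borel_measurable Y f by auto
  have ne: "S \<noteq> {}" using Y by auto
  define I :: "(unit + nat) set" where "I = UNIV <+> {..<n}"
  define V where "V = case_sum (\<lambda>_::unit. f) Y"
  define W where "W = case_sum (\<lambda>(_::unit) z. f (fst z)) (\<lambda>(k::nat) (z :: 'w \<times> 'w). Y k (snd z))"
  define D where "D = case_sum (\<lambda>_ :: unit. B) (\<lambda>k :: nat. C)"
  have all_I: "(\<forall>i\<in>I. Q i) \<longleftrightarrow> Q (Inl ()) \<and> (\<forall>k<n. Q (Inr k))" for Q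
    by (auto simp: I_def)
  have sum_I: "(\<Sum>i\<in>I. h i) = h (Inl ()) + (\<Sum>k<n. h (Inr k))" for h :: "unit + nat \<Rightarrow> real"
    unfolding I_def by (simp add: sum.Plus o_def UNIV_unit)
  have "prob {x \<in> space M. \<forall>i\<in>I. V i x \<in> D i}
      = measure (M \<Otimes>\<^sub>M M) {z \<in> space (M \<Otimes>\<^sub>M M). \<forall>i\<in>I. W i z \<in> D i}"
  proof (rule Cramer_Wold[OF _ prob_space_axioms prob_space_pair])
    fix a :: "unit + nat \<Rightarrow> real" and b :: real
    define c where "c = a (Inl ())"
    define g where "g = (\<lambda>x. c * f x)"
    define h where "h = (\<lambda>x. \<Sum>k<n. a (Inr k) * Y k x)"
    have gh: "g \<in> S" "h \<in> S" unfolding g_def h_def using Y ne f by (auto intro!: combination_mem scale)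
    have V: "(\<Sum>i\<in>I. a i * V i z) = g z + h z" for z
      by (simp add: sum_I V_def g_def h_def c_def)
    have W: "(\<Sum>i\<in>I. a i * W i z) = g (fst z) + h (snd z)" for z
      by (simp add: sum_I W_def g_def h_def c_def)
    note sq = square_integrable[OF gh(1)] square_integrable[OF gh(2)]
    have "expectation (\<lambda>x. g x * h x) = expectation (\<lambda>x. \<Sum>k<n. c * a (Inr k) * (f x * Y k x))"
      by (simp add: g_def h_def sum_distrib_left mult_ac)
    also have "\<dots> = (\<Sum>k<n. c * a (Inr k) * expectation (\<lambda>x. f x * Y k x))"
      by (simp add: square_integrable_mult square_integrable f Y)
    finally have "expectation (\<lambda>x. g x * h x) = 0" by (simp add: cov)
    then have "(rms M (\<lambda>x. g x + h x))\<^sup>2 = (rms M g)\<^sup>2 + (rms M h)\<^sup>2"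
      using integral_square_add_scale[OF sq, of 1] by (simp add: rms_square)
    then show "expectation (\<lambda>x. cos ((\<Sum>i\<in>I. a i * V i x) + b))
        = (LINT z|(M \<Otimes>\<^sub>M M). cos ((\<Sum>i\<in>I. a i * W i z) + b))"
      by (simp only: V W expectation_cos_pair gh expectation_cos[OF add[OF gh]])
  next
    show "finite I" by (simp add: I_def)
    fix i
    show "V i \<in> borel_measurable M" by (cases i) (simp_all add: V_def)
    show "W i \<in> borel_measurable (M \<Otimes>\<^sub>M M)" by (cases i) (simp_all add: W_def)
    show "D i \<in> sets borel" by (cases i) (simp_all add: D_def)
  qed
  also have "{z \<in> space (M \<Otimes>\<^sub>M M). \<forall>i\<in>I. W i z \<in> D i}
      = {x \<in> space M. f x \<in> B} \<times> {x \<in> space M. \<forall>k<n. Y k x \<in> C}"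
    by (auto simp: all_I W_def D_def space_pair_measure)
  also have "measure (M \<Otimes>\<^sub>M M) \<dots>
      = prob {x \<in> space M. f x \<in> B} * prob {x \<in> space M. \<forall>k<n. Y k x \<in> C}"
    by (rule measure_pair_Times) measurable
  finally show ?thesis by (simp add: all_I V_def D_def)
qed

lemma uncorrelated_imp_independent_sequence:
  fixes Y :: "nat \<Rightarrow> 'w \<Rightarrow> real"
  assumes f: "f \<in> S" and Y: "\<And>k. Y k \<in> S" and cov: "\<And>k. expectation (\<lambda>x. f x * Y k x) = 0"
    and [measurable]: "B \<in> sets borel" "C \<in> sets borel"
  shows "prob {x \<in> space M. f x \<in> B \<and> (\<forall>k. Y k x \<in> C)}
    = prob {x \<in> space M. f x \<in> B} * prob {x \<in> space M. \<forall>k. Y k x \<in> C}"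
proof (rule LIMSEQ_unique)
  have [measurable]: "Y k \<in> borel_measurable M" "f \<in> borel_measurable M" for k
    using borel_measurable Y f by auto
  have "(\<lambda>n. prob {x \<in> space M. \<forall>k<n. Y k x \<in> C}) \<longlonglongrightarrow> prob (\<Inter>n. {x \<in> space M. \<forall>k<n. Y k x \<in> C})"
    by (rule finite_Lim_measure_decseq) (auto simp: decseq_def)
  also have "(\<Inter>n. {x \<in> space M. \<forall>k<n. Y k x \<in> C}) = {x \<in> space M. \<forall>k. Y k x \<in> C}" by auto
  finally show "(\<lambda>n. prob {x \<in> space M. f x \<in> B \<and> (\<forall>k<n. Y k x \<in> C)})
      \<longlonglongrightarrow> prob {x \<in> space M. f x \<in> B} * prob {x \<in> space M. \<forall>k. Y k x \<in> C}"
    by (simp only: uncorrelated_imp_independent[OF f Y cov assms(4,5)] tendsto_mult_left)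
  have "(\<lambda>n. prob {x \<in> space M. f x \<in> B \<and> (\<forall>k<n. Y k x \<in> C)})
      \<longlonglongrightarrow> prob (\<Inter>n. {x \<in> space M. f x \<in> B \<and> (\<forall>k<n. Y k x \<in> C)})"
    by (rule finite_Lim_measure_decseq) (auto simp: decseq_def)
  also have "(\<Inter>n. {x \<in> space M. f x \<in> B \<and> (\<forall>k<n. Y k x \<in> C)}) = {x \<in> space M. f x \<in> B \<and> (\<forall>k. Y k x \<in> C)}"
    by auto
  finally show "(\<lambda>n. prob {x \<in> space M. f x \<in> B \<and> (\<forall>k<n. Y k x \<in> C)})
      \<longlonglongrightarrow> prob {x \<in> space M. f x \<in> B \<and> (\<forall>k. Y k x \<in> C)}" .
qed

text \<open>If all rotated differences are at most \<open>s\<close> and some rotated sum exceeds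
  \<open>t\<close>, then at that index both copies exceed \<open>(t - s) / sqrt 2\<close> in
  absolute value. The first event has the probability on the left by rotation invariance; the second
  has the square on the right by independence of the copies.\<close>

lemma Fernique_step:
  fixes Y :: "nat \<Rightarrow> 'w \<Rightarrow> real"
  assumes Y: "\<And>k. Y k \<in> S"
  shows "prob {x \<in> space M. \<forall>k<n. \<bar>Y k x\<bar> \<le> s} * prob {x \<in> space M. \<exists>k<n. t < \<bar>Y k x\<bar>}
    \<le> (prob {x \<in> space M. \<exists>k<n. (t - s) / sqrt 2 < \<bar>Y k x\<bar>})\<^sup>2"
proof -
  interpret P: prob_space "M \<Otimes>\<^sub>M M" by (rule prob_space_pair)
  have [measurable]: "Y k \<in> borel_measurable M" for k using borel_measurable Y by auto
  define c where "c = (t - s) / sqrt 2"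
  have abs_iff: "y \<in> {-t..t} \<longleftrightarrow> \<bar>y\<bar> \<le> t" for y t :: real by auto
  have rot: "P.prob {z \<in> space (M \<Otimes>\<^sub>M M).
      (\<forall>k<n. \<bar>(Y k (fst z) - Y k (snd z)) / sqrt 2\<bar> \<le> s) \<and> (\<forall>k<n. (Y k (fst z) + Y k (snd z)) / sqrt 2 \<in> C)}
    = prob {x \<in> space M. \<forall>k<n. \<bar>Y k x\<bar> \<le> s} * prob {x \<in> space M. \<forall>k<n. Y k x \<in> C}"
    if "C \<in> sets borel" for C
    using rotation_invariance[where B = "{-s..s}" and C = C and Y = Y and n = n] Y that
    by (simp only: abs_iff) simp
  define E where "E = {z \<in> space (M \<Otimes>\<^sub>M M). \<forall>k<n. \<bar>(Y k (fst z) - Y k (snd z)) / sqrt 2\<bar> \<le> s}"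
  define F where "F = {z \<in> space (M \<Otimes>\<^sub>M M). (\<forall>k<n. \<bar>(Y k (fst z) - Y k (snd z)) / sqrt 2\<bar> \<le> s)
    \<and> (\<forall>k<n. \<bar>(Y k (fst z) + Y k (snd z)) / sqrt 2\<bar> \<le> t)}"
  have [measurable]: "E \<in> sets (M \<Otimes>\<^sub>M M)" "F \<in> sets (M \<Otimes>\<^sub>M M)"
    unfolding E_def F_def by measurable
  have E: "P.prob E = prob {x \<in> space M. \<forall>k<n. \<bar>Y k x\<bar> \<le> s}"
    using rot[of UNIV] by (simp add: E_def prob_space)
  have F: "P.prob F = prob {x \<in> space M. \<forall>k<n. \<bar>Y k x\<bar> \<le> s} * prob {x \<in> space M. \<forall>k<n. \<bar>Y k x\<bar> \<le> t}"
    using rot[of "{-t..t}"] unfolding F_def by (simp only: abs_iff) simp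
  have compl: "prob {x \<in> space M. \<exists>k<n. t < \<bar>Y k x\<bar>} = 1 - prob {x \<in> space M. \<forall>k<n. \<bar>Y k x\<bar> \<le> t}"
    by (subst prob_compl[symmetric]) (auto intro!: arg_cong[where f = prob])
  have "prob {x \<in> space M. \<forall>k<n. \<bar>Y k x\<bar> \<le> s} * prob {x \<in> space M. \<exists>k<n. t < \<bar>Y k x\<bar>}
      = P.prob E - P.prob F"
    unfolding E F compl by (simp add: algebra_simps)
  also have "\<dots> = P.prob (E - F)"
    by (rule P.finite_measure_Diff[symmetric]) (auto simp: E_def F_def)
  also have "\<dots> \<le> P.prob ({x \<in> space M. \<exists>k<n. c < \<bar>Y k x\<bar>} \<times> {x \<in> space M. \<exists>k<n. c < \<bar>Y k x\<bar>})"
  proof (rule P.finite_measure_mono)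
    show "E - F \<subseteq> {x \<in> space M. \<exists>k<n. c < \<bar>Y k x\<bar>} \<times> {x \<in> space M. \<exists>k<n. c < \<bar>Y k x\<bar>}"
    proof (rule subsetI)
      fix z assume z: "z \<in> E - F"
      then obtain k where k: "k < n" "t < \<bar>(Y k (fst z) + Y k (snd z)) / sqrt 2\<bar>"
        "\<bar>(Y k (fst z) - Y k (snd z)) / sqrt 2\<bar> \<le> s"
        by (auto simp: E_def F_def not_le)
      have aux: "(u - v) / 2 < \<bar>a\<bar> \<and> (u - v) / 2 < \<bar>b\<bar>" if "u < \<bar>a + b\<bar>" "\<bar>a - b\<bar> \<le> v"
        for a b u v :: real
      proof -
        have "\<bar>a + b\<bar> \<le> 2 * \<bar>a\<bar> + \<bar>a - b\<bar>" "\<bar>a + b\<bar> \<le> 2 * \<bar>b\<bar> + \<bar>a - b\<bar>" by arith+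
        with that show ?thesis by simp
      qed
      have eq: "(t - s) / sqrt 2 = (sqrt 2 * t - sqrt 2 * s) / 2"
        by (simp add: field_simps)
      have "sqrt 2 * t < \<bar>Y k (fst z) + Y k (snd z)\<bar>" "\<bar>Y k (fst z) - Y k (snd z)\<bar> \<le> sqrt 2 * s"
        using k by (simp_all add: abs_divide field_simps)
      then have "c < \<bar>Y k (fst z)\<bar>" "c < \<bar>Y k (snd z)\<bar>"
        unfolding c_def eq by (auto dest: aux)
      with k z show "z \<in> {x \<in> space M. \<exists>k<n. c < \<bar>Y k x\<bar>} \<times> {x \<in> space M. \<exists>k<n. c < \<bar>Y k x\<bar>}"
        by (cases z) (auto simp: E_def space_pair_measure)
    qed
  qed measurable
  also have "\<dots> = (prob {x \<in> space M. \<exists>k<n. c < \<bar>Y k x\<bar>})\<^sup>2"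
    by (subst measure_pair_Times) (auto simp: power2_eq_square)
  finally show ?thesis by (simp add: c_def)
qed

text \<open>Iterating the step squares the normalised tail while the threshold grows by a factor of
  about \<open>sqrt 2\<close>: this is Gaussian decay. For
  \<open>sqrt 2 ^ m \<le> t / (4 * s) < sqrt 2 ^ Suc m\<close> the exponent \<open>2 ^ m\<close> is
  at least half the square of \<open>t / (4 * s)\<close>, whence the constant
  \<open>32\<close>.\<close>

lemma Fernique_finite:
  fixes Y :: "nat \<Rightarrow> 'w \<Rightarrow> real"
  assumes Y: "\<And>k. Y k \<in> S" and s: "0 < s" "3 / 4 \<le> prob {x \<in> space M. \<forall>k<n. \<bar>Y k x\<bar> \<le> s}"
    and t: "4 * s \<le> t"
  shows "prob {x \<in> space M. \<exists>k<n. t < \<bar>Y k x\<bar>} \<le> exp (- t\<^sup>2 / (32 * s\<^sup>2))"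
proof -
  have [measurable]: "Y k \<in> borel_measurable M" for k using borel_measurable Y by auto
  define q where "q = prob {x \<in> space M. \<forall>k<n. \<bar>Y k x\<bar> \<le> s}"
  define \<beta> where "\<beta> t = prob {x \<in> space M. \<exists>k<n. t < \<bar>Y k x\<bar>}" for t
  have q: "3 / 4 \<le> q" "q \<le> 1" using s by (auto simp: q_def)
  have \<beta>_mono: "\<beta> t' \<le> \<beta> t" if "t \<le> t'" for t t'
    unfolding \<beta>_def using that by (intro finite_measure_mono) (auto intro: le_less_trans)
  have \<beta>_nonneg: "0 \<le> \<beta> t" for t by (simp add: \<beta>_def)
  have "\<beta> s = 1 - q" unfolding q_def \<beta>_def
    by (subst prob_compl[symmetric]) (auto intro!: arg_cong[where f = prob])
  \<comment> \<open>The constants ensure \<open>\<tau> 0 = s\<close> and \<open>\<tau> m \<le> (\<tau> (Suc m) - s) / sqrt 2\<close>, so that each step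
    squares the normalised tail.\<close>
  define \<tau> where "\<tau> m = s * (4 * sqrt 2 ^ m - 3)" for m
  have sqrt2: "sqrt 2 * sqrt 2 = (2::real)" by simp
  have "sqrt 2 \<le> 3 / (2::real)" by (rule real_le_lsqrt) (auto simp: power2_eq_square)
  have decay: "\<beta> (\<tau> m) \<le> q * exp (- (2 ^ m))" for m
  proof (induction m)
    case 0
    \<comment> \<open>This start of the iteration is what the level \<open>3 / 4\<close> provides:
      \<open>(1 - q) / q \<le> 1 / 3 \<le> exp (-1)\<close>, because
      \<open>exp 1 \<le> 3\<close>.\<close>
    have "1 - q \<le> q * (1 / 3)" using q by simp
    also have "\<dots> \<le> q * exp (-1)"
      using q exp_le by (intro mult_left_mono) (auto simp: exp_minus field_simps)
    finally show ?case using \<open>\<beta> s = 1 - q\<close> by (simp add: \<tau>_def)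
  next
    case (Suc m)
    have "(\<tau> (Suc m) - s) / sqrt 2 = s * (4 * sqrt 2 ^ m - 2 * sqrt 2)"
      by (simp add: \<tau>_def field_simps)
    also have "\<dots> \<ge> \<tau> m"
      unfolding \<tau>_def using s \<open>sqrt 2 \<le> 3 / 2\<close> by (intro mult_left_mono) auto
    finally have "\<beta> ((\<tau> (Suc m) - s) / sqrt 2) \<le> \<beta> (\<tau> m)" by (rule \<beta>_mono)
    also note Suc
    finally have "(\<beta> ((\<tau> (Suc m) - s) / sqrt 2))\<^sup>2 \<le> (q * exp (- (2 ^ m)))\<^sup>2"
      by (intro power_mono \<beta>_nonneg)
    also have "\<dots> = q * (q * exp (- (2 ^ Suc m)))"
      by (simp add: power2_eq_square mult_exp_exp)
    finally have "q * \<beta> (\<tau> (Suc m)) \<le> q * (q * exp (- (2 ^ Suc m)))"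
      using Fernique_step[where Y = Y, OF Y, where n = n and s = s and t = "\<tau> (Suc m)"] by (simp add: q_def \<beta>_def)
    with q show ?case by (subst (asm) mult_le_cancel_left_pos) auto
  qed
  define x where "x = t / (4 * s)"
  have x: "1 \<le> x" using s t by (simp add: x_def)
  obtain m0 where "x < sqrt 2 ^ m0" using real_arch_pow[of "sqrt 2" x] by auto
  then have ex: "\<exists>m. x < sqrt 2 ^ Suc m"
    by (metis less_le_trans power_increasing le_Suc_eq order_refl real_sqrt_ge_1_iff one_le_numeral)
  define m where "m = (LEAST m. x < sqrt 2 ^ Suc m)"
  have m1: "x < sqrt 2 ^ Suc m" unfolding m_def by (rule LeastI_ex[OF ex])
  have m2: "sqrt 2 ^ m \<le> x"
  proof (cases m)
    case 0
    with x show ?thesis by simp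
  next
    case (Suc k)
    then have "\<not> x < sqrt 2 ^ Suc k" unfolding m_def by (intro not_less_Least) simp
    with Suc show ?thesis by simp
  qed
  have "x\<^sup>2 \<le> (sqrt 2 ^ Suc m)\<^sup>2" using m1 x by (intro power_mono) auto
  also have "\<dots> = 2 * 2 ^ m"
    by (simp only: power_mult[symmetric] mult.commute[of "Suc m"]) (simp add: power_mult)
  finally have x2: "x\<^sup>2 / 2 \<le> 2 ^ m" by simp
  have "\<tau> m \<le> t"
  proof -
    have "\<tau> m \<le> s * (4 * x)" unfolding \<tau>_def using s m2 by (intro mult_left_mono) auto
    also have "\<dots> = t" using s by (simp add: x_def)
    finally show ?thesis .
  qed
  then have "\<beta> t \<le> q * exp (- (2 ^ m))" using \<beta>_mono decay[of m] by (meson order_trans)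
  also have "\<dots> \<le> 1 * exp (- (x\<^sup>2 / 2))"
    using q x2 by (intro mult_mono) auto
  also have "x\<^sup>2 / 2 = t\<^sup>2 / (32 * s\<^sup>2)" by (simp add: x_def power_divide power_mult_distrib)
  finally show ?thesis by (simp add: \<beta>_def)
qed

text \<open>The bound for finitely many variables is uniform in \<open>n\<close>, and the events
  increase with \<open>n\<close>.\<close>

theorem Fernique:
  fixes Y :: "nat \<Rightarrow> 'w \<Rightarrow> real"
  assumes Y: "\<And>k. Y k \<in> S" and s: "0 < s" "3 / 4 \<le> prob {x \<in> space M. \<forall>k. \<bar>Y k x\<bar> \<le> s}"
    and t: "4 * s \<le> t"
  shows "prob {x \<in> space M. \<exists>k. t < \<bar>Y k x\<bar>} \<le> exp (- t\<^sup>2 / (32 * s\<^sup>2))"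
proof (rule LIMSEQ_le_const2)
  have [measurable]: "Y k \<in> borel_measurable M" for k using borel_measurable Y by auto
  have "(\<lambda>n. prob {x \<in> space M. \<exists>k<n. t < \<bar>Y k x\<bar>}) \<longlonglongrightarrow> prob (\<Union>n. {x \<in> space M. \<exists>k<n. t < \<bar>Y k x\<bar>})"
    by (rule finite_Lim_measure_incseq) (auto simp: incseq_def intro: less_le_trans)
  also have "(\<Union>n. {x \<in> space M. \<exists>k<n. t < \<bar>Y k x\<bar>}) = {x \<in> space M. \<exists>k. t < \<bar>Y k x\<bar>}" by auto
  finally show "(\<lambda>n. prob {x \<in> space M. \<exists>k<n. t < \<bar>Y k x\<bar>}) \<longlonglongrightarrow> prob {x \<in> space M. \<exists>k. t < \<bar>Y k x\<bar>}" .
  have "3 / 4 \<le> prob {x \<in> space M. \<forall>k<n. \<bar>Y k x\<bar> \<le> s}" for n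
    using s(2) by (rule order_trans) (intro finite_measure_mono; auto)
  then show "\<exists>N. \<forall>n\<ge>N. prob {x \<in> space M. \<exists>k<n. t < \<bar>Y k x\<bar>} \<le> exp (- t\<^sup>2 / (32 * s\<^sup>2))"
    using Fernique_finite[where Y = Y, OF Y s(1) _ t] by blast
qed

end

section \<open>Finitely many linear constraints\<close>

context centered_gaussian_system
begin

text \<open>Second-order expansion for testing a vector of multipliers by raising its
  \<open>j\<close>-th entry by \<open>c\<close>.\<close>

lemma integral_mult_combination:
  assumes "finite I" "S \<noteq> {}" "\<And>i. i \<in> I \<Longrightarrow> Z i \<in> S" and j: "j \<in> I"
  shows "(rms M (\<lambda>x. (\<Sum>i\<in>I. l i * Z i x) + c * Z j x))\<^sup>2
    = (rms M (\<lambda>x. \<Sum>i\<in>I. l i * Z i x))\<^sup>2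
      + 2 * c * expectation (\<lambda>x. Z j x * (\<Sum>i\<in>I. l i * Z i x)) + c\<^sup>2 * (rms M (Z j))\<^sup>2"
  unfolding rms_square
  using integral_square_add_scale[OF square_integrable[OF combination_mem[OF assms(1-3)]] square_integrable[OF assms(3)[OF j]]]
  by (simp add: mult.commute)

text \<open>The dual problem is to maximise \<open>q\<close> over nonnegative multipliers. An almost maximiser yields an
  almost feasible point of the primal problem, because \<open>q\<close> cannot increase much when one multiplier is
  raised or when all multipliers are scaled down.\<close>

lemma approximate_duality:
  fixes Z :: "'i \<Rightarrow> 'w \<Rightarrow> real" and c :: "'i \<Rightarrow> real"
  assumes I: "finite I" and ne: "S \<noteq> {}" and Z: "\<And>i. i \<in> I \<Longrightarrow> Z i \<in> S" and "0 \<le> d" "0 < e"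
    and bound: "\<And>l. (\<And>i. i \<in> I \<Longrightarrow> 0 \<le> l i) \<Longrightarrow>
      (\<Sum>i\<in>I. c i * l i) \<le> d * rms M (\<lambda>x. \<Sum>i\<in>I. l i * Z i x)"
  obtains H where "H \<in> S" "rms M H \<le> d + e" "\<And>i. i \<in> I \<Longrightarrow> c i - e \<le> expectation (\<lambda>x. Z i x * H x)"
proof -
  define N where "N l = rms M (\<lambda>x. \<Sum>i\<in>I. l i * Z i x)" for l
  \<comment> \<open>The Lagrange dual function of minimising half the second moment of
    \<open>H\<close> under the constraints that \<open>Z i * H\<close> has expectation at least
    \<open>c i\<close>: for given multipliers \<open>l\<close> the Lagrangian is minimised by the
    combination of the \<open>Z i\<close> with coefficients \<open>l\<close>.\<close>
  define q where "q l = (\<Sum>i\<in>I. c i * l i) - (N l)\<^sup>2 / 2" for l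
  define P where "P = {l. \<forall>i\<in>I. (0::real) \<le> l i}"
  have q_le: "q l \<le> d\<^sup>2 / 2" if "l \<in> P" for l
  proof -
    have "0 \<le> (d - N l)\<^sup>2" by simp
    with bound[of l] that show ?thesis
      by (simp add: q_def P_def N_def[symmetric] power2_diff)
  qed
  then have bdd: "bdd_above (q ` P)" by (intro bdd_aboveI2)
  have "(\<lambda>_. 0) \<in> P" by (simp add: P_def)
  then have neP: "q ` P \<noteq> {}" by auto
  define V where "V = 1 + (\<Sum>i\<in>I. (rms M (Z i))\<^sup>2)"
  have V: "1 \<le> V" unfolding V_def by (simp add: sum_nonneg)
  \<comment> \<open>\<open>\<sigma>\<close> is the test step in one multiplier and
    \<open>\<eta>\<close> the admissible suboptimality. The quadratic term
    \<open>\<sigma> * (rms M (Z i))\<^sup>2 / 2\<close> and the quotient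
    \<open>\<eta> / \<sigma>\<close> each contribute at most \<open>e / 2\<close> to the violation
    of a constraint. The summand \<open>1\<close> in \<open>V\<close> also yields
    \<open>\<sigma> \<le> e\<close>.\<close>
  define \<sigma> where "\<sigma> = e / V"
  define \<eta> where "\<eta> = \<sigma> * e / 2"
  have \<sigma>: "0 < \<sigma>" using V \<open>0 < e\<close> by (simp add: \<sigma>_def)
  have \<eta>: "0 < \<eta>" using \<sigma> \<open>0 < e\<close> by (simp add: \<eta>_def)
  obtain l where l: "l \<in> P" "Sup (q ` P) - \<eta> < q l"
    using less_cSupD[OF neP, of "Sup (q ` P) - \<eta>"] \<eta> by auto
  have almost_max: "q l' < q l + \<eta>" if "l' \<in> P" for l'
    using cSup_upper[OF imageI[OF that, of q] bdd] l by linarith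
  define H where "H = (\<lambda>x. \<Sum>i\<in>I. l i * Z i x)"
  have H: "H \<in> S" unfolding H_def by (rule combination_mem[OF I ne Z])
  have "c i - e \<le> expectation (\<lambda>x. Z i x * H x)" if i: "i \<in> I" for i
  proof -
    define h where "h = expectation (\<lambda>x. Z i x * H x)"
    define l' where "l' j = l j + (if j = i then \<sigma> else 0)" for j
    have "l' \<in> P" using l \<sigma> by (auto simp: P_def l'_def)
    have s1: "(\<Sum>j\<in>I. l' j * f j) = (\<Sum>j\<in>I. l j * f j) + \<sigma> * f i" for f :: "'i \<Rightarrow> real"
      using I i by (simp add: l'_def distrib_right sum.distrib if_distrib[of "\<lambda>x. x * _"] cong: if_cong)
    have "(N l')\<^sup>2 = (N l)\<^sup>2 + 2 * \<sigma> * h + \<sigma>\<^sup>2 * (rms M (Z i))\<^sup>2"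
      unfolding N_def s1 h_def H_def by (rule integral_mult_combination[OF I ne Z i])
    moreover have "(\<Sum>j\<in>I. c j * l' j) = (\<Sum>j\<in>I. c j * l j) + \<sigma> * c i"
      using s1[of c] by (simp add: mult.commute)
    ultimately have "q l' = q l + \<sigma> * (c i - h) - \<sigma> * (\<sigma> * (rms M (Z i))\<^sup>2) / 2"
      by (simp add: q_def algebra_simps power2_eq_square add_divide_distrib)
    with almost_max[OF \<open>l' \<in> P\<close>]
    have "\<sigma> * (c i - h) < \<sigma> * (e / 2 + \<sigma> * (rms M (Z i))\<^sup>2 / 2)"
      by (simp add: \<eta>_def algebra_simps)
    then have "c i - h < e / 2 + \<sigma> * (rms M (Z i))\<^sup>2 / 2" using \<sigma> by simp
    moreover have "\<sigma> * (rms M (Z i))\<^sup>2 \<le> \<sigma> * V"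
      using \<sigma> member_le_sum[OF i _ I, of "\<lambda>i. (rms M (Z i))\<^sup>2"] by (simp add: V_def)
    moreover have "\<sigma> * V = e" using V by (simp add: \<sigma>_def)
    ultimately show ?thesis by (simp add: h_def)
  qed
  moreover have "rms M H \<le> d + e"
  proof (rule ccontr)
    assume "\<not> rms M H \<le> d + e"
    then have big: "d + e < N l" by (simp add: H_def N_def)
    \<comment> \<open>Scaling all multipliers by \<open>\<kappa>\<close> lowers \<open>N l\<close>
      by exactly \<open>e\<close>. If \<open>N l\<close> exceeded \<open>d + e\<close>, this would
      raise \<open>q\<close> by more than \<open>e\<^sup>2 / 2\<close>, which is at least
      \<open>\<eta>\<close>.\<close>
    define \<kappa> where "\<kappa> = 1 - e / N l"
    have Npos: "0 < N l" using big \<open>0 \<le> d\<close> \<open>0 < e\<close> by linarith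
    then have \<kappa>: "0 \<le> \<kappa>" using big \<open>0 \<le> d\<close> by (simp add: \<kappa>_def field_simps)
    define l' where "l' j = \<kappa> * l j" for j
    have "l' \<in> P" using l \<kappa> by (auto simp: P_def l'_def)
    have "N l' = \<kappa> * N l"
      using rms_scale[of M \<kappa> "\<lambda>x. \<Sum>i\<in>I. l i * Z i x"] \<kappa>
      by (simp add: N_def l'_def sum_distrib_left mult.assoc)
    also have "\<dots> = N l - e" using Npos by (simp add: \<kappa>_def field_simps)
    finally have N: "N l' = N l - e" .
    define C where "C = (\<Sum>i\<in>I. c i * l i)"
    have C: "C \<le> d * N l" using bound[of l] l by (simp add: P_def C_def N_def)
    have "(\<Sum>i\<in>I. c i * l' i) = C - (e / N l) * C"
      by (simp add: l'_def C_def \<kappa>_def sum_distrib_left algebra_simps sum_subtractf)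
    moreover have "(e / N l) * C \<le> (e / N l) * (d * N l)"
      using C Npos \<open>0 < e\<close> by (intro mult_left_mono) auto
    then have "(e / N l) * C \<le> e * d" using Npos by simp
    ultimately have "C - e * d \<le> (\<Sum>i\<in>I. c i * l' i)" by linarith
    then have "q l + (N l * e - e * d - e\<^sup>2 / 2) \<le> q l'"
      by (simp add: q_def N C_def[symmetric] power2_diff diff_divide_distrib add_divide_distrib)
    with almost_max[OF \<open>l' \<in> P\<close>] have "N l * e - e * d - e\<^sup>2 / 2 < \<eta>" by linarith
    moreover have "(d + e) * e < N l * e" using big \<open>0 < e\<close> by simp
    then have "e\<^sup>2 < N l * e - e * d" by (simp add: power2_eq_square algebra_simps)
    moreover have "\<sigma> * e \<le> e * e" using V \<open>0 < e\<close> by (intro mult_right_mono) (auto simp: \<sigma>_def field_simps)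
    then have "\<eta> \<le> e\<^sup>2 / 2" by (simp add: \<eta>_def power2_eq_square)
    ultimately show False by linarith
  qed
  ultimately show thesis using that H by blast
qed

text \<open>By the contrapositive of \<open>approximate_duality\<close>, infeasibility with slack
  supplies nonnegative multipliers that violate its bound. On the event, the single Gaussian
  variable formed with them is at least \<open>u\<close> times the combined levels, and
  \<open>prob_ge_le\<close> estimates its tail. Strictness of the violation makes the threshold
  \<open>y\<close> positive.\<close>

lemma prob_finite_constraints_le:
  fixes Z :: "'i \<Rightarrow> 'w \<Rightarrow> real" and c :: "'i \<Rightarrow> real"
  assumes I: "finite I" and ne: "S \<noteq> {}" and Z: "\<And>i. i \<in> I \<Longrightarrow> Z i \<in> S" and "0 \<le> d" "0 < e" "0 < u"
    and infeasible: "\<And>H. H \<in> S \<Longrightarrow> rms M H \<le> d + e \<Longrightarrow> \<exists>i\<in>I. expectation (\<lambda>x. Z i x * H x) < c i - e"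
  shows "prob {x \<in> space M. \<forall>i\<in>I. u * c i \<le> Z i x} \<le> exp (- (d\<^sup>2 * u\<^sup>2 / 2))"
proof -
  have "\<exists>l. (\<forall>i\<in>I. 0 \<le> l i) \<and> d * rms M (\<lambda>x. \<Sum>i\<in>I. l i * Z i x) < (\<Sum>i\<in>I. c i * l i)"
  proof (rule ccontr)
    assume *: "\<not> ?thesis"
    show False
    proof (rule approximate_duality[OF I ne Z \<open>0 \<le> d\<close> \<open>0 < e\<close>])
      show "(\<Sum>i\<in>I. c i * l i) \<le> d * rms M (\<lambda>x. \<Sum>i\<in>I. l i * Z i x)" if "\<And>i. i \<in> I \<Longrightarrow> 0 \<le> l i" for l
        using * that by (meson not_le)
    next
      fix H assume "H \<in> S" "rms M H \<le> d + e" "\<And>i. i \<in> I \<Longrightarrow> c i - e \<le> expectation (\<lambda>x. Z i x * H x)"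
      with infeasible[of H] show False by (meson not_le)
    qed
  qed
  then obtain l where l: "\<And>i. i \<in> I \<Longrightarrow> 0 \<le> l i"
    and less: "d * rms M (\<lambda>x. \<Sum>i\<in>I. l i * Z i x) < (\<Sum>i\<in>I. c i * l i)" by blast
  define f where "f = (\<lambda>x. \<Sum>i\<in>I. l i * Z i x)"
  have f: "f \<in> S" unfolding f_def by (rule combination_mem[OF I ne Z])
  note [measurable] = borel_measurable[OF f]
  define y where "y = u * (\<Sum>i\<in>I. c i * l i)"
  have "0 < y"
    unfolding y_def using less \<open>0 \<le> d\<close> \<open>0 < u\<close>
    by (intro mult_pos_pos) (auto intro: le_less_trans[rotated] mult_nonneg_nonneg)
  have "(d * u) * rms M f \<le> y"
    unfolding y_def f_def using less \<open>0 < u\<close> by (simp add: mult.assoc mult.left_commute[of d])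
  have "prob {x \<in> space M. \<forall>i\<in>I. u * c i \<le> Z i x} \<le> prob {x \<in> space M. y \<le> f x}"
  proof (rule finite_measure_mono)
    show "{x \<in> space M. \<forall>i\<in>I. u * c i \<le> Z i x} \<subseteq> {x \<in> space M. y \<le> f x}"
    proof (intro subsetI CollectI conjI; elim CollectE conjE)
      fix x assume "\<forall>i\<in>I. u * c i \<le> Z i x"
      then have "(\<Sum>i\<in>I. l i * (u * c i)) \<le> f x"
        unfolding f_def by (intro sum_mono mult_left_mono l) auto
      then show "y \<le> f x" by (simp add: y_def sum_distrib_left mult_ac)
    qed
  qed measurable
  also have "\<dots> \<le> exp (- (d * u)\<^sup>2 / 2)"
    using \<open>0 \<le> d\<close> \<open>0 < u\<close> \<open>0 < y\<close> \<open>(d * u) * rms M f \<le> y\<close> by (intro prob_ge_le f) auto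
  finally show ?thesis by (simp add: power_mult_distrib)
qed

end

section \<open>Continuous Gaussian fields\<close>

lemma compact_finite_net:
  fixes K :: "'a::metric_space set"
  assumes "compact K" "0 < \<delta>"
  obtains F where "finite F" "F \<subseteq> K" "\<And>t. t \<in> K \<Longrightarrow> \<exists>s\<in>F. dist s t < \<delta>"
proof -
  have "K \<subseteq> (\<Union>s\<in>K. ball s \<delta>)" using \<open>0 < \<delta>\<close> by auto
  then obtain F where "F \<subseteq> K" "finite F" "K \<subseteq> (\<Union>s\<in>F. ball s \<delta>)"
    by (rule compactE_image[OF assms(1), rotated]) auto
  then show thesis using that by (force simp: subset_iff)
qed

section \<open>Finite linear combinations of the field as a linear space\<close>

lemma linear_combinationsE:
  assumes "f \<in> linear_combinations T X"
  obtains k :: nat and a t where "f = (\<lambda>\<omega>. \<Sum>j=1..k. a j * X (t j) \<omega>)" "1 \<le> k" "t ` {1..k} \<subseteq> T"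
  using assms unfolding linear_combinations_def mem_Collect_eq by (elim exE conjE) (rule that; assumption)

lemma linear_combinations_add:
  assumes "f \<in> linear_combinations T X" "g \<in> linear_combinations T X"
  shows "(\<lambda>x. f x + g x) \<in> linear_combinations T X"
proof -
  obtain k :: nat and a t where f: "f = (\<lambda>\<omega>. \<Sum>j=1..k. a j * X (t j) \<omega>)" "1 \<le> k" "t ` {1..k} \<subseteq> T"
    using assms(1) by (rule linear_combinationsE)
  obtain l :: nat and b s where g: "g = (\<lambda>\<omega>. \<Sum>j=1..l. b j * X (s j) \<omega>)" "1 \<le> l" "s ` {1..l} \<subseteq> T"
    using assms(2) by (rule linear_combinationsE)
  \<comment> \<open>Concatenation: indices above \<open>k\<close> address the second combination,
    shifted by \<open>k\<close>; both ranges start at \<open>1\<close>.\<close>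
  define c where "c j = (if j \<le> k then a j else b (j - k))" for j
  define r where "r j = (if j \<le> k then t j else s (j - k))" for j
  have "(\<Sum>j=1..k + l. c j * X (r j) \<omega>) = f \<omega> + g \<omega>" for \<omega>
  proof -
    have "(\<Sum>j=1..k + l. c j * X (r j) \<omega>)
        = (\<Sum>j=1..k. c j * X (r j) \<omega>) + (\<Sum>j=k + 1..k + l. c j * X (r j) \<omega>)"
      by (rule sum.ub_add_nat) simp
    also have "(\<Sum>j=1..k. c j * X (r j) \<omega>) = f \<omega>"
      unfolding f(1) by (intro sum.cong) (auto simp: c_def r_def)
    also have "(\<Sum>j=k + 1..k + l. c j * X (r j) \<omega>) = (\<Sum>j=1..l. c (j + k) * X (r (j + k)) \<omega>)"
      using sum.shift_bounds_cl_nat_ivl[of "\<lambda>j. c j * X (r j) \<omega>" 1 k l] by (simp add: add.commute)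
    also have "\<dots> = g \<omega>"
      unfolding g(1) by (intro sum.cong) (auto simp: c_def r_def)
    finally show ?thesis .
  qed
  moreover have "r ` {1..k + l} \<subseteq> T"
  proof (intro subsetI, elim imageE)
    fix x j assume "x = r j" and j: "j \<in> {1..k + l}"
    show "x \<in> T"
    proof (cases "j \<le> k")
      case True
      with j have "j \<in> {1..k}" by simp
      with True f(3) show ?thesis unfolding \<open>x = r j\<close> by (auto simp: r_def)
    next
      case False
      with j have "j - k \<in> {1..l}" by auto
      with False g(3) show ?thesis unfolding \<open>x = r j\<close> by (auto simp: r_def simp del: atLeastAtMost_iff)
    qed
  qed
  ultimately show ?thesis
    unfolding linear_combinations_def using f(2) by (intro CollectI exI[of _ "k + l"] exI[of _ c] exI[of _ r]) auto
qed

lemma linear_combinations_scale: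
  assumes "f \<in> linear_combinations T X"
  shows "(\<lambda>x. c * f x) \<in> linear_combinations T X"
proof -
  obtain k :: nat and a t where f: "f = (\<lambda>\<omega>. \<Sum>j=1..k. a j * X (t j) \<omega>)" "1 \<le> k" "t ` {1..k} \<subseteq> T"
    using assms by (rule linear_combinationsE)
  then show ?thesis
    unfolding linear_combinations_def
    by (intro CollectI exI[of _ k] exI[of _ "\<lambda>j. c * a j"] exI[of _ t])
      (auto simp: sum_distrib_left mult.assoc)
qed

lemma linear_combinations_mem: "t \<in> T \<Longrightarrow> X t \<in> linear_combinations T X"
  unfolding linear_combinations_def
  by (intro CollectI exI[of _ 1] exI[of _ "\<lambda>_. 1"] exI[of _ "\<lambda>_. t"]) auto

locale continuous_gaussian_field = prob_space M for M :: "'w measure" +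
  fixes T :: "'t::euclidean_space set" and X :: "'t \<Rightarrow> 'w \<Rightarrow> real"
  assumes compact: "compact T" and gaussian_field: "gaussian_field M T X"
    and centered_field: "centered_field M T X"
    and continuous_paths: "\<And>\<omega>. \<omega> \<in> space M \<Longrightarrow> continuous_on T (\<lambda>t. X t \<omega>)"
begin

sublocale centered_gaussian_system M "linear_combinations T X"
proof
  fix f assume f: "f \<in> linear_combinations T X"
  show "gaussian_rv M f" using gaussian_field f by (simp add: gaussian_field_def)
  obtain k :: nat and a t where f_eq: "f = (\<lambda>\<omega>. \<Sum>j=1..k. a j * X (t j) \<omega>)" "1 \<le> k" "t ` {1..k} \<subseteq> T"
    using f by (rule linear_combinationsE)
  have "integrable M (X (t j))" "expectation (X (t j)) = 0" if "j \<in> {1..k}" for j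
  proof -
    have "t j \<in> T" using f_eq(3) that by blast
    then show "integrable M (X (t j))" "expectation (X (t j)) = 0"
      using centered_field by (auto simp: centered_field_def)
  qed
  then show "integrable M f" "expectation f = 0"
    unfolding f_eq by (auto simp: sum.neutral)
qed (rule linear_combinations_add linear_combinations_scale; assumption)+

lemma X_mem: "t \<in> T \<Longrightarrow> X t \<in> linear_combinations T X"
  by (rule linear_combinations_mem)

lemma X_measurable: "t \<in> T \<Longrightarrow> X t \<in> borel_measurable M"
  using borel_measurable X_mem by blast

lemma increment_mem: "s \<in> T \<Longrightarrow> t \<in> T \<Longrightarrow> (\<lambda>\<omega>. X s \<omega> - X t \<omega>) \<in> linear_combinations T X"
  using diff[OF X_mem X_mem, of s t] by simp

section \<open>Moduli of continuity of the paths and of the covariance\<close>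

lemma path_uniformly_continuous:
  assumes "\<omega> \<in> space M" "0 < e"
  obtains \<delta> where "0 < \<delta>" "\<And>s t. s \<in> T \<Longrightarrow> t \<in> T \<Longrightarrow> dist s t < \<delta> \<Longrightarrow> \<bar>X s \<omega> - X t \<omega>\<bar> < e"
proof -
  have "uniformly_continuous_on T (\<lambda>t. X t \<omega>)"
    by (rule compact_uniformly_continuous[OF continuous_paths[OF assms(1)] compact])
  with \<open>0 < e\<close> obtain \<delta> where "0 < \<delta>"
    "\<And>t s. t \<in> T \<Longrightarrow> s \<in> T \<Longrightarrow> dist s t < \<delta> \<Longrightarrow> dist (X s \<omega>) (X t \<omega>) < e"
    unfolding uniformly_continuous_on_def by metis
  then show thesis by (intro that[of \<delta>]) (auto simp: dist_real_def)
qed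

text \<open>Pointwise convergence of \<open>X (s n) - X (t n)\<close> to \<open>0\<close> forces the characteristic functions to \<open>1\<close>
  and hence, the increments being Gaussian, the variances to \<open>0\<close>.\<close>

lemma rms_uniformly_continuous:
  assumes "0 < e"
  obtains \<delta> where "0 < \<delta>"
    "\<And>s t. s \<in> T \<Longrightarrow> t \<in> T \<Longrightarrow> dist s t < \<delta> \<Longrightarrow> rms M (\<lambda>\<omega>. X s \<omega> - X t \<omega>) < e"
proof (rule ccontr)
  assume "\<not> thesis"
  then have "\<exists>s t. s \<in> T \<and> t \<in> T \<and> dist s t < 1 / real (Suc n) \<and> e \<le> rms M (\<lambda>\<omega>. X s \<omega> - X t \<omega>)" for n
    using that[of "1 / real (Suc n)"] by (force simp: not_less)
  then obtain s t where st: "\<And>n. s n \<in> T" "\<And>n. t n \<in> T" "\<And>n. dist (s n) (t n) < 1 / real (Suc n)"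
    and ge: "\<And>n. e \<le> rms M (\<lambda>\<omega>. X (s n) \<omega> - X (t n) \<omega>)" by metis
  have [measurable]: "X (s n) \<in> borel_measurable M" "X (t n) \<in> borel_measurable M" for n
    using st X_measurable by auto
  have "(\<lambda>n. expectation (\<lambda>\<omega>. cos ((X (s n) \<omega> - X (t n) \<omega>) + 0))) \<longlonglongrightarrow> expectation (\<lambda>\<omega>. 1)"
  proof (rule integral_dominated_convergence[where w = "\<lambda>_. 1"])
    show "AE \<omega> in M. (\<lambda>n. cos ((X (s n) \<omega> - X (t n) \<omega>) + 0)) \<longlonglongrightarrow> 1"
    proof (rule AE_I2)
      fix \<omega> assume \<omega>: "\<omega> \<in> space M"
      have "(\<lambda>n. X (s n) \<omega> - X (t n) \<omega>) \<longlonglongrightarrow> 0"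
      proof (rule LIMSEQ_I)
        fix r :: real assume "0 < r"
        then obtain \<delta> where \<delta>: "0 < \<delta>"
          "\<And>s t. s \<in> T \<Longrightarrow> t \<in> T \<Longrightarrow> dist s t < \<delta> \<Longrightarrow> \<bar>X s \<omega> - X t \<omega>\<bar> < r"
          using path_uniformly_continuous[OF \<omega>] by metis
        obtain n0 where n0: "1 / real (Suc n0) < \<delta>" using nat_approx_posE[OF \<open>0 < \<delta>\<close>] by blast
        have "norm (X (s n) \<omega> - X (t n) \<omega> - 0) < r" if "n0 \<le> n" for n
        proof -
          have "1 / real (Suc n) \<le> 1 / real (Suc n0)" using that by (intro divide_left_mono) auto
          with n0 st(3)[of n] have "dist (s n) (t n) < \<delta>" by linarith
          with \<delta>(2) st show ?thesis by simp
        qed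
        then show "\<exists>no. \<forall>n\<ge>no. norm (X (s n) \<omega> - X (t n) \<omega> - 0) < r" by blast
      qed
      from tendsto_cos[OF this] show "(\<lambda>n. cos ((X (s n) \<omega> - X (t n) \<omega>) + 0)) \<longlonglongrightarrow> 1" by simp
    qed
  qed auto
  moreover have "expectation (\<lambda>\<omega>. cos ((X (s n) \<omega> - X (t n) \<omega>) + 0)) \<le> exp (- e\<^sup>2 / 2)" for n
    unfolding expectation_cos[OF increment_mem[OF st(1,2)]]
    using power_mono[OF ge[of n], of 2] \<open>0 < e\<close> by simp
  ultimately have "expectation (\<lambda>\<omega>. 1) \<le> exp (- e\<^sup>2 / 2)"
    by (intro LIMSEQ_le_const2) auto
  with \<open>0 < e\<close> show False by (simp add: prob_space)
qed

text \<open>Uniform continuity of the increments extends the bound from a finite net to all of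
  \<open>T\<close>.\<close>

lemma rms_bounded:
  obtains C where "0 < C" "\<And>t. t \<in> T \<Longrightarrow> rms M (X t) \<le> C"
proof -
  obtain \<delta> where \<delta>: "0 < \<delta>"
    "\<And>s t. s \<in> T \<Longrightarrow> t \<in> T \<Longrightarrow> dist s t < \<delta> \<Longrightarrow> rms M (\<lambda>\<omega>. X s \<omega> - X t \<omega>) < 1"
    using rms_uniformly_continuous[of 1] by auto
  obtain F where F: "finite F" "F \<subseteq> T" "\<And>t. t \<in> T \<Longrightarrow> \<exists>s\<in>F. dist s t < \<delta>"
    using compact_finite_net[OF compact \<open>0 < \<delta>\<close>] by blast
  show thesis
  proof
    show "0 < 1 + (\<Sum>s\<in>F. rms M (X s))" by (simp add: sum_nonneg add_pos_nonneg)
    fix t assume t: "t \<in> T"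
    then obtain s where s: "s \<in> F" "dist s t < \<delta>" using F by blast
    then have "s \<in> T" using F by blast
    have "rms M (X t) = rms M (\<lambda>\<omega>. (X t \<omega> - X s \<omega>) + X s \<omega>)" by simp
    also have "\<dots> \<le> rms M (\<lambda>\<omega>. X t \<omega> - X s \<omega>) + rms M (X s)"
      using t \<open>s \<in> T\<close> by (intro rms_add square_integrable increment_mem X_mem)
    also have "rms M (\<lambda>\<omega>. X t \<omega> - X s \<omega>) \<le> 1"
      using \<delta>(2)[of t s] t \<open>s \<in> T\<close> s by (simp add: dist_commute)
    also have "rms M (X s) \<le> (\<Sum>s\<in>F. rms M (X s))"
      by (rule member_le_sum[OF s(1)]) (use F in auto)
    finally show "rms M (X t) \<le> 1 + (\<Sum>s\<in>F. rms M (X s))" by simp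
  qed
qed

text \<open>As the distance shrinks these events increase, and uniform continuity of each single
  path makes them exhaust the space. The level \<open>3 / 4\<close> is the one that
  \<open>Fernique\<close> asks for; taking pairs from a countable \<open>D\<close> keeps the events
  measurable.\<close>

lemma modulus_prob_ge:
  assumes D: "countable D" "D \<subseteq> T" and "0 < a"
  obtains \<delta> where "0 < \<delta>"
    "3 / 4 \<le> prob {\<omega> \<in> space M. \<forall>p\<in>{p \<in> D \<times> D. dist (fst p) (snd p) < \<delta>}. \<bar>X (fst p) \<omega> - X (snd p) \<omega>\<bar> \<le> a}"
proof -
  define A where "A n = {\<omega> \<in> space M. \<forall>p\<in>{p \<in> D \<times> D. dist (fst p) (snd p) < 1 / real (Suc n)}.
    \<bar>X (fst p) \<omega> - X (snd p) \<omega>\<bar> \<le> a}" for n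
  have count: "countable {p \<in> D \<times> D. dist (fst p) (snd p) < c}" for c
    by (rule countable_subset[of _ "D \<times> D"]) (use D in auto)
  have A: "A n \<in> sets M" for n
    unfolding A_def
  proof (rule sets.sets_Collect_countable_All'[OF _ count])
    fix p assume "p \<in> {p \<in> D \<times> D. dist (fst p) (snd p) < 1 / real (Suc n)}"
    then have [measurable]: "X (fst p) \<in> borel_measurable M" "X (snd p) \<in> borel_measurable M"
      using D X_measurable by auto
    show "{\<omega> \<in> space M. \<bar>X (fst p) \<omega> - X (snd p) \<omega>\<bar> \<le> a} \<in> sets M" by measurable
  qed
  have "incseq A"
  proof (intro incseq_SucI subsetI)
    fix n \<omega> assume "\<omega> \<in> A n"
    moreover have "1 / real (Suc (Suc n)) \<le> 1 / real (Suc n)" by (intro divide_left_mono) auto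
    ultimately show "\<omega> \<in> A (Suc n)" by (auto simp: A_def intro: less_le_trans simp del: of_nat_Suc)
  qed
  then have "(\<lambda>n. prob (A n)) \<longlonglongrightarrow> prob (\<Union>n. A n)"
    using A by (intro finite_Lim_measure_incseq) auto
  also have "(\<Union>n. A n) = space M"
  proof (intro equalityI subsetI)
    fix \<omega> assume \<omega>: "\<omega> \<in> space M"
    obtain \<delta> where \<delta>: "0 < \<delta>" "\<And>s t. s \<in> T \<Longrightarrow> t \<in> T \<Longrightarrow> dist s t < \<delta> \<Longrightarrow> \<bar>X s \<omega> - X t \<omega>\<bar> < a"
      using path_uniformly_continuous[OF \<omega> \<open>0 < a\<close>] by metis
    obtain n0 where n0: "1 / real (Suc n0) < \<delta>" using nat_approx_posE[OF \<open>0 < \<delta>\<close>] by blast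
    have "\<omega> \<in> A n0"
      unfolding A_def using \<omega> n0 D by (fastforce intro!: less_imp_le[OF \<delta>(2)])
    then show "\<omega> \<in> (\<Union>n. A n)" by blast
  qed (auto simp: A_def)
  finally have "(\<lambda>n. prob (A n)) \<longlonglongrightarrow> 1" by (simp add: prob_space)
  from order_tendstoD(1)[OF this, of "3 / 4"] obtain n where "3 / 4 < prob (A n)"
    by (auto simp: eventually_sequentially)
  then show thesis by (intro that[of "1 / real (Suc n)"]) (auto simp: A_def)
qed

text \<open>The rate \<open>A\<close> is arbitrary and is paid for by the choice of
  \<open>\<delta>\<close>. The exceptional set \<open>N\<close> is defined through countably many
  pairs and is thus measurable; outside it the bound extends to all of \<open>T\<close> by
  continuity of the path.\<close>

lemma modulus_tail:
  fixes a A :: real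
  assumes "0 < a"
  obtains \<delta> u0 where "0 < \<delta>"
    "\<And>u. u0 \<le> u \<Longrightarrow> \<exists>N\<in>sets M. prob N \<le> exp (- (A * u\<^sup>2)) \<and>
      (\<forall>\<omega>\<in>space M - N. \<forall>s\<in>T. \<forall>t\<in>T. dist s t < \<delta> \<longrightarrow> \<bar>X s \<omega> - X t \<omega>\<bar> \<le> a * u)"
proof (cases "T = {}")
  case True
  then show thesis by (intro that[of 1 0]) (auto intro!: bexI[of _ "{}"])
next
  case False
  obtain D where D: "countable D" "D \<subseteq> T" "T \<subseteq> closure D" using separable[of T] by auto
  from False D have "D \<noteq> {}" by auto
  \<comment> \<open>At this level the exponent \<open>(a * u)\<^sup>2 / (32 * s\<^sup>2)\<close> of
    \<open>Fernique\<close> becomes \<open>(\<bar>A\<bar> + 1) * u\<^sup>2\<close>; the summand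
    \<open>1\<close> keeps the root positive when \<open>A = 0\<close>.\<close>
  define s where "s = a / sqrt (32 * (\<bar>A\<bar> + 1))"
  have "0 < s" using \<open>0 < a\<close> by (auto simp: s_def intro!: divide_pos_pos)
  have s2: "a\<^sup>2 / (32 * s\<^sup>2) = \<bar>A\<bar> + 1"
    using \<open>0 < a\<close> by (simp add: s_def power_divide)
  obtain \<delta> where \<delta>: "0 < \<delta>" "3 / 4 \<le> prob {\<omega> \<in> space M.
      \<forall>p\<in>{p \<in> D \<times> D. dist (fst p) (snd p) < \<delta>}. \<bar>X (fst p) \<omega> - X (snd p) \<omega>\<bar> \<le> s}"
    using modulus_prob_ge[OF D(1,2) \<open>0 < s\<close>] by blast
  define Z where "Z = {p \<in> D \<times> D. dist (fst p) (snd p) < \<delta>}"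
  have Z: "countable Z" unfolding Z_def by (rule countable_subset[of _ "D \<times> D"]) (use D in auto)
  from \<open>D \<noteq> {}\<close> obtain d where "d \<in> D" by auto
  with \<delta> have "Z \<noteq> {}" by (auto simp: Z_def intro!: exI[of _ d])
  define Y where "Y k = (\<lambda>\<omega>. X (fst (from_nat_into Z k)) \<omega> - X (snd (from_nat_into Z k)) \<omega>)" for k
  have Z_mem: "from_nat_into Z k \<in> Z" for k by (rule from_nat_into[OF \<open>Z \<noteq> {}\<close>])
  then have Y: "Y k \<in> linear_combinations T X" for k
    unfolding Y_def using D by (intro increment_mem) (auto simp: Z_def dest!: meta_spec[of _ k])
  then have [measurable]: "Y k \<in> borel_measurable M" for k by (rule borel_measurable)
  have all_Z: "(\<forall>k. Q (from_nat_into Z k)) \<longleftrightarrow> (\<forall>p\<in>Z. Q p)" for Q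
    using Z_mem from_nat_into_surj[OF Z] by metis
  have q: "3 / 4 \<le> prob {\<omega> \<in> space M. \<forall>k. \<bar>Y k \<omega>\<bar> \<le> s}"
    using \<delta>(2) all_Z[of "\<lambda>p. \<bar>X (fst p) _ - X (snd p) _\<bar> \<le> s"] by (simp add: Y_def Z_def)
  show thesis
  proof (rule that[OF \<open>0 < \<delta>\<close>])
    \<comment> \<open>From here on \<open>a * u\<close> has reached the threshold
      \<open>4 * s\<close> of \<open>Fernique\<close>.\<close>
    fix u assume u: "4 * s / a \<le> u"
    then have "4 * s \<le> a * u" using \<open>0 < a\<close> by (simp add: field_simps)
    define N where "N = {\<omega> \<in> space M. \<exists>k. a * u < \<bar>Y k \<omega>\<bar>}"
    have "prob N \<le> exp (- (a * u)\<^sup>2 / (32 * s\<^sup>2))"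
      unfolding N_def by (rule Fernique[OF Y \<open>0 < s\<close> q \<open>4 * s \<le> a * u\<close>])
    also have "(a * u)\<^sup>2 / (32 * s\<^sup>2) = (\<bar>A\<bar> + 1) * u\<^sup>2"
      by (simp add: power_mult_distrib flip: s2)
    then have "exp (- (a * u)\<^sup>2 / (32 * s\<^sup>2)) \<le> exp (- (A * u\<^sup>2))"
      by (simp add: mult_right_mono)
    finally have "prob N \<le> exp (- (A * u\<^sup>2))" .
    moreover have "\<bar>X t \<omega> - X t' \<omega>\<bar> \<le> a * u"
      if \<omega>: "\<omega> \<in> space M - N" and t: "t \<in> T" "t' \<in> T" "dist t t' < \<delta>" for \<omega> t t'
    proof -
      obtain f g where f: "\<And>n. f n \<in> D" "f \<longlonglongrightarrow> t" and g: "\<And>n. g n \<in> D" "g \<longlonglongrightarrow> t'"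
        using t D closure_sequential by (metis subsetD)
      \<comment> \<open>Since \<open>dist t t' < \<delta>\<close> is strict, the approximating pairs
        from \<open>D\<close> eventually belong to \<open>Z\<close>.\<close>
      have "(\<lambda>n. dist (f n) (g n)) \<longlonglongrightarrow> dist t t'" using f g by (intro tendsto_dist)
      then have "eventually (\<lambda>n. dist (f n) (g n) < \<delta>) sequentially" using t order_tendstoD(2) by blast
      then have ev: "eventually (\<lambda>n. \<bar>X (f n) \<omega> - X (g n) \<omega>\<bar> \<le> a * u) sequentially"
      proof eventually_elim
        case (elim n)
        then have "(f n, g n) \<in> Z" using f g by (simp add: Z_def)
        moreover have "\<forall>p\<in>Z. \<bar>X (fst p) \<omega> - X (snd p) \<omega>\<bar> \<le> a * u"
          using \<omega> unfolding all_Z[symmetric] by (auto simp: N_def Y_def not_less)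
        ultimately show ?case by auto
      qed
      have cont: "continuous_on T (\<lambda>t. X t \<omega>)" using continuous_paths \<omega> by auto
      have "(\<lambda>n. X (f n) \<omega>) \<longlonglongrightarrow> X t \<omega>"
        by (rule continuous_on_tendsto_compose[OF cont f(2) t(1)]) (use f D in \<open>auto intro!: always_eventually\<close>)
      moreover have "(\<lambda>n. X (g n) \<omega>) \<longlonglongrightarrow> X t' \<omega>"
        by (rule continuous_on_tendsto_compose[OF cont g(2) t(2)]) (use g D in \<open>auto intro!: always_eventually\<close>)
      ultimately have "(\<lambda>n. \<bar>X (f n) \<omega> - X (g n) \<omega>\<bar>) \<longlonglongrightarrow> \<bar>X t \<omega> - X t' \<omega>\<bar>"
        by (intro tendsto_intros)
      then show ?thesis by (rule tendsto_upperbound[OF _ ev]) simp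
    qed
    moreover have "N \<in> sets M" unfolding N_def by measurable
    ultimately show "\<exists>N\<in>sets M. prob N \<le> exp (- (A * u\<^sup>2)) \<and>
      (\<forall>\<omega>\<in>space M - N. \<forall>s\<in>T. \<forall>t\<in>T. dist s t < \<delta> \<longrightarrow> \<bar>X s \<omega> - X t \<omega>\<bar> \<le> a * u)" by blast
  qed
qed

end

section \<open>Constraints on pairs of compact sets\<close>

lemma hausdorff_dist_less_imp_near:
  fixes K K' :: "'a::heine_borel set"
  assumes "K \<in> compact_subsets T" "K' \<in> compact_subsets T" "hausdorff_dist K K' < \<delta>" "t \<in> K"
  shows "\<exists>s\<in>K'. dist t s < \<delta>"
proof -
  have "K \<in> compact_subsets UNIV" "K' \<in> compact_subsets UNIV"
    using assms by (auto simp: compact_subsets_def)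
  from infdist_le_hausdorff_dist[OF this assms(4)] assms(3) have "infdist t K' < \<delta>" by linarith
  moreover obtain s where "s \<in> K'" "infdist t K' = dist t s"
    using infdist_attains_inf[of K' t] assms(2) by (auto simp: compact_subsets_def compact_imp_closed)
  ultimately show ?thesis by auto
qed

text \<open>Balls of radius \<open>\<rho> K\<close> around the members of \<open>\<C>\<close> form
  an open cover, and the product metric dominates the Hausdorff distance in each coordinate. The
  radius may depend on the centre, since it will come from a bound proved for each pair
  separately.\<close>

lemma compactin_hausdorff_finite_cover:
  assumes C: "compactin (mtopology_of (prod_metric (hausdorff_metric T) (hausdorff_metric T))) \<C>"
    and \<rho>: "\<And>K. K \<in> \<C> \<Longrightarrow> 0 < \<rho> K"
  obtains F where "finite F" "F \<subseteq> \<C>"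
    "\<And>K. K \<in> \<C> \<Longrightarrow> \<exists>L\<in>F. hausdorff_dist (fst L) (fst K) < \<rho> L \<and> hausdorff_dist (snd L) (snd K) < \<rho> L"
proof -
  let ?m = "prod_metric (hausdorff_metric T) (hausdorff_metric T)"
  interpret P: Metric_space "mspace ?m" "mdist ?m" by (rule Metric_space_mspace_mdist)
  have top: "mtopology_of ?m = P.mtopology" by (simp add: mtopology_of_def)
  have sub: "\<C> \<subseteq> mspace ?m"
    using C compactin_subset_topspace[OF C] by (simp add: top)
  have "\<exists>\<F>. finite \<F> \<and> \<F> \<subseteq> (\<lambda>K. P.mball K (\<rho> K)) ` \<C> \<and> \<C> \<subseteq> \<Union>\<F>"
  proof -
    have "\<forall>U\<in>(\<lambda>K. P.mball K (\<rho> K)) ` \<C>. openin (mtopology_of ?m) U"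
      by (intro ballI, elim imageE) (simp only: top P.openin_mball)
    moreover have "\<C> \<subseteq> \<Union>((\<lambda>K. P.mball K (\<rho> K)) ` \<C>)"
    proof
      fix K assume K: "K \<in> \<C>"
      then have "K \<in> P.mball K (\<rho> K)"
        unfolding P.centre_in_mball_iff using sub \<rho> by blast
      with K show "K \<in> \<Union>((\<lambda>K. P.mball K (\<rho> K)) ` \<C>)" by blast
    qed
    ultimately show ?thesis using C unfolding compactin_def by meson
  qed
  then obtain \<F> where \<F>: "finite \<F>" "\<F> \<subseteq> (\<lambda>K. P.mball K (\<rho> K)) ` \<C>" "\<C> \<subseteq> \<Union>\<F>" by blast
  obtain F where "F \<subseteq> \<C>" "finite F" "\<F> = (\<lambda>K. P.mball K (\<rho> K)) ` F"
    using finite_subset_image[OF \<F>(1,2)] by blast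
  with \<F>(3) have F: "finite F" "F \<subseteq> \<C>" "\<C> \<subseteq> (\<Union>K\<in>F. P.mball K (\<rho> K))" by simp_all
  show thesis
  proof (rule that[OF F(1,2)])
    fix K assume "K \<in> \<C>"
    then obtain L where "L \<in> F" "K \<in> P.mball L (\<rho> L)" using F(3) by blast
    then have L: "L \<in> F" "mdist ?m L K < \<rho> L" unfolding P.in_mball by blast+
    obtain L1 L2 K1 K2 where eq: "L = (L1, L2)" "K = (K1, K2)" by (metis surj_pair)
    have "hausdorff_dist L1 K1 \<le> mdist ?m L K" "hausdorff_dist L2 K2 \<le> mdist ?m L K"
      by (simp_all add: eq prod_dist_def real_le_rsqrt)
    with L show "\<exists>L\<in>F. hausdorff_dist (fst L) (fst K) < \<rho> L \<and> hausdorff_dist (snd L) (snd K) < \<rho> L"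
      by (intro bexI[of _ L]) (auto simp: eq)
  qed
qed

context continuous_gaussian_field
begin

text \<open>The levels are parameters because the upper bound relaxes \<open>1\<close> and
  \<open>r\<close> by a slack.\<close>

definition feasible :: "'t set \<Rightarrow> 't set \<Rightarrow> real \<Rightarrow> real \<Rightarrow> ('w \<Rightarrow> real) \<Rightarrow> bool" where
  "feasible K1 K2 a b H \<longleftrightarrow>
    (\<forall>t\<in>K1. a \<le> (LINT \<omega>|M. X t \<omega> * H \<omega>)) \<and> (\<forall>t\<in>K2. (LINT \<omega>|M. X t \<omega> * H \<omega>) \<le> b)"

definition excursion :: "'t set \<Rightarrow> 't set \<Rightarrow> real \<Rightarrow> real \<Rightarrow> 'w set" where
  "excursion K1 K2 a b = {\<omega> \<in> space M. (\<forall>t\<in>K1. a < X t \<omega>) \<and> (\<forall>t\<in>K2. X t \<omega> < b)}"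

lemma field_L2_spaceD:
  assumes "H \<in> field_L2_space M T X"
  shows "square_integrable M H"
    and "0 < e \<Longrightarrow> \<exists>Y\<in>linear_combinations T X. rms M (\<lambda>\<omega>. H \<omega> - Y \<omega>) < e"
proof -
  show "square_integrable M H"
    using assms by (simp add: field_L2_space_def mean_square_closure_def square_integrable_def)
  assume "0 < e"
  then have "0 < e\<^sup>2" by simp
  then obtain Y where Y: "Y \<in> linear_combinations T X" "(LINT \<omega>|M. (H \<omega> - Y \<omega>)\<^sup>2) < e\<^sup>2"
    using assms unfolding field_L2_space_def mean_square_closure_def by blast
  have "rms M (\<lambda>\<omega>. H \<omega> - Y \<omega>) < sqrt (e\<^sup>2)"
    unfolding rms_def using Y(2) by (rule real_sqrt_less_mono)
  with Y(1) \<open>0 < e\<close> show "\<exists>Y\<in>linear_combinations T X. rms M (\<lambda>\<omega>. H \<omega> - Y \<omega>) < e" by auto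
qed

lemma field_L2_spaceI:
  assumes H: "square_integrable M H" and F: "\<And>n. F n \<in> linear_combinations T X"
    and lim: "(\<lambda>n. rms M (\<lambda>\<omega>. H \<omega> - F n \<omega>)) \<longlonglongrightarrow> 0"
  shows "H \<in> field_L2_space M T X"
  unfolding field_L2_space_def mean_square_closure_def
proof (intro CollectI conjI allI impI)
  show "H \<in> borel_measurable M" "integrable M (\<lambda>\<omega>. (H \<omega>)\<^sup>2)"
    using H by (auto simp: square_integrable_def)
  fix \<epsilon> :: real assume "0 < \<epsilon>"
  have "(\<lambda>n. (rms M (\<lambda>\<omega>. H \<omega> - F n \<omega>))\<^sup>2) \<longlonglongrightarrow> 0\<^sup>2" by (intro tendsto_intros lim)
  then have "eventually (\<lambda>n. (rms M (\<lambda>\<omega>. H \<omega> - F n \<omega>))\<^sup>2 < \<epsilon>) sequentially"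
    using order_tendstoD(2) \<open>0 < \<epsilon>\<close> by fastforce
  then obtain n where "(rms M (\<lambda>\<omega>. H \<omega> - F n \<omega>))\<^sup>2 < \<epsilon>" by (auto simp: eventually_sequentially)
  then show "\<exists>Y\<in>linear_combinations T X. integrable M (\<lambda>\<omega>. (H \<omega> - Y \<omega>)\<^sup>2) \<and> (LINT \<omega>|M. (H \<omega> - Y \<omega>)\<^sup>2) < \<epsilon>"
    using F[of n] square_integrable_diff[OF H square_integrable[OF F[of n]]]
    by (intro bexI[of _ "F n"]) (auto simp: rms_square square_integrable_def)
qed

lemma covariance_diff_le:
  assumes t: "t \<in> T" and H: "square_integrable M H" "square_integrable M H'"
  shows "\<bar>(LINT \<omega>|M. X t \<omega> * H \<omega>) - (LINT \<omega>|M. X t \<omega> * H' \<omega>)\<bar>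
    \<le> rms M (X t) * rms M (\<lambda>\<omega>. H \<omega> - H' \<omega>)"
proof -
  note X = square_integrable[OF X_mem[OF t]]
  have "(LINT \<omega>|M. X t \<omega> * H \<omega>) - (LINT \<omega>|M. X t \<omega> * H' \<omega>) = (LINT \<omega>|M. X t \<omega> * (H \<omega> - H' \<omega>))"
    using square_integrable_mult[OF X H(1)] square_integrable_mult[OF X H(2)]
    by (simp add: right_diff_distrib)
  then show ?thesis using Cauchy_Schwarz_integral[OF X square_integrable_diff[OF H]] by simp
qed

lemma covariance_increment_le:
  assumes t: "s \<in> T" "t \<in> T" and H: "square_integrable M H"
  shows "\<bar>(LINT \<omega>|M. X s \<omega> * H \<omega>) - (LINT \<omega>|M. X t \<omega> * H \<omega>)\<bar>
    \<le> rms M (\<lambda>\<omega>. X s \<omega> - X t \<omega>) * rms M H"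
proof -
  note X = square_integrable[OF X_mem]
  have "(LINT \<omega>|M. X s \<omega> * H \<omega>) - (LINT \<omega>|M. X t \<omega> * H \<omega>) = (LINT \<omega>|M. (X s \<omega> - X t \<omega>) * H \<omega>)"
    using square_integrable_mult[OF X[OF t(1)] H] square_integrable_mult[OF X[OF t(2)] H]
    by (simp add: left_diff_distrib)
  then show ?thesis
    using Cauchy_Schwarz_integral[OF square_integrable[OF increment_mem[OF t]] H] by simp
qed

text \<open>Almost minimisers of the second moment under the relaxed constraints form a Cauchy sequence by the
  parallelogram law, since midpoints satisfy the weaker of the two constraints.\<close>

lemma feasible_limit:
  assumes K: "K1 \<subseteq> T" "K2 \<subseteq> T" and "0 \<le> d"
    and approx: "\<And>e. 0 < e \<Longrightarrow> \<exists>H\<in>linear_combinations T X. rms M H \<le> d + e \<and> feasible K1 K2 (1 - e) (r + e) H"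
  obtains H where "H \<in> field_L2_space M T X" "rms M H \<le> d" "feasible K1 K2 1 r H"
proof -
  define \<epsilon> where "\<epsilon> n = 1 / real (Suc n)" for n
  have \<epsilon>: "0 < \<epsilon> n" for n by (simp add: \<epsilon>_def)
  have \<epsilon>_mono: "\<epsilon> m \<le> \<epsilon> n" if "n \<le> m" for m n
    using that by (auto simp: \<epsilon>_def intro!: divide_left_mono)
  have "\<epsilon> = (\<lambda>n. inverse (real (Suc n)))" by (simp add: \<epsilon>_def fun_eq_iff inverse_eq_divide)
  then have \<epsilon>_lim: "\<epsilon> \<longlonglongrightarrow> 0" using LIMSEQ_inverse_real_of_nat by simp
  define Q where "Q n = {H \<in> linear_combinations T X. feasible K1 K2 (1 - \<epsilon> n) (r + \<epsilon> n) H}" for n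
  have Q_mono: "Q m \<subseteq> Q n" if "n \<le> m" for m n
    using \<epsilon>_mono[OF that] unfolding Q_def feasible_def by force
  \<comment> \<open>The infimum of the second moment under slack \<open>\<epsilon> n\<close>. Less
    slack leaves fewer candidates, so \<open>p\<close> increases; it stays below
    \<open>d\<^sup>2\<close>, and its convergence drives the Cauchy estimate.\<close>
  define p where "p n = Inf ((\<lambda>H. (rms M H)\<^sup>2) ` Q n)" for n
  have bdd: "bdd_below ((\<lambda>H. (rms M H)\<^sup>2) ` Q n)" for n by (rule bdd_belowI2[of _ 0]) simp
  have p_le: "p n \<le> (rms M H)\<^sup>2" if "H \<in> Q n" for n H
    unfolding p_def using that by (intro cInf_lower bdd imageI)
  have ex: "\<exists>H\<in>Q n. rms M H \<le> d + e" if "0 < e" "e \<le> \<epsilon> n" for n e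
    using approx[OF that(1)] that(2) unfolding Q_def feasible_def by force
  \<comment> \<open>Points feasible with slack \<open>e < \<epsilon> n\<close> and of norm at most
    \<open>d + e\<close> lie in \<open>Q n\<close>; letting \<open>e\<close> tend to
    \<open>0\<close> removes the excess over \<open>d\<close>.\<close>
  have p_bound: "p n \<le> d\<^sup>2" for n
  proof (rule tendsto_lowerbound)
    show "((\<lambda>e. (d + e)\<^sup>2) \<longlongrightarrow> d\<^sup>2) (at_right 0)"
      by (rule tendsto_eq_intros refl | simp)+
    show "\<forall>\<^sub>F e in at_right 0. p n \<le> (d + e)\<^sup>2"
      unfolding eventually_at_right_field
    proof (intro exI[of _ "\<epsilon> n"] conjI allI impI \<epsilon>)
      fix e assume e: "0 < e" "e < \<epsilon> n"
      then obtain H where H: "H \<in> Q n" "rms M H \<le> d + e" using ex[of e n] by auto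
      have "(rms M H)\<^sup>2 \<le> (d + e)\<^sup>2" using H by (intro power_mono) auto
      with p_le[OF H(1)] show "p n \<le> (d + e)\<^sup>2" by linarith
    qed
  qed simp
  have "incseq p"
  proof (rule incseq_SucI)
    fix n
    have "(\<lambda>H. (rms M H)\<^sup>2) ` Q (Suc n) \<noteq> {}" using ex[OF \<epsilon>, of "Suc n" "Suc n"] by auto
    then show "p n \<le> p (Suc n)"
      unfolding p_def using Q_mono[of n "Suc n"] by (intro cInf_superset_mono bdd) auto
  qed
  then obtain p' where p': "p \<longlonglongrightarrow> p'" "\<And>n. p n \<le> p'"
    using incseq_convergent[of p "d\<^sup>2"] p_bound by blast
  have "\<exists>H\<in>Q n. (rms M H)\<^sup>2 < p n + \<epsilon> n" for n
    using cInf_lessD[of "(\<lambda>H. (rms M H)\<^sup>2) ` Q n" "p n + \<epsilon> n"] ex[OF \<epsilon>, of n n] \<epsilon>[of n]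
    by (auto simp: p_def)
  then obtain F where F: "\<And>n. F n \<in> Q n" "\<And>n. (rms M (F n))\<^sup>2 < p n + \<epsilon> n" by metis
  have F_mem: "F n \<in> linear_combinations T X" for n using F(1) by (auto simp: Q_def)
  have F_sq: "square_integrable M (F n)" for n by (rule square_integrable[OF F_mem])
  have cauchy: "expectation (\<lambda>\<omega>. (F m \<omega> - F n \<omega>)\<^sup>2) \<le> 2 * (p' - p n) + 4 * \<epsilon> n" if "n \<le> m" for m n
  proof -
    define G where "G = (\<lambda>\<omega>. (1/2) * (F n \<omega> + F m \<omega>))"
    have "F m \<in> Q n" using F(1)[of m] Q_mono[OF that] by blast
    have cov: "(LINT \<omega>|M. X t \<omega> * G \<omega>)
        = ((LINT \<omega>|M. X t \<omega> * F n \<omega>) + (LINT \<omega>|M. X t \<omega> * F m \<omega>)) / 2" if "t \<in> T" for t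
      using square_integrable_mult[OF square_integrable[OF X_mem[OF that]] F_sq]
      by (simp add: G_def distrib_left)
    have G_mem: "G \<in> linear_combinations T X"
      unfolding G_def by (intro scale add F_mem)
    have "G \<in> Q n"
      unfolding Q_def feasible_def
    proof (intro CollectI conjI ballI G_mem)
      fix t assume t: "t \<in> K1"
      then have "1 - \<epsilon> n \<le> (LINT \<omega>|M. X t \<omega> * F n \<omega>)" "1 - \<epsilon> n \<le> (LINT \<omega>|M. X t \<omega> * F m \<omega>)"
        using F(1)[of n] \<open>F m \<in> Q n\<close> by (auto simp: Q_def feasible_def)
      moreover have "t \<in> T" using t K by blast
      ultimately show "1 - \<epsilon> n \<le> (LINT \<omega>|M. X t \<omega> * G \<omega>)" unfolding cov[OF \<open>t \<in> T\<close>] by (simp add: field_simps)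
    next
      fix t assume t: "t \<in> K2"
      then have "(LINT \<omega>|M. X t \<omega> * F n \<omega>) \<le> r + \<epsilon> n" "(LINT \<omega>|M. X t \<omega> * F m \<omega>) \<le> r + \<epsilon> n"
        using F(1)[of n] \<open>F m \<in> Q n\<close> by (auto simp: Q_def feasible_def)
      moreover have "t \<in> T" using t K by blast
      ultimately show "(LINT \<omega>|M. X t \<omega> * G \<omega>) \<le> r + \<epsilon> n" unfolding cov[OF \<open>t \<in> T\<close>] by (simp add: field_simps)
    qed
    then have "4 * p n \<le> (rms M (\<lambda>\<omega>. F n \<omega> + 1 * F m \<omega>))\<^sup>2"
      using p_le[of G n] unfolding G_def rms_scale by (simp add: power_mult_distrib power_divide)
    moreover have "expectation (\<lambda>\<omega>. (F m \<omega> - F n \<omega>)\<^sup>2)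
        = 2 * (rms M (F n))\<^sup>2 + 2 * (rms M (F m))\<^sup>2 - (rms M (\<lambda>\<omega>. F n \<omega> + 1 * F m \<omega>))\<^sup>2"
    proof -
      have "(F m \<omega> - F n \<omega>)\<^sup>2 = (F n \<omega> + (-1) * F m \<omega>)\<^sup>2" for \<omega>
        by (simp add: power2_eq_square algebra_simps)
      then show ?thesis
        unfolding rms_square by (simp only: integral_square_add_scale[OF F_sq F_sq]) simp
    qed
    \<comment> \<open>The second moments of \<open>F n\<close> and \<open>F m\<close> are below
      \<open>p n + \<epsilon> n\<close> and \<open>p m + \<epsilon> m\<close>, twice each, and
      \<open>4 * p n\<close> is subtracted; \<open>p m \<le> p'\<close> and
      \<open>\<epsilon> m \<le> \<epsilon> n\<close> give the claim.\<close>
    ultimately show ?thesis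
      using F(2)[of n] F(2)[of m] p'(2)[of m] \<epsilon>_mono[OF that]
      unfolding right_diff_distrib by linarith
  qed
  have "\<exists>N. \<forall>m\<ge>N. \<forall>n\<ge>N. expectation (\<lambda>\<omega>. (F m \<omega> - F n \<omega>)\<^sup>2) < e" if "0 < e" for e
  proof -
    have "(\<lambda>n. 2 * (p' - p n) + 4 * \<epsilon> n) \<longlonglongrightarrow> 2 * (p' - p') + 4 * 0"
      by (intro tendsto_intros p'(1) \<epsilon>_lim)
    then have "eventually (\<lambda>n. 2 * (p' - p n) + 4 * \<epsilon> n < e) sequentially"
      using order_tendstoD(2) \<open>0 < e\<close> by fastforce
    then obtain N where N: "\<And>n. N \<le> n \<Longrightarrow> 2 * (p' - p n) + 4 * \<epsilon> n < e"
      by (auto simp: eventually_sequentially)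
    have "expectation (\<lambda>\<omega>. (F m \<omega> - F n \<omega>)\<^sup>2) < e" if "N \<le> m" "N \<le> n" for m n
    proof (cases "n \<le> m")
      case True
      with cauchy[OF this] N[OF that(2)] show ?thesis by linarith
    next
      case False
      then have "expectation (\<lambda>\<omega>. (F n \<omega> - F m \<omega>)\<^sup>2) < e"
        using cauchy[of m n] N[OF that(1)] by linarith
      then show ?thesis by (simp add: power2_commute)
    qed
    then show ?thesis by blast
  qed
  then obtain H where H: "square_integrable M H" and lim: "(\<lambda>n. rms M (\<lambda>\<omega>. H \<omega> - F n \<omega>)) \<longlonglongrightarrow> 0"
    using square_integrable_complete[where F = F, OF F_sq] by blast
  show thesis
  proof (rule that)
    show "H \<in> field_L2_space M T X" by (rule field_L2_spaceI[OF H F_mem lim])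
    show "rms M H \<le> d"
    proof (rule LIMSEQ_le_const)
      have "(\<lambda>n. sqrt (d\<^sup>2 + \<epsilon> n) + rms M (\<lambda>\<omega>. H \<omega> - F n \<omega>)) \<longlonglongrightarrow> sqrt (d\<^sup>2 + 0) + 0"
        by (intro tendsto_intros \<epsilon>_lim lim)
      with \<open>0 \<le> d\<close> show "(\<lambda>n. sqrt (d\<^sup>2 + \<epsilon> n) + rms M (\<lambda>\<omega>. H \<omega> - F n \<omega>)) \<longlonglongrightarrow> d" by simp
      have "rms M H \<le> sqrt (d\<^sup>2 + \<epsilon> n) + rms M (\<lambda>\<omega>. H \<omega> - F n \<omega>)" for n
      proof -
        have "rms M (F n) \<le> sqrt (d\<^sup>2 + \<epsilon> n)"
          using F(2)[of n] p_bound[of n] by (intro real_le_rsqrt) linarith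
        with rms_add[OF F_sq[of n] square_integrable_diff[OF H F_sq[of n]]] show ?thesis by simp
      qed
      then show "\<exists>N. \<forall>n\<ge>N. rms M H \<le> sqrt (d\<^sup>2 + \<epsilon> n) + rms M (\<lambda>\<omega>. H \<omega> - F n \<omega>)" by blast
    qed
    have conv: "(\<lambda>n. (LINT \<omega>|M. X t \<omega> * F n \<omega>)) \<longlonglongrightarrow> (LINT \<omega>|M. X t \<omega> * H \<omega>)" if "t \<in> T" for t
    proof (rule LIM_zero_cancel, rule tendsto_rabs_zero_cancel, rule real_tendsto_sandwich)
      show "\<forall>\<^sub>F n in sequentially. 0 \<le> \<bar>(LINT \<omega>|M. X t \<omega> * F n \<omega>) - (LINT \<omega>|M. X t \<omega> * H \<omega>)\<bar>" by simp
      show "\<forall>\<^sub>F n in sequentially. \<bar>(LINT \<omega>|M. X t \<omega> * F n \<omega>) - (LINT \<omega>|M. X t \<omega> * H \<omega>)\<bar>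
          \<le> rms M (X t) * rms M (\<lambda>\<omega>. H \<omega> - F n \<omega>)"
        using covariance_diff_le[OF that F_sq H] by (simp add: rms_diff_commute[of M "F _" H])
      show "(\<lambda>n. rms M (X t) * rms M (\<lambda>\<omega>. H \<omega> - F n \<omega>)) \<longlonglongrightarrow> 0"
        using tendsto_mult_right_zero[OF lim] by simp
    qed simp
    show "feasible K1 K2 1 r H"
      unfolding feasible_def
    proof (intro conjI ballI)
      fix t assume t: "t \<in> K1"
      show "1 \<le> (LINT \<omega>|M. X t \<omega> * H \<omega>)"
      proof (rule LIMSEQ_le)
        show "(\<lambda>n. 1 - \<epsilon> n) \<longlonglongrightarrow> 1" using tendsto_diff[OF tendsto_const \<epsilon>_lim, of 1] by simp
        show "(\<lambda>n. (LINT \<omega>|M. X t \<omega> * F n \<omega>)) \<longlonglongrightarrow> (LINT \<omega>|M. X t \<omega> * H \<omega>)" using conv t K by auto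
        show "\<exists>N. \<forall>n\<ge>N. 1 - \<epsilon> n \<le> (LINT \<omega>|M. X t \<omega> * F n \<omega>)"
          using F(1) t by (auto simp: Q_def feasible_def)
      qed
    next
      fix t assume t: "t \<in> K2"
      show "(LINT \<omega>|M. X t \<omega> * H \<omega>) \<le> r"
      proof (rule LIMSEQ_le)
        show "(\<lambda>n. r + \<epsilon> n) \<longlonglongrightarrow> r" using tendsto_add[OF tendsto_const \<epsilon>_lim, of r] by simp
        show "(\<lambda>n. (LINT \<omega>|M. X t \<omega> * F n \<omega>)) \<longlonglongrightarrow> (LINT \<omega>|M. X t \<omega> * H \<omega>)" using conv t K by auto
        show "\<exists>N. \<forall>n\<ge>N. (LINT \<omega>|M. X t \<omega> * F n \<omega>) \<le> r + \<epsilon> n"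
          using F(1) t by (auto simp: Q_def feasible_def)
      qed
    qed
  qed
qed

end

section \<open>Bounds for a single pair of compact sets\<close>

context continuous_gaussian_field
begin

text \<open>A continuous positive function on a compact set is bounded away from zero, so positivity
  on \<open>K\<close> amounts to some bound \<open>1 / real (Suc n)\<close> on a countable dense
  subset. The inequality there has to be a closed one with a margin, because a strict one would not
  pass to the closure.\<close>

lemma positive_on_compact_measurable:
  fixes Y :: "'t \<Rightarrow> 'w \<Rightarrow> real"
  assumes K: "compact K" and [measurable]: "\<And>t. t \<in> K \<Longrightarrow> Y t \<in> borel_measurable M"
    and cont: "\<And>\<omega>. \<omega> \<in> space M \<Longrightarrow> continuous_on K (\<lambda>t. Y t \<omega>)"
  shows "{\<omega> \<in> space M. \<forall>t\<in>K. 0 < Y t \<omega>} \<in> sets M"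
proof (cases "K = {}")
  case False
  obtain D where D: "countable D" "D \<subseteq> K" "K \<subseteq> closure D" using separable[of K] by auto
  then have closure: "closure D = K"
    using closure_minimal[of D K] compact_imp_closed[OF K] by blast
  have "{\<omega> \<in> space M. \<forall>t\<in>K. 0 < Y t \<omega>} = (\<Union>n. {\<omega> \<in> space M. \<forall>t\<in>D. 1 / real (Suc n) \<le> Y t \<omega>})"
  proof (intro equalityI subsetI)
    fix \<omega> assume "\<omega> \<in> {\<omega> \<in> space M. \<forall>t\<in>K. 0 < Y t \<omega>}"
    then have \<omega>: "\<omega> \<in> space M" "\<And>t. t \<in> K \<Longrightarrow> 0 < Y t \<omega>" by auto
    obtain t where t: "t \<in> K" "\<And>s. s \<in> K \<Longrightarrow> Y t \<omega> \<le> Y s \<omega>"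
      using continuous_attains_inf[OF K False cont[OF \<omega>(1)]] by blast
    obtain n where "1 / real (Suc n) < Y t \<omega>" using nat_approx_posE[OF \<omega>(2)[OF t(1)]] by blast
    then have "\<forall>s\<in>D. 1 / real (Suc n) \<le> Y s \<omega>" using t(2) D by (meson less_le_trans less_imp_le subsetD)
    with \<omega> show "\<omega> \<in> (\<Union>n. {\<omega> \<in> space M. \<forall>t\<in>D. 1 / real (Suc n) \<le> Y t \<omega>})" by blast
  next
    fix \<omega> assume "\<omega> \<in> (\<Union>n. {\<omega> \<in> space M. \<forall>t\<in>D. 1 / real (Suc n) \<le> Y t \<omega>})"
    then obtain n where n: "\<omega> \<in> space M" "\<And>t. t \<in> D \<Longrightarrow> 1 / real (Suc n) \<le> Y t \<omega>" by blast
    have "1 / real (Suc n) \<le> Y t \<omega>" if "t \<in> K" for t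
      by (rule continuous_ge_on_closure[of D]) (use cont n closure that in auto)
    moreover have "0 < 1 / real (Suc n)" by simp
    ultimately show "\<omega> \<in> {\<omega> \<in> space M. \<forall>t\<in>K. 0 < Y t \<omega>}" using n(1) less_le_trans by blast
  qed
  also have "\<dots> \<in> sets M"
    using D by (intro sets.countable_UN sets.sets_Collect_countable_All' image_subsetI)
      (auto intro!: borel_measurable_le assms(2) simp del: of_nat_Suc)
  finally show ?thesis .
qed simp

lemma excursion_sets:
  assumes K1: "K1 \<in> compact_subsets T" and K2: "K2 \<in> compact_subsets T"
  shows "excursion K1 K2 a b \<in> sets M"
proof -
  have "{\<omega> \<in> space M. \<forall>t\<in>K1. 0 < X t \<omega> - a} \<in> sets M"
    using K1 X_measurable continuous_paths
    by (intro positive_on_compact_measurable borel_measurable_diff continuous_intros)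
      (auto simp: compact_subsets_def intro: continuous_on_subset)
  moreover have "{\<omega> \<in> space M. \<forall>t\<in>K2. 0 < b - X t \<omega>} \<in> sets M"
    using K2 X_measurable continuous_paths
    by (intro positive_on_compact_measurable borel_measurable_diff continuous_intros)
      (auto simp: compact_subsets_def intro: continuous_on_subset)
  ultimately have "{\<omega> \<in> space M. \<forall>t\<in>K1. 0 < X t \<omega> - a} \<inter> {\<omega> \<in> space M. \<forall>t\<in>K2. 0 < b - X t \<omega>} \<in> sets M"
    by (rule sets.Int)
  also have "{\<omega> \<in> space M. \<forall>t\<in>K1. 0 < X t \<omega> - a} \<inter> {\<omega> \<in> space M. \<forall>t\<in>K2. 0 < b - X t \<omega>} = excursion K1 K2 a b"
    by (auto simp: excursion_def)
  finally show ?thesis .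
qed

text \<open>The room comes from the strict inequalities \<open>(rms M H)\<^sup>2 < x\<close> and
  \<open>\<tau> < r\<close>. A single small \<open>\<kappa>\<close> measures all errors: in
  approximating \<open>H\<close>, in the position of the interval for \<open>Y\<close>, and in the
  size of the remainder.\<close>

lemma excursion_lower_bound:
  assumes K1: "K1 \<in> compact_subsets T" and K2: "K2 \<in> compact_subsets T"
    and r: "0 \<le> \<tau>" "\<tau> < r" "r \<le> 1"
    and H: "H \<in> field_L2_space M T X" "feasible K1 K2 1 \<tau> H" "(rms M H)\<^sup>2 < x"
  obtains c u0 where "0 < c" "\<And>u. u0 \<le> u \<Longrightarrow> c * exp (- (x * u\<^sup>2 / 2)) \<le> prob (excursion K1 K2 u (r * u))"
proof -
  have K: "compact K1" "K1 \<noteq> {}" "K1 \<subseteq> T" "compact K2" "K2 \<noteq> {}" "K2 \<subseteq> T"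
    using K1 K2 by (auto simp: compact_subsets_def)
  define h where "h = rms M H"
  note H_sq = field_L2_spaceD(1)[OF H(1)]
  obtain C where C: "0 < C" "\<And>t. t \<in> T \<Longrightarrow> rms M (X t) \<le> C" using rms_bounded by blast
  \<comment> \<open>Two requirements on \<open>\<kappa>\<close>. The approximation of
    \<open>H\<close> will have norm at most \<open>h + \<kappa>\<close> and its level is overshot by
    a factor up to \<open>1 + 2 * \<kappa>\<close>, so the squared product, which becomes the rate,
    must stay below \<open>x\<close>. And the total error \<open>3 * \<kappa>\<close> in the
    constraint on \<open>K2\<close> must fit between \<open>\<tau>\<close> and
    \<open>r\<close>.\<close>
  have "((\<lambda>\<kappa>. ((h + \<kappa>) * (1 + 2 * \<kappa>))\<^sup>2) \<longlongrightarrow> ((h + 0) * (1 + 2 * 0))\<^sup>2) (at_right 0)"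
    by (intro tendsto_intros)
  then have "eventually (\<lambda>\<kappa>. ((h + \<kappa>) * (1 + 2 * \<kappa>))\<^sup>2 < x) (at_right 0)"
    using order_tendstoD(2) H(3) by (fastforce simp: h_def)
  moreover have "eventually (\<lambda>\<kappa>. \<kappa> \<in> {0<..<min 1 ((r - \<tau>) / 3)}) (at_right 0)"
    using r by (intro eventually_at_right_real) auto
  ultimately have ev: "eventually (\<lambda>\<kappa>. ((h + \<kappa>) * (1 + 2 * \<kappa>))\<^sup>2 < x
      \<and> \<kappa> \<in> {0<..<min 1 ((r - \<tau>) / 3)}) (at_right 0)"
    by eventually_elim simp
  have "at_right (0 :: real) \<noteq> bot" by simp
  from eventually_happens'[OF this ev] obtain \<kappa> where
    \<kappa>0: "((h + \<kappa>) * (1 + 2 * \<kappa>))\<^sup>2 < x" "\<kappa> \<in> {0<..<min 1 ((r - \<tau>) / 3)}" by (elim exE conjE)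
  then have \<kappa>: "((h + \<kappa>) * (1 + 2 * \<kappa>))\<^sup>2 < x" "0 < \<kappa>" "\<kappa> < 1" "3 * \<kappa> < r - \<tau>" by simp_all
  \<comment> \<open>Accuracy \<open>\<kappa>\<close> controls the norm of \<open>Y\<close>; accuracy
    \<open>\<kappa> / (4 * C)\<close> changes each covariance with \<open>X t\<close> by at most
    \<open>\<kappa> / 4\<close>.\<close>
  have "0 < min \<kappa> (\<kappa> / (4 * C))" using \<kappa> C by simp
  then obtain Y where Y: "Y \<in> linear_combinations T X" "rms M (\<lambda>\<omega>. H \<omega> - Y \<omega>) < min \<kappa> (\<kappa> / (4 * C))"
    using field_L2_spaceD(2)[OF H(1)] by blast
  note Y_sq = square_integrable[OF Y(1)]
  note [measurable] = borel_measurable[OF Y(1)]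
  define m where "m t = (LINT \<omega>|M. X t \<omega> * Y \<omega>)" for t
  have m: "\<bar>m t - (LINT \<omega>|M. X t \<omega> * H \<omega>)\<bar> \<le> \<kappa> / 4" if "t \<in> T" for t
  proof -
    have "rms M (X t) * rms M (\<lambda>\<omega>. H \<omega> - Y \<omega>) \<le> C * (\<kappa> / (4 * C))"
      using C(2)[OF that] C(1) Y(2) by (intro mult_mono) auto
    also have "\<dots> = \<kappa> / 4" using C by simp
    finally show ?thesis
      using covariance_diff_le[OF that Y_sq H_sq] by (simp add: m_def rms_diff_commute[of M Y H])
  qed
  have m1: "1 - \<kappa> / 4 \<le> m t" if "t \<in> K1" for t
  proof -
    have "1 \<le> (LINT \<omega>|M. X t \<omega> * H \<omega>)" "t \<in> T" using H(2) that K by (auto simp: feasible_def)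
    with m[of t] show ?thesis by linarith
  qed
  have m2: "m t \<le> \<tau> + \<kappa> / 4" if "t \<in> K2" for t
  proof -
    have "(LINT \<omega>|M. X t \<omega> * H \<omega>) \<le> \<tau>" "t \<in> T" using H(2) that K by (auto simp: feasible_def)
    with m[of t] show ?thesis by linarith
  qed
  define \<sigma> where "\<sigma> = rms M Y"
  have \<sigma>: "0 < \<sigma>"
  proof (rule ccontr)
    assume "\<not> 0 < \<sigma>"
    then have "\<sigma> = 0" using rms_nonneg[of M Y] by (simp add: \<sigma>_def)
    obtain t where "t \<in> K1" using K by auto
    with K have "t \<in> T" by auto
    then have "\<bar>m t\<bar> \<le> rms M (X t) * \<sigma>"
      unfolding m_def \<sigma>_def by (intro Cauchy_Schwarz_integral Y_sq square_integrable X_mem)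
    with \<open>\<sigma> = 0\<close> m1[OF \<open>t \<in> K1\<close>] \<kappa> show False by simp
  qed
  have "\<sigma> \<le> h + \<kappa>"
  proof -
    have "\<sigma> \<le> rms M H + rms M (\<lambda>\<omega>. Y \<omega> - H \<omega>)"
      using rms_add[OF H_sq square_integrable_diff[OF Y_sq H_sq]] by (simp add: \<sigma>_def)
    with Y(2) show ?thesis by (simp add: h_def rms_diff_commute[of M Y H])
  qed
  define \<theta> where "\<theta> = 1 + 2 * \<kappa>"
  have "(\<sigma> * \<theta>)\<^sup>2 \<le> ((h + \<kappa>) * (1 + 2 * \<kappa>))\<^sup>2"
    using \<sigma> \<open>\<sigma> \<le> h + \<kappa>\<close> \<kappa> unfolding \<theta>_def by (intro power_mono mult_right_mono) auto
  with \<kappa> have \<sigma>\<theta>: "(\<sigma> * \<theta>)\<^sup>2 \<le> x" by linarith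
  define v where "v = \<sigma>\<^sup>2"
  have v: "0 < v" using \<sigma> by (simp add: v_def)
  \<comment> \<open>Regression of \<open>X t\<close> on \<open>Y\<close>: the coefficient
    \<open>m t / v\<close> is the one that leaves a remainder uncorrelated with
    \<open>Y\<close>.\<close>
  define R where "R t = (\<lambda>\<omega>. X t \<omega> - (m t / v) * Y \<omega>)" for t
  have R_mem: "R t \<in> linear_combinations T X" if "t \<in> T" for t
    unfolding R_def using that by (intro diff scale X_mem Y(1))
  have R_cov: "expectation (\<lambda>\<omega>. Y \<omega> * R t \<omega>) = 0" if "t \<in> T" for t
  proof -
    have "(\<lambda>\<omega>. Y \<omega> * R t \<omega>) = (\<lambda>\<omega>. X t \<omega> * Y \<omega> - (m t / v) * (Y \<omega>)\<^sup>2)"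
      by (simp add: R_def fun_eq_iff algebra_simps power2_eq_square)
    moreover have "integrable M (\<lambda>\<omega>. X t \<omega> * Y \<omega>)"
      using that by (intro square_integrable_mult Y_sq square_integrable X_mem)
    ultimately have "expectation (\<lambda>\<omega>. Y \<omega> * R t \<omega>) = m t - (m t / v) * expectation (\<lambda>\<omega>. (Y \<omega>)\<^sup>2)"
      using Y_sq by (simp add: m_def square_integrable_def)
    also have "expectation (\<lambda>\<omega>. (Y \<omega>)\<^sup>2) = v" by (simp add: v_def \<sigma>_def rms_square)
    finally show ?thesis using v by simp
  qed
  \<comment> \<open>Separate dense sets let each constraint be extended to its own compact set;
    their union provides one sequence of remainders, as the independence statement requires.\<close>
  obtain D1 where D1: "countable D1" "D1 \<subseteq> K1" "K1 \<subseteq> closure D1" using separable[of K1] by auto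
  obtain D2 where D2: "countable D2" "D2 \<subseteq> K2" "K2 \<subseteq> closure D2" using separable[of K2] by auto
  define D where "D = D1 \<union> D2"
  have D: "countable D" "D \<subseteq> T" "D \<noteq> {}" using D1 D2 K by (auto simp: D_def)
  define Z where "Z k = R (from_nat_into D k)" for k
  have D_mem: "from_nat_into D k \<in> D" for k by (rule from_nat_into[OF D(3)])
  then have D_T: "from_nat_into D k \<in> T" for k using D(2) by auto
  have Z: "Z k \<in> linear_combinations T X" "expectation (\<lambda>\<omega>. Y \<omega> * Z k \<omega>) = 0" for k
    unfolding Z_def using R_mem[OF D_T] R_cov[OF D_T] by auto
  have [measurable]: "Z k \<in> borel_measurable M" for k using Z(1) by (rule borel_measurable)
  have "(\<lambda>n. prob {\<omega> \<in> space M. \<forall>k. \<bar>Z k \<omega>\<bar> \<le> real n}) \<longlonglongrightarrow> prob (\<Union>n. {\<omega> \<in> space M. \<forall>k. \<bar>Z k \<omega>\<bar> \<le> real n})"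
    by (rule finite_Lim_measure_incseq) (auto simp: incseq_def intro: order_trans)
  also have "(\<Union>n. {\<omega> \<in> space M. \<forall>k. \<bar>Z k \<omega>\<bar> \<le> real n}) = space M"
  proof (intro equalityI subsetI)
    fix \<omega> assume \<omega>: "\<omega> \<in> space M"
    have "bounded ((\<lambda>t. X t \<omega>) ` T)"
      by (intro compact_imp_bounded compact_continuous_image continuous_paths[OF \<omega>] compact)
    then obtain b where b: "\<And>t. t \<in> T \<Longrightarrow> \<bar>X t \<omega>\<bar> \<le> b" by (auto simp: bounded_iff)
    obtain n where n: "b + (C * \<sigma> / v) * \<bar>Y \<omega>\<bar> \<le> real n" using real_arch_simple by blast
    have "\<bar>Z k \<omega>\<bar> \<le> real n" for k
    proof -
      define t where "t = from_nat_into D k"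
      have t: "t \<in> T" using D_T by (simp add: t_def)
      have "\<bar>m t\<bar> \<le> rms M (X t) * \<sigma>"
        unfolding m_def \<sigma>_def by (intro Cauchy_Schwarz_integral Y_sq square_integrable X_mem t)
      also have "\<dots> \<le> C * \<sigma>" using C(2)[OF t] \<sigma> by (intro mult_right_mono) auto
      finally have "\<bar>m t / v\<bar> \<le> C * \<sigma> / v" using v by (simp add: abs_divide divide_right_mono)
      then have "\<bar>m t / v * Y \<omega>\<bar> \<le> (C * \<sigma> / v) * \<bar>Y \<omega>\<bar>"
        unfolding abs_mult by (intro mult_right_mono) auto
      moreover have "\<bar>Z k \<omega>\<bar> \<le> \<bar>X t \<omega>\<bar> + \<bar>m t / v * Y \<omega>\<bar>"
        unfolding Z_def R_def t_def by (rule abs_triangle_ineq4)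
      ultimately show ?thesis using b[OF t] n by linarith
    qed
    with \<omega> show "\<omega> \<in> (\<Union>n. {\<omega> \<in> space M. \<forall>k. \<bar>Z k \<omega>\<bar> \<le> real n})" by blast
  qed auto
  finally have "(\<lambda>n. prob {\<omega> \<in> space M. \<forall>k. \<bar>Z k \<omega>\<bar> \<le> real n}) \<longlonglongrightarrow> 1" by (simp add: prob_space)
  from order_tendstoD(1)[OF this, of "1 / 2"]
  obtain n0 where n0: "1 / 2 < prob {\<omega> \<in> space M. \<forall>k. \<bar>Z k \<omega>\<bar> \<le> real n0}"
    by (auto simp: eventually_sequentially)
  \<comment> \<open>\<open>\<kappa> * v\<close> bounds the length of the interval for
    \<open>Y\<close> from below, \<open>sqrt (2 * pi * v)\<close> normalises its density, and the
    last factor is the probability kept by the event that all remainders are small.\<close>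
  define c where "c = \<kappa> * v / sqrt (2 * pi * v) / 2"
  show thesis
  proof
    show "0 < c" using \<kappa> v by (simp add: c_def)
    fix u assume u: "max 1 (real n0 / (\<kappa> / 4)) \<le> u"
    then have "1 \<le> u" "real n0 \<le> \<kappa> / 4 * u" using \<kappa> by (auto simp: field_simps)
    have Icc_iff: "z \<in> {- w..w} \<longleftrightarrow> \<bar>z\<bar> \<le> w" for z w :: real by auto
    \<comment> \<open>\<open>Y / v\<close> is to lie between \<open>(1 + \<kappa>) * u\<close> and
      \<open>(1 + 2 * \<kappa>) * u\<close>; the lower end leaves room for the errors on
      \<open>K1\<close>, the upper end limits those on \<open>K2\<close>.\<close>
    define a b where "a = (1 + \<kappa>) * u * v" and "b = \<theta> * u * v"
    have ab: "0 \<le> a" "a \<le> b"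
      unfolding a_def b_def \<theta>_def using \<kappa> v \<open>1 \<le> u\<close> by (auto intro!: mult_right_mono)
    have "1 / 2 \<le> prob {\<omega> \<in> space M. \<forall>k. Z k \<omega> \<in> {- (\<kappa> / 4 * u)..\<kappa> / 4 * u}}"
    proof -
      have "prob {\<omega> \<in> space M. \<forall>k. \<bar>Z k \<omega>\<bar> \<le> real n0}
          \<le> prob {\<omega> \<in> space M. \<forall>k. Z k \<omega> \<in> {- (\<kappa> / 4 * u)..\<kappa> / 4 * u}}"
      proof (rule finite_measure_mono)
        show "{\<omega> \<in> space M. \<forall>k. \<bar>Z k \<omega>\<bar> \<le> real n0} \<subseteq> {\<omega> \<in> space M. \<forall>k. Z k \<omega> \<in> {- (\<kappa> / 4 * u)..\<kappa> / 4 * u}}"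
        proof (intro subsetI CollectI conjI allI; elim CollectE conjE)
          fix \<omega> k assume "\<forall>k. \<bar>Z k \<omega>\<bar> \<le> real n0"
          then have "\<bar>Z k \<omega>\<bar> \<le> \<kappa> / 4 * u" using \<open>real n0 \<le> \<kappa> / 4 * u\<close> order_trans by blast
          then show "Z k \<omega> \<in> {- (\<kappa> / 4 * u)..\<kappa> / 4 * u}" by (simp only: Icc_iff)
        qed
      qed measurable
      with n0 show ?thesis by linarith
    qed
    moreover have "2 * c * exp (- (x * u\<^sup>2 / 2)) \<le> prob {\<omega> \<in> space M. Y \<omega> \<in> {a..b}}"
    proof -
      have "b\<^sup>2 / (2 * \<sigma>\<^sup>2) = (\<sigma> * \<theta>)\<^sup>2 * u\<^sup>2 / 2"
        using \<sigma> by (simp add: b_def v_def power2_eq_square)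
      also have "\<dots> \<le> x * u\<^sup>2 / 2" using \<sigma>\<theta> by (simp add: mult_right_mono)
      finally have "exp (- (x * u\<^sup>2 / 2)) \<le> exp (- b\<^sup>2 / (2 * \<sigma>\<^sup>2))" by simp
      moreover have "\<kappa> * v \<le> b - a"
      proof -
        have "\<kappa> * v * 1 \<le> \<kappa> * v * u" using \<kappa> v \<open>1 \<le> u\<close> by (intro mult_left_mono) auto
        also have "\<dots> = b - a" by (simp add: a_def b_def \<theta>_def algebra_simps)
        finally show ?thesis by simp
      qed
      ultimately have "\<kappa> * v / sqrt (2 * pi * v) * exp (- (x * u\<^sup>2 / 2))
          \<le> (b - a) / sqrt (2 * pi * v) * exp (- b\<^sup>2 / (2 * \<sigma>\<^sup>2))"
        using \<kappa> v ab by (intro mult_mono divide_right_mono) auto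
      also have "\<dots> = (b - a) * normal_density 0 \<sigma> b"
        by (simp add: normal_density_def v_def)
      also have "\<dots> \<le> prob {\<omega> \<in> space M. a \<le> Y \<omega> \<and> Y \<omega> \<le> b}"
        unfolding \<sigma>_def by (rule prob_Icc_ge[OF Y(1)]) (use \<sigma> ab in \<open>auto simp: \<sigma>_def\<close>)
      finally show ?thesis by (simp add: c_def)
    qed
    ultimately have "(2 * c * exp (- (x * u\<^sup>2 / 2))) * (1 / 2)
        \<le> prob {\<omega> \<in> space M. Y \<omega> \<in> {a..b}} * prob {\<omega> \<in> space M. \<forall>k. Z k \<omega> \<in> {- (\<kappa> / 4 * u)..\<kappa> / 4 * u}}"
      by (intro mult_mono) auto
    also have "\<dots> = prob {\<omega> \<in> space M. Y \<omega> \<in> {a..b} \<and> (\<forall>k. Z k \<omega> \<in> {- (\<kappa> / 4 * u)..\<kappa> / 4 * u})}"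
      by (rule uncorrelated_imp_independent_sequence[OF Y(1) Z, symmetric]) auto
    also have "\<dots> \<le> prob (excursion K1 K2 u (r * u))"
    proof (rule finite_measure_mono[OF _ excursion_sets[OF K1 K2]], rule subsetI, elim CollectE conjE)
      fix \<omega> assume \<omega>: "\<omega> \<in> space M" and Y_in: "Y \<omega> \<in> {a..b}" and "\<forall>k. Z k \<omega> \<in> {- (\<kappa> / 4 * u)..\<kappa> / 4 * u}"
      then have Z_le: "\<bar>Z k \<omega>\<bar> \<le> \<kappa> / 4 * u" for k by (simp only: Icc_iff)
      have R_le: "\<bar>R t \<omega>\<bar> \<le> \<kappa> / 4 * u" if "t \<in> D" for t
      proof -
        obtain k where "from_nat_into D k = t" using from_nat_into_surj[OF D(1) \<open>t \<in> D\<close>] by blast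
        with Z_le[of k] show ?thesis by (simp add: Z_def)
      qed
      define y where "y = Y \<omega> / v"
      have y: "(1 + \<kappa>) * u \<le> y" "y \<le> \<theta> * u"
        using Y_in v by (auto simp: y_def a_def b_def field_simps)
      have X_eq: "X t \<omega> = m t * y + R t \<omega>" for t by (simp add: R_def y_def)
      have "0 < (1 + \<kappa>) * u" using \<kappa> \<open>1 \<le> u\<close> by simp
      then have "0 < y" using y by linarith
      have "\<kappa>\<^sup>2 \<le> \<kappa>" using \<kappa> by (simp add: power2_eq_square mult_left_le)
      have cont: "continuous_on T (\<lambda>t. X t \<omega>)" by (rule continuous_paths[OF \<omega>])
      have clo: "closure D1 \<subseteq> T" "closure D2 \<subseteq> T"
        using closure_mono[OF D1(2)] closure_mono[OF D2(2)] K by (auto simp: compact_imp_closed closure_closed)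
      \<comment> \<open>A closed inequality with a margin extends from the dense set to
        \<open>K1\<close>, which \<open>u < X t \<omega>\<close> would not. After all losses a gain
        of \<open>\<kappa> / 2 - \<kappa>\<^sup>2 / 4\<close> remains, at least
        \<open>\<kappa> / 4\<close>.\<close>
      have "(1 + \<kappa> / 4) * u \<le> X t \<omega>" if "t \<in> K1" for t
      proof (rule continuous_ge_on_closure[of D1])
        show "continuous_on (closure D1) (\<lambda>t. X t \<omega>)" by (rule continuous_on_subset[OF cont clo(1)])
        show "t \<in> closure D1" using D1 that by auto
        fix t assume t: "t \<in> D1"
        have "(1 - \<kappa> / 4) * ((1 + \<kappa>) * u) \<le> m t * y"
          using m1[of t] t D1 y \<kappa> \<open>1 \<le> u\<close> by (intro mult_mono) auto
        moreover have "\<bar>R t \<omega>\<bar> \<le> \<kappa> / 4 * u" using R_le t by (simp add: D_def)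
        moreover have "(1 + \<kappa> / 4) * u \<le> ((1 - \<kappa> / 4) * (1 + \<kappa>) - \<kappa> / 4) * u"
          using \<open>1 \<le> u\<close> \<open>\<kappa>\<^sup>2 \<le> \<kappa>\<close>
          by (intro mult_right_mono) (auto simp: field_simps power2_eq_square)
        then have "(1 + \<kappa> / 4) * u \<le> (1 - \<kappa> / 4) * ((1 + \<kappa>) * u) - \<kappa> / 4 * u"
          by (simp only: left_diff_distrib mult.assoc)
        ultimately show "(1 + \<kappa> / 4) * u \<le> X t \<omega>"
          unfolding X_eq by linarith
      qed
      moreover have "u < (1 + \<kappa> / 4) * u" using \<open>1 \<le> u\<close> \<kappa> by simp
      moreover have "X t \<omega> \<le> (\<tau> + 3 * \<kappa>) * u" if "t \<in> K2" for t
      proof (rule continuous_le_on_closure[of D2])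
        show "continuous_on (closure D2) (\<lambda>t. X t \<omega>)" by (rule continuous_on_subset[OF cont clo(2)])
        show "t \<in> closure D2" using D2 that by auto
        fix t assume t: "t \<in> D2"
        have "m t * y \<le> (\<tau> + \<kappa> / 4) * (\<theta> * u)"
        proof -
          have "m t * y \<le> (\<tau> + \<kappa> / 4) * y"
            using m2[of t] t D2 \<open>0 < y\<close> by (intro mult_right_mono) auto
          also have "\<dots> \<le> (\<tau> + \<kappa> / 4) * (\<theta> * u)"
            using y r \<kappa> by (intro mult_left_mono) auto
          finally show ?thesis .
        qed
        moreover have "\<bar>R t \<omega>\<bar> \<le> \<kappa> / 4 * u" using R_le t by (simp add: D_def)
        moreover have "((\<tau> + \<kappa> / 4) * \<theta> + \<kappa> / 4) * u \<le> (\<tau> + 3 * \<kappa>) * u"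
        proof (rule mult_right_mono)
          \<comment> \<open>Here \<open>r \<le> 1\<close> enters: through
            \<open>\<tau> \<le> 1\<close> the cross term \<open>2 * \<tau> * \<kappa>\<close> is at
            most \<open>2 * \<kappa>\<close>, and the other error terms add up to at most
            \<open>\<kappa>\<close>.\<close>
          have "\<tau> * \<kappa> \<le> 1 * \<kappa>" using r \<kappa> by (intro mult_right_mono) auto
          then show "(\<tau> + \<kappa> / 4) * \<theta> + \<kappa> / 4 \<le> \<tau> + 3 * \<kappa>"
            using \<open>\<kappa>\<^sup>2 \<le> \<kappa>\<close> by (simp add: \<theta>_def field_simps power2_eq_square)
        qed (use \<open>1 \<le> u\<close> in simp)
        then have "(\<tau> + \<kappa> / 4) * (\<theta> * u) + \<kappa> / 4 * u \<le> (\<tau> + 3 * \<kappa>) * u"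
          by (simp only: distrib_right mult.assoc)
        ultimately show "X t \<omega> \<le> (\<tau> + 3 * \<kappa>) * u"
          unfolding X_eq by linarith
      qed
      moreover have "(\<tau> + 3 * \<kappa>) * u < r * u" using \<kappa> \<open>1 \<le> u\<close> by (intro mult_strict_right_mono) auto
      ultimately show "\<omega> \<in> excursion K1 K2 u (r * u)"
        using \<omega> unfolding excursion_def by (blast intro: less_le_trans le_less_trans)
    qed
    finally show "c * exp (- (x * u\<^sup>2 / 2)) \<le> prob (excursion K1 K2 u (r * u))" by simp
  qed
qed

text \<open>The slack \<open>e\<close> is spent in portions: \<open>e / 2\<close> for passing from
  \<open>K1\<close> and \<open>K2\<close> to finite nets, \<open>e / 4\<close> for duality,
  \<open>e / 4\<close> for the oscillation of the path over distances below \<open>\<delta>\<close>.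
  The set \<open>N\<close> covers the excursions of all neighbouring pairs at once, so that a whole
  neighbourhood costs one probability.\<close>

lemma excursion_upper_bound:
  assumes K1: "K1 \<in> compact_subsets T" and K2: "K2 \<in> compact_subsets T" and "0 \<le> d"
    and infeasible: "\<And>H. H \<in> field_L2_space M T X \<Longrightarrow> rms M H \<le> d \<Longrightarrow> \<not> feasible K1 K2 1 r H"
  obtains \<delta> u0 where "0 < \<delta>"
    "\<And>u. u0 \<le> u \<Longrightarrow> \<exists>N\<in>sets M. prob N \<le> 2 * exp (- (d\<^sup>2 * u\<^sup>2 / 2)) \<and>
      (\<forall>L1\<in>compact_subsets T. \<forall>L2\<in>compact_subsets T.
        hausdorff_dist K1 L1 < \<delta> \<longrightarrow> hausdorff_dist K2 L2 < \<delta> \<longrightarrow> excursion L1 L2 u (r * u) \<subseteq> N)"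
proof -
  let ?L = "linear_combinations T X"
  have K: "compact K1" "K1 \<noteq> {}" "K1 \<subseteq> T" "compact K2" "K2 \<noteq> {}" "K2 \<subseteq> T"
    using K1 K2 by (auto simp: compact_subsets_def)
  have ne: "?L \<noteq> {}" using K X_mem by blast
  have "\<exists>e>0. \<forall>H\<in>?L. rms M H \<le> d + e \<longrightarrow> \<not> feasible K1 K2 (1 - e) (r + e) H"
  proof (rule ccontr)
    assume "\<not> ?thesis"
    then have "\<exists>H\<in>?L. rms M H \<le> d + e \<and> feasible K1 K2 (1 - e) (r + e) H" if "0 < e" for e
      using that by blast
    from feasible_limit[OF K(3,6) \<open>0 \<le> d\<close> this] infeasible show False by blast
  qed
  then obtain e where e: "0 < e"
    "\<And>H. H \<in> ?L \<Longrightarrow> rms M H \<le> d + e \<Longrightarrow> \<not> feasible K1 K2 (1 - e) (r + e) H" by blast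
  \<comment> \<open>Covariances with an \<open>H\<close> of norm at most \<open>d + e\<close> then
    vary by at most \<open>e / 2\<close> over distances below \<open>\<eta>\<close>.\<close>
  have "0 < e / (2 * (d + e))" using e \<open>0 \<le> d\<close> by simp
  then obtain \<eta> where \<eta>: "0 < \<eta>"
    "\<And>s t. s \<in> T \<Longrightarrow> t \<in> T \<Longrightarrow> dist s t < \<eta> \<Longrightarrow> rms M (\<lambda>\<omega>. X s \<omega> - X t \<omega>) < e / (2 * (d + e))"
    using rms_uniformly_continuous by metis
  obtain F1 where F1: "finite F1" "F1 \<subseteq> K1" "\<And>t. t \<in> K1 \<Longrightarrow> \<exists>s\<in>F1. dist s t < \<eta>"
    using compact_finite_net[OF K(1) \<eta>(1)] by blast
  obtain F2 where F2: "finite F2" "F2 \<subseteq> K2" "\<And>t. t \<in> K2 \<Longrightarrow> \<exists>s\<in>F2. dist s t < \<eta>"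
    using compact_finite_net[OF K(4) \<eta>(1)] by blast
  have net: "\<not> feasible F1 F2 (1 - e / 2) (r + e / 2) H" if H: "H \<in> ?L" "rms M H \<le> d + e" for H
  proof
    assume f: "feasible F1 F2 (1 - e / 2) (r + e / 2) H"
    have close: "\<bar>(LINT \<omega>|M. X s \<omega> * H \<omega>) - (LINT \<omega>|M. X t \<omega> * H \<omega>)\<bar> \<le> e / 2"
      if "s \<in> T" "t \<in> T" "dist s t < \<eta>" for s t
    proof -
      have "rms M (\<lambda>\<omega>. X s \<omega> - X t \<omega>) * rms M H \<le> e / (2 * (d + e)) * (d + e)"
        using \<eta>(2)[OF that] H(2) e \<open>0 \<le> d\<close> by (intro mult_mono) auto
      also have "\<dots> = e / 2" using e \<open>0 \<le> d\<close> by (simp add: field_simps)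
      finally show ?thesis
        using covariance_increment_le[OF that(1,2) square_integrable[OF H(1)]] by linarith
    qed
    have "feasible K1 K2 (1 - e) (r + e) H"
      unfolding feasible_def
    proof (intro conjI ballI)
      fix t assume t: "t \<in> K1"
      then obtain s where s: "s \<in> F1" "dist s t < \<eta>" using F1 by blast
      have "1 - e / 2 \<le> (LINT \<omega>|M. X s \<omega> * H \<omega>)" using f s by (auto simp: feasible_def)
      moreover have "s \<in> T" "t \<in> T" using s t F1 K by auto
      ultimately show "1 - e \<le> (LINT \<omega>|M. X t \<omega> * H \<omega>)" using close[of s t] s by linarith
    next
      fix t assume t: "t \<in> K2"
      then obtain s where s: "s \<in> F2" "dist s t < \<eta>" using F2 by blast
      have "(LINT \<omega>|M. X s \<omega> * H \<omega>) \<le> r + e / 2" using f s by (auto simp: feasible_def)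
      moreover have "s \<in> T" "t \<in> T" using s t F2 K by auto
      ultimately show "(LINT \<omega>|M. X t \<omega> * H \<omega>) \<le> r + e" using close[of s t] s by linarith
    qed
    with e(2)[OF H] show False by blast
  qed
  \<comment> \<open>Upper constraints on \<open>F2\<close> become lower ones by a change of sign.
    The levels are relaxed by \<open>e / 4\<close>, the oscillation granted to the path; the further
    \<open>e / 4\<close> of duality completes the \<open>e / 2\<close> for which the nets are
    infeasible.\<close>
  define I :: "('t + 't) set" where "I = F1 <+> F2"
  define Z where "Z = case_sum X (\<lambda>t \<omega>. - X t \<omega>)"
  define c where "c = case_sum (\<lambda>t :: 't. 1 - e / 4) (\<lambda>t :: 't. - (r + e / 4))"
  have all_I: "(\<forall>i\<in>I. Q i) \<longleftrightarrow> (\<forall>t\<in>F1. Q (Inl t)) \<and> (\<forall>t\<in>F2. Q (Inr t))" for Q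
    by (auto simp: I_def)
  have finite_I: "finite I" using F1 F2 by (simp add: I_def)
  have Z: "Z i \<in> ?L" if "i \<in> I" for i
    using that F1(2) F2(2) K X_mem scale[OF X_mem, of _ "-1"] by (auto simp: I_def Z_def subset_iff)
  define B where "B u = {\<omega> \<in> space M. \<forall>i\<in>I. u * c i \<le> Z i \<omega>}" for u
  have B: "prob (B u) \<le> exp (- (d\<^sup>2 * u\<^sup>2 / 2))" if "0 < u" for u
    unfolding B_def
  proof (rule prob_finite_constraints_le[OF finite_I ne Z \<open>0 \<le> d\<close> _ that])
    show "0 < e / 4" using e by simp
    fix H assume H: "H \<in> ?L" "rms M H \<le> d + e / 4"
    then have "\<not> feasible F1 F2 (1 - e / 2) (r + e / 2) H" using e by (intro net) auto
    moreover have "c (Inl t) - e / 4 \<le> (LINT \<omega>|M. Z (Inl t) \<omega> * H \<omega>)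
        \<longleftrightarrow> 1 - e / 2 \<le> (LINT \<omega>|M. X t \<omega> * H \<omega>)" for t by (simp add: c_def Z_def)
    moreover have "c (Inr t) - e / 4 \<le> (LINT \<omega>|M. Z (Inr t) \<omega> * H \<omega>)
        \<longleftrightarrow> (LINT \<omega>|M. X t \<omega> * H \<omega>) \<le> r + e / 2" for t by (auto simp: c_def Z_def)
    ultimately have "\<not> (\<forall>i\<in>I. c i - e / 4 \<le> (LINT \<omega>|M. Z i \<omega> * H \<omega>))"
      by (simp add: all_I feasible_def)
    then show "\<exists>i\<in>I. (LINT \<omega>|M. Z i \<omega> * H \<omega>) < c i - e / 4" by (auto simp: not_le)
  qed
  have B_sets: "B u \<in> sets M" for u
    unfolding B_def using finite_I borel_measurable[OF Z] by measurable
  \<comment> \<open>The modulus is used with oscillation \<open>e / 4 * u\<close> and rate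
    \<open>d\<^sup>2 / 2\<close>, so that its exceptional set obeys the same bound as
    \<open>B u\<close>.\<close>
  have "0 < e / 4" using e by simp
  then obtain \<delta> u0 where \<delta>: "0 < \<delta>"
    "\<And>u. u0 \<le> u \<Longrightarrow> \<exists>N\<in>sets M. prob N \<le> exp (- (d\<^sup>2 / 2 * u\<^sup>2)) \<and>
      (\<forall>\<omega>\<in>space M - N. \<forall>s\<in>T. \<forall>t\<in>T. dist s t < \<delta> \<longrightarrow> \<bar>X s \<omega> - X t \<omega>\<bar> \<le> e / 4 * u)"
    using modulus_tail by metis
  show thesis
  proof (rule that[OF \<delta>(1)])
    fix u assume "max 1 u0 \<le> u"
    then have u: "1 \<le> u" "u0 \<le> u" by auto
    obtain N where N: "N \<in> sets M" "prob N \<le> exp (- (d\<^sup>2 / 2 * u\<^sup>2))"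
      "\<And>\<omega> s t. \<omega> \<in> space M - N \<Longrightarrow> s \<in> T \<Longrightarrow> t \<in> T \<Longrightarrow> dist s t < \<delta> \<Longrightarrow> \<bar>X s \<omega> - X t \<omega>\<bar> \<le> e / 4 * u"
      using \<delta>(2)[OF u(2)] by blast
    have "prob (N \<union> B u) \<le> prob N + prob (B u)" by (rule measure_Un_le[OF N(1) B_sets])
    also have "\<dots> \<le> 2 * exp (- (d\<^sup>2 * u\<^sup>2 / 2))" using N(2) B[of u] u by simp
    finally have "prob (N \<union> B u) \<le> 2 * exp (- (d\<^sup>2 * u\<^sup>2 / 2))" .
    moreover have "excursion L1 L2 u (r * u) \<subseteq> N \<union> B u"
      if L: "L1 \<in> compact_subsets T" "L2 \<in> compact_subsets T"
        and near: "hausdorff_dist K1 L1 < \<delta>" "hausdorff_dist K2 L2 < \<delta>" for L1 L2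
    proof
      fix \<omega> assume \<omega>: "\<omega> \<in> excursion L1 L2 u (r * u)"
      show "\<omega> \<in> N \<union> B u"
      proof (cases "\<omega> \<in> N")
        case False
        with \<omega> have \<omega>': "\<omega> \<in> space M - N" by (simp add: excursion_def)
        \<comment> \<open>A net point in \<open>K1\<close> has a point of \<open>L1\<close> within
          \<open>\<delta>\<close>, where the path exceeds \<open>u\<close>; off \<open>N\<close> the
          path is then at least \<open>u - e / 4 * u\<close> at the net point. The argument for
          \<open>K2\<close> is the mirror image.\<close>
        have "\<forall>i\<in>I. u * c i \<le> Z i \<omega>"
          unfolding all_I
        proof (intro conjI ballI)
          fix t assume "t \<in> F1"
          then have t: "t \<in> K1" "t \<in> T" using F1 K by auto
          obtain s where s: "s \<in> L1" "dist t s < \<delta>"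
            using hausdorff_dist_less_imp_near[OF K1 L(1) near(1) t(1)] by blast
          then have "s \<in> T" "u < X s \<omega>" using L \<omega> by (auto simp: compact_subsets_def excursion_def)
          moreover have "u * (1 - e / 4) = u - e / 4 * u" by (simp add: algebra_simps)
          ultimately show "u * c (Inl t) \<le> Z (Inl t) \<omega>"
            using N(3)[OF \<omega>' t(2) \<open>s \<in> T\<close> s(2)] unfolding c_def Z_def sum.case by linarith
        next
          fix t assume "t \<in> F2"
          then have t: "t \<in> K2" "t \<in> T" using F2 K by auto
          obtain s where s: "s \<in> L2" "dist t s < \<delta>"
            using hausdorff_dist_less_imp_near[OF K2 L(2) near(2) t(1)] by blast
          then have "s \<in> T" "X s \<omega> < r * u" using L \<omega> by (auto simp: compact_subsets_def excursion_def)
          moreover have "u * - (r + e / 4) = - (r * u) - e / 4 * u" by (simp add: algebra_simps)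
          ultimately show "u * c (Inr t) \<le> Z (Inr t) \<omega>"
            using N(3)[OF \<omega>' t(2) \<open>s \<in> T\<close> s(2)] unfolding c_def Z_def sum.case by linarith
        qed
        with \<omega>' show ?thesis by (simp add: B_def)
      qed simp
    qed
    moreover have "N \<union> B u \<in> sets M" using N(1) B_sets by auto
    ultimately show "\<exists>N\<in>sets M. prob N \<le> 2 * exp (- (d\<^sup>2 * u\<^sup>2 / 2)) \<and>
      (\<forall>L1\<in>compact_subsets T. \<forall>L2\<in>compact_subsets T.
        hausdorff_dist K1 L1 < \<delta> \<longrightarrow> hausdorff_dist K2 L2 < \<delta> \<longrightarrow> excursion L1 L2 u (r * u) \<subseteq> N)"
      by blast
  qed
qed

end

section \<open>Logarithmic asymptotics\<close>

lemma tendsto_const_div_square_at_top: "((\<lambda>u::real. k / u\<^sup>2 - a) \<longlongrightarrow> - a) at_top" for k a :: real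
proof -
  have "filterlim (\<lambda>u::real. u\<^sup>2) at_infinity at_top"
    by (intro filterlim_at_top_imp_at_infinity filterlim_pow_at_top filterlim_ident) simp
  then have "((\<lambda>u::real. k / u\<^sup>2) \<longlongrightarrow> 0) at_top" by (rule tendsto_divide_0[OF tendsto_const])
  from tendsto_diff[OF this tendsto_const[of a]] show ?thesis by simp
qed

text \<open>The prefactor contributes \<open>ln c / u\<^sup>2\<close>, which vanishes in the
  limit.\<close>

lemma Limsup_log_prob_le:
  fixes p :: "real \<Rightarrow> real"
  assumes "0 < c" and p: "\<And>u. 0 \<le> p u" "\<And>u. u0 \<le> u \<Longrightarrow> p u \<le> c * exp (- (a * u\<^sup>2 / 2))"
  shows "Limsup at_top (\<lambda>u. ereal (1 / u\<^sup>2) * log_prob (p u)) \<le> ereal (- a / 2)"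
proof -
  have "ereal (1 / u\<^sup>2) * log_prob (p u) \<le> ereal (ln c / u\<^sup>2 - a / 2)" if u: "max 1 u0 \<le> u" for u
  proof (cases "p u = 0")
    \<comment> \<open>The logarithm is minus infinity here, and so is its product with the positive
      number \<open>1 / u\<^sup>2\<close>.\<close>
    case True
    with u show ?thesis by (simp add: log_prob_def)
  next
    case False
    then have "ln (p u) \<le> ln (c * exp (- (a * u\<^sup>2 / 2)))"
      using p(1)[of u] p(2)[of u] u by (intro ln_mono) auto
    also have "\<dots> = ln c - a * u\<^sup>2 / 2" using \<open>0 < c\<close> by (simp add: ln_mult)
    finally have "1 / u\<^sup>2 * ln (p u) \<le> 1 / u\<^sup>2 * (ln c - a * u\<^sup>2 / 2)" by (intro mult_left_mono) auto
    also have "\<dots> = ln c / u\<^sup>2 - a / 2" using u by (simp add: field_simps)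
    finally show ?thesis using False by (simp add: log_prob_def)
  qed
  then have "Limsup at_top (\<lambda>u. ereal (1 / u\<^sup>2) * log_prob (p u))
      \<le> Limsup at_top (\<lambda>u. ereal (ln c / u\<^sup>2 - a / 2))"
    by (intro Limsup_mono eventually_at_top_linorderI[of "max 1 u0"])
  also have "\<dots> = ereal (- (a / 2))"
    using tendsto_const_div_square_at_top[of "ln c" "a / 2"] by (intro lim_imp_Limsup) auto
  finally show ?thesis by simp
qed

lemma Liminf_log_prob_ge:
  fixes p :: "real \<Rightarrow> real"
  assumes "0 < c" and p: "\<And>u. u0 \<le> u \<Longrightarrow> c * exp (- (a * u\<^sup>2 / 2)) \<le> p u"
  shows "ereal (- a / 2) \<le> Liminf at_top (\<lambda>u. ereal (1 / u\<^sup>2) * log_prob (p u))"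
proof -
  have "ereal (ln c / u\<^sup>2 - a / 2) \<le> ereal (1 / u\<^sup>2) * log_prob (p u)" if u: "max 1 u0 \<le> u" for u
  proof -
    have pos: "0 < c * exp (- (a * u\<^sup>2 / 2))" using \<open>0 < c\<close> by simp
    with p[of u] u have "0 < p u" by simp
    have "ln c / u\<^sup>2 - a / 2 = 1 / u\<^sup>2 * (ln c - a * u\<^sup>2 / 2)" using u by (simp add: field_simps)
    also have "ln c - a * u\<^sup>2 / 2 = ln (c * exp (- (a * u\<^sup>2 / 2)))" using \<open>0 < c\<close> by (simp add: ln_mult)
    also have "1 / u\<^sup>2 * \<dots> \<le> 1 / u\<^sup>2 * ln (p u)"
      using pos p[of u] u by (intro mult_left_mono ln_mono) auto
    finally show ?thesis using \<open>0 < p u\<close> by (simp add: log_prob_def)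
  qed
  then have "Liminf at_top (\<lambda>u. ereal (ln c / u\<^sup>2 - a / 2))
      \<le> Liminf at_top (\<lambda>u. ereal (1 / u\<^sup>2) * log_prob (p u))"
    by (intro Liminf_mono eventually_at_top_linorderI[of "max 1 u0"])
  moreover have "Liminf at_top (\<lambda>u. ereal (ln c / u\<^sup>2 - a / 2)) = ereal (- (a / 2))"
    using tendsto_const_div_square_at_top[of "ln c" "a / 2"] by (intro lim_imp_Liminf) auto
  ultimately show ?thesis by simp
qed

context continuous_gaussian_field
begin

section \<open>Rate function and events for the whole collection of pairs\<close>

lemma excursion_prob_eq:
  "excursion_prob M X \<C> u r = prob (\<Union>K\<in>\<C>. excursion (fst K) (snd K) u (r * u))"
  unfolding excursion_prob_def excursion_def case_prod_unfold
  by (rule arg_cong[where f = prob]) blast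

lemma excursion_rate_le:
  assumes "H \<in> field_L2_space M T X" "K \<in> \<C>" "feasible (fst K) (snd K) 1 r H"
  shows "excursion_rate M T X \<C> r \<le> ereal ((rms M H)\<^sup>2)"
  unfolding excursion_rate_def rms_square
proof (rule Inf_lower, rule CollectI, intro exI conjI)
  show "\<exists>(K1, K2)\<in>\<C>. (\<forall>t\<in>K1. 1 \<le> (LINT \<omega>|M. X t \<omega> * H \<omega>)) \<and> (\<forall>t\<in>K2. (LINT \<omega>|M. X t \<omega> * H \<omega>) \<le> r)"
    using assms by (intro bexI[of _ K]) (auto simp: feasible_def)
qed (use assms in auto)

lemma excursion_rate_less_imp:
  assumes "excursion_rate M T X \<C> r < ereal x"
  obtains H K where "H \<in> field_L2_space M T X" "K \<in> \<C>" "feasible (fst K) (snd K) 1 r H" "(rms M H)\<^sup>2 < x"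
proof -
  from assms obtain H K1 K2 where "(LINT \<omega>|M. (H \<omega>)\<^sup>2) < x" "H \<in> field_L2_space M T X" "(K1, K2) \<in> \<C>"
    "\<forall>t\<in>K1. 1 \<le> (LINT \<omega>|M. X t \<omega> * H \<omega>)" "\<forall>t\<in>K2. (LINT \<omega>|M. X t \<omega> * H \<omega>) \<le> r"
    unfolding excursion_rate_def Inf_less_iff by auto
  then show thesis by (intro that[of H "(K1, K2)"]) (auto simp: feasible_def rms_square)
qed

text \<open>A larger level admits more \<open>H\<close>. Arguing through all \<open>y\<close> above
  the rate covers infinite values too.\<close>

lemma excursion_rate_antimono:
  assumes "\<tau> \<le> \<tau>'"
  shows "excursion_rate M T X \<C> \<tau>' \<le> excursion_rate M T X \<C> \<tau>"
proof (rule dense_ge)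
  fix y assume y: "excursion_rate M T X \<C> \<tau> < y"
  show "excursion_rate M T X \<C> \<tau>' \<le> y"
  proof (cases y)
    case (real x)
    with y obtain H K where H: "H \<in> field_L2_space M T X" "K \<in> \<C>" "feasible (fst K) (snd K) 1 \<tau> H" "(rms M H)\<^sup>2 < x"
      using excursion_rate_less_imp by blast
    have "feasible (fst K) (snd K) 1 \<tau>' H" using H(3) assms by (force simp: feasible_def)
    from excursion_rate_le[OF H(1,2) this] H(4) real show ?thesis
      by (metis ereal_less_eq(3) less_imp_le order_trans)
  qed (use y in auto)
qed

lemma excursion_rate_nonneg: "0 \<le> excursion_rate M T X \<C> r"
  unfolding excursion_rate_def by (rule Inf_greatest) auto

text \<open>\<open>\<C>\<close> may be uncountable. Its finite nets at all scales
  \<open>1 / real (Suc n)\<close> give a countable subfamily with the same union: a fixed path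
  satisfies the strict inequalities on two compact sets with a margin, hence also on every pair
  close enough in Hausdorff distance.\<close>

lemma excursion_union_sets:
  assumes C: "compactin (mtopology_of (prod_metric (hausdorff_metric T) (hausdorff_metric T))) \<C>"
  shows "(\<Union>K\<in>\<C>. excursion (fst K) (snd K) a b) \<in> sets M"
proof -
  have sub: "\<C> \<subseteq> compact_subsets T \<times> compact_subsets T"
    using compactin_subset_topspace[OF C] by simp
  have "\<exists>F. finite F \<and> F \<subseteq> \<C> \<and> (\<forall>K\<in>\<C>. \<exists>L\<in>F. hausdorff_dist (fst L) (fst K) < 1 / real (Suc n)
      \<and> hausdorff_dist (snd L) (snd K) < 1 / real (Suc n))" for n
    by (rule compactin_hausdorff_finite_cover[OF C, of "\<lambda>_. 1 / real (Suc n)"]) (simp, blast)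
  then obtain F where F: "\<And>n. finite (F n)" "\<And>n. F n \<subseteq> \<C>"
    "\<And>n K. K \<in> \<C> \<Longrightarrow> \<exists>L\<in>F n. hausdorff_dist (fst L) (fst K) < 1 / real (Suc n)
      \<and> hausdorff_dist (snd L) (snd K) < 1 / real (Suc n)"
    by metis
  have "(\<Union>K\<in>\<C>. excursion (fst K) (snd K) a b) = (\<Union>K\<in>(\<Union>n. F n). excursion (fst K) (snd K) a b)"
  proof (rule equalityI)
    show "(\<Union>K\<in>\<C>. excursion (fst K) (snd K) a b) \<subseteq> (\<Union>K\<in>(\<Union>n. F n). excursion (fst K) (snd K) a b)"
    proof (rule subsetI)
      fix \<omega> assume "\<omega> \<in> (\<Union>K\<in>\<C>. excursion (fst K) (snd K) a b)"
      then obtain K where K: "K \<in> \<C>" and \<omega>: "\<omega> \<in> space M"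
        and ex: "\<forall>t\<in>fst K. a < X t \<omega>" "\<forall>t\<in>snd K. X t \<omega> < b" by (auto simp: excursion_def)
      have cs: "fst K \<in> compact_subsets T" "snd K \<in> compact_subsets T" using K sub by auto
      then have cK: "compact (fst K)" "fst K \<noteq> {}" "fst K \<subseteq> T" "compact (snd K)" "snd K \<noteq> {}" "snd K \<subseteq> T"
        by (auto simp: compact_subsets_def)
      note cont = continuous_on_subset[OF continuous_paths[OF \<omega>]]
      obtain t1 where t1: "t1 \<in> fst K" "\<And>s. s \<in> fst K \<Longrightarrow> X t1 \<omega> \<le> X s \<omega>"
        using continuous_attains_inf[OF cK(1,2) cont[OF cK(3)]] by blast
      obtain t2 where t2: "t2 \<in> snd K" "\<And>s. s \<in> snd K \<Longrightarrow> X s \<omega> \<le> X t2 \<omega>"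
        using continuous_attains_sup[OF cK(4,5) cont[OF cK(6)]] by blast
      define e where "e = min (X t1 \<omega> - a) (b - X t2 \<omega>)"
      have "0 < e" using ex t1 t2 by (simp add: e_def)
      then obtain \<delta> where \<delta>: "0 < \<delta>"
        "\<And>s t. s \<in> T \<Longrightarrow> t \<in> T \<Longrightarrow> dist s t < \<delta> \<Longrightarrow> \<bar>X s \<omega> - X t \<omega>\<bar> < e"
        using path_uniformly_continuous[OF \<omega>] by metis
      obtain n where n: "1 / real (Suc n) < \<delta>" using nat_approx_posE[OF \<delta>(1)] by blast
      obtain L where L: "L \<in> F n" "hausdorff_dist (fst L) (fst K) < \<delta>" "hausdorff_dist (snd L) (snd K) < \<delta>"
        using F(3)[OF K, of n] n by (meson less_trans)
      then have "L \<in> compact_subsets T \<times> compact_subsets T" using F(2)[of n] sub by blast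
      then have csL: "fst L \<in> compact_subsets T" "snd L \<in> compact_subsets T" by auto
      have "a < X t \<omega>" if t: "t \<in> fst L" for t
      proof -
        obtain s where s: "s \<in> fst K" "dist t s < \<delta>"
          using hausdorff_dist_less_imp_near[OF csL(1) cs(1) L(2) t] by blast
        have "t \<in> T" "s \<in> T" using t s csL cK by (auto simp: compact_subsets_def)
        with \<delta>(2) s have "\<bar>X t \<omega> - X s \<omega>\<bar> < e" by blast
        with t1(2)[OF s(1)] show ?thesis unfolding e_def by linarith
      qed
      moreover have "X t \<omega> < b" if t: "t \<in> snd L" for t
      proof -
        obtain s where s: "s \<in> snd K" "dist t s < \<delta>"
          using hausdorff_dist_less_imp_near[OF csL(2) cs(2) L(3) t] by blast
        have "t \<in> T" "s \<in> T" using t s csL cK by (auto simp: compact_subsets_def)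
        with \<delta>(2) s have "\<bar>X t \<omega> - X s \<omega>\<bar> < e" by blast
        with t2(2)[OF s(1)] show ?thesis unfolding e_def by linarith
      qed
      ultimately have "\<omega> \<in> excursion (fst L) (snd L) a b" using \<omega> by (simp add: excursion_def)
      with L show "\<omega> \<in> (\<Union>K\<in>(\<Union>n. F n). excursion (fst K) (snd K) a b)" by blast
    qed
  qed (use F(2) in blast)
  also have "\<dots> \<in> sets M"
  proof (rule sets.countable_UN')
    show "countable (\<Union>n. F n)" by (rule countable_UN) (simp_all add: F(1) countable_finite)
    show "(\<lambda>K. excursion (fst K) (snd K) a b) ` (\<Union>n. F n) \<subseteq> sets M"
    proof (rule image_subsetI)
      fix L assume "L \<in> (\<Union>n. F n)"
      then have "L \<in> compact_subsets T \<times> compact_subsets T" using F(2) sub by blast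
      then show "excursion (fst L) (snd L) a b \<in> sets M" by (intro excursion_sets) auto
    qed
  qed
  finally show ?thesis .
qed

lemma excursion_prob_upper:
  assumes C: "compactin (mtopology_of (prod_metric (hausdorff_metric T) (hausdorff_metric T))) \<C>"
    and d: "0 \<le> d" "ereal (d\<^sup>2) < excursion_rate M T X \<C> r"
  obtains c u0 where "0 < c" "\<And>u. u0 \<le> u \<Longrightarrow> excursion_prob M X \<C> u r \<le> c * exp (- (d\<^sup>2 * u\<^sup>2 / 2))"
proof -
  have sub: "\<C> \<subseteq> compact_subsets T \<times> compact_subsets T"
    using compactin_subset_topspace[OF C] by simp
  define P where "P K \<delta> u N \<longleftrightarrow> N \<in> sets M \<and> prob N \<le> 2 * exp (- (d\<^sup>2 * u\<^sup>2 / 2)) \<and>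
    (\<forall>L1\<in>compact_subsets T. \<forall>L2\<in>compact_subsets T.
      hausdorff_dist (fst K) L1 < \<delta> \<longrightarrow> hausdorff_dist (snd K) L2 < \<delta> \<longrightarrow> excursion L1 L2 u (r * u) \<subseteq> N)"
    for K \<delta> u N
  have "\<exists>\<delta> u0. 0 < \<delta> \<and> (\<forall>u\<ge>u0. \<exists>N. P K \<delta> u N)" if K: "K \<in> \<C>" for K
  proof -
    have "\<not> feasible (fst K) (snd K) 1 r H" if "H \<in> field_L2_space M T X" "rms M H \<le> d" for H
    proof
      assume "feasible (fst K) (snd K) 1 r H"
      from excursion_rate_le[OF that(1) K this] d(2) have "ereal (d\<^sup>2) < ereal ((rms M H)\<^sup>2)"
        by (rule less_le_trans[rotated])
      moreover have "(rms M H)\<^sup>2 \<le> d\<^sup>2" using that(2) by (intro power_mono) auto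
      ultimately show False by simp
    qed
    moreover have "fst K \<in> compact_subsets T" "snd K \<in> compact_subsets T" using K sub by auto
    ultimately obtain \<delta> u0 where "0 < \<delta>" "\<And>u. u0 \<le> u \<Longrightarrow> \<exists>N. P K \<delta> u N"
      using excursion_upper_bound[of "fst K" "snd K" d r] d(1) unfolding P_def Bex_def by metis
    then show ?thesis by blast
  qed
  then obtain \<delta> u0 where \<delta>: "\<And>K. K \<in> \<C> \<Longrightarrow> 0 < \<delta> K"
    and u0: "\<And>K u. K \<in> \<C> \<Longrightarrow> u0 K \<le> u \<Longrightarrow> \<exists>N. P K (\<delta> K) u N"
    by metis
  obtain F where F: "finite F" "F \<subseteq> \<C>"
    "\<And>K. K \<in> \<C> \<Longrightarrow> \<exists>L\<in>F. hausdorff_dist (fst L) (fst K) < \<delta> L \<and> hausdorff_dist (snd L) (snd K) < \<delta> L"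
    using compactin_hausdorff_finite_cover[OF C, of \<delta>] \<delta> by blast
  \<comment> \<open>Inserting \<open>0\<close> here and adding \<open>1\<close> in \<open>c\<close>
    cover an empty \<open>F\<close>, which arises from an empty \<open>\<C>\<close>.\<close>
  define U where "U = Max (insert 0 (u0 ` F))"
  define c where "c = 2 * real (card F) + 1"
  show thesis
  proof
    show "0 < c" by (simp add: c_def)
    fix u assume u: "U \<le> u"
    have "u0 L \<le> u" if "L \<in> F" for L
    proof -
      have "u0 L \<le> U" unfolding U_def using F(1) that by (intro Max_ge) auto
      with u show ?thesis by simp
    qed
    with u0 F(2) have "\<forall>L\<in>F. \<exists>N. P L (\<delta> L) u N" by blast
    then obtain N where N: "\<And>L. L \<in> F \<Longrightarrow> P L (\<delta> L) u (N L)" by metis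
    then have N_sets: "N L \<in> sets M" and N_prob: "prob (N L) \<le> 2 * exp (- (d\<^sup>2 * u\<^sup>2 / 2))" if "L \<in> F" for L
      using that by (auto simp: P_def)
    have "(\<Union>K\<in>\<C>. excursion (fst K) (snd K) u (r * u)) \<subseteq> (\<Union>L\<in>F. N L)"
    proof (rule UN_least)
      fix K assume K: "K \<in> \<C>"
      then obtain L where L: "L \<in> F" "hausdorff_dist (fst L) (fst K) < \<delta> L" "hausdorff_dist (snd L) (snd K) < \<delta> L"
        using F(3) by blast
      moreover have "fst K \<in> compact_subsets T" "snd K \<in> compact_subsets T" using K sub by auto
      ultimately have "excursion (fst K) (snd K) u (r * u) \<subseteq> N L" using N[OF L(1)] unfolding P_def by blast
      with L(1) show "excursion (fst K) (snd K) u (r * u) \<subseteq> (\<Union>L\<in>F. N L)" by blast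
    qed
    then have "excursion_prob M X \<C> u r \<le> prob (\<Union>L\<in>F. N L)"
      unfolding excursion_prob_eq using F(1) N_sets by (intro finite_measure_mono sets.finite_UN) auto
    also have "\<dots> \<le> (\<Sum>L\<in>F. prob (N L))"
      using F(1) N_sets by (intro finite_measure_subadditive_finite) auto
    also have "\<dots> \<le> (\<Sum>L\<in>F. 2 * exp (- (d\<^sup>2 * u\<^sup>2 / 2)))" by (intro sum_mono N_prob)
    also have "\<dots> = (c - 1) * exp (- (d\<^sup>2 * u\<^sup>2 / 2))" by (simp add: c_def)
    also have "\<dots> \<le> c * exp (- (d\<^sup>2 * u\<^sup>2 / 2))" by (intro mult_right_mono) auto
    finally show "excursion_prob M X \<C> u r \<le> c * exp (- (d\<^sup>2 * u\<^sup>2 / 2))" .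
  qed
qed

text \<open>One pair suffices; measurability of the union over \<open>\<C>\<close> makes the
  probability of a single excursion a lower bound.\<close>

lemma excursion_prob_lower:
  assumes C: "compactin (mtopology_of (prod_metric (hausdorff_metric T) (hausdorff_metric T))) \<C>"
    and r: "0 \<le> \<tau>" "\<tau> < r" "r \<le> 1" and x: "excursion_rate M T X \<C> \<tau> < ereal x"
  obtains c u0 where "0 < c" "\<And>u. u0 \<le> u \<Longrightarrow> c * exp (- (x * u\<^sup>2 / 2)) \<le> excursion_prob M X \<C> u r"
proof -
  obtain H K where H: "H \<in> field_L2_space M T X" "K \<in> \<C>" "feasible (fst K) (snd K) 1 \<tau> H" "(rms M H)\<^sup>2 < x"
    using excursion_rate_less_imp[OF x] by blast
  have "\<C> \<subseteq> compact_subsets T \<times> compact_subsets T"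
    using compactin_subset_topspace[OF C] by simp
  with H(2) have K: "fst K \<in> compact_subsets T" "snd K \<in> compact_subsets T" by auto
  obtain c u0 where c: "0 < c"
    "\<And>u. u0 \<le> u \<Longrightarrow> c * exp (- (x * u\<^sup>2 / 2)) \<le> prob (excursion (fst K) (snd K) u (r * u))"
    using excursion_lower_bound[OF K r H(1,3,4)] by blast
  have "prob (excursion (fst K) (snd K) u (r * u)) \<le> excursion_prob M X \<C> u r" for u
    unfolding excursion_prob_eq
    by (rule finite_measure_mono[OF _ excursion_union_sets[OF C]]) (use H(2) in blast)
  with c show thesis by (meson that order_trans)
qed

lemma excursion_prob_nonneg: "0 \<le> excursion_prob M X \<C> u r"
  by (simp add: excursion_prob_def)

text \<open>Every \<open>y\<close> strictly above the right-hand side is shown to bound the limit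
  superior, which treats finite and infinite rates alike.\<close>

lemma Limsup_excursion_prob:
  assumes C: "compactin (mtopology_of (prod_metric (hausdorff_metric T) (hausdorff_metric T))) \<C>"
  shows "Limsup at_top (\<lambda>u. ereal (1 / u\<^sup>2) * log_prob (excursion_prob M X \<C> u r))
    \<le> ereal (-1/2) * excursion_rate M T X \<C> r" (is "?l \<le> _")
proof (rule dense_ge)
  fix y assume y: "ereal (-1/2) * excursion_rate M T X \<C> r < y"
  show "?l \<le> y"
  proof (cases y)
    case (real y')
    show ?thesis
    proof (cases "0 \<le> y'")
      case True
      \<comment> \<open>For nonnegative \<open>y\<close> it is enough that probabilities are at most
        \<open>1\<close>.\<close>
      have "?l \<le> ereal (- 0 / 2)"
        by (rule Limsup_log_prob_le[of 1 _ 0]) (auto simp: excursion_prob_def)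
      also have "\<dots> \<le> y" using True real by simp
      finally show ?thesis .
    next
      case False
      \<comment> \<open>Chosen so that the exponent \<open>- d\<^sup>2 / 2\<close> equals
        \<open>y'\<close>.\<close>
      define d where "d = sqrt (- 2 * y')"
      have d: "0 \<le> d" "d\<^sup>2 = - 2 * y'" using False by (auto simp: d_def)
      have "ereal (d\<^sup>2) < excursion_rate M T X \<C> r"
        using y real excursion_rate_nonneg[of \<C> r] unfolding d(2)
        by (cases "excursion_rate M T X \<C> r") auto
      from excursion_prob_upper[OF C d(1) this] obtain c u0 where "0 < c"
        "\<And>u. u0 \<le> u \<Longrightarrow> excursion_prob M X \<C> u r \<le> c * exp (- (d\<^sup>2 * u\<^sup>2 / 2))" by blast
      from Limsup_log_prob_le[OF this(1) excursion_prob_nonneg this(2)]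
      have "?l \<le> ereal (- d\<^sup>2 / 2)" by blast
      then show ?thesis using real by (simp add: d(2))
    qed
  qed (use y in auto)
qed

lemma Liminf_excursion_prob:
  assumes C: "compactin (mtopology_of (prod_metric (hausdorff_metric T) (hausdorff_metric T))) \<C>"
    and r: "r \<le> 1"
  shows "ereal (-1/2) * (INF \<tau>\<in>{0<..<r}. excursion_rate M T X \<C> \<tau>)
    \<le> Liminf at_top (\<lambda>u. ereal (1 / u\<^sup>2) * log_prob (excursion_prob M X \<C> u r))" (is "_ * ?L \<le> ?l")
proof (rule dense_le)
  fix y assume y: "y < ereal (-1/2) * ?L"
  have "0 \<le> ?L" by (rule INF_greatest) (rule excursion_rate_nonneg)
  show "y \<le> ?l"
  proof (cases y)
    case (real y')
    \<comment> \<open>The infimum falls below \<open>- 2 * y'\<close>, so the rate at some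
      \<open>\<tau> < r\<close> does; this \<open>\<tau>\<close> leaves the gap to \<open>r\<close>
      that the bound for a single pair requires.\<close>
    have "?L < ereal (- 2 * y')" using y real \<open>0 \<le> ?L\<close> by (cases ?L) auto
    then obtain \<tau> where \<tau>: "0 < \<tau>" "\<tau> < r" "excursion_rate M T X \<C> \<tau> < ereal (- 2 * y')"
      by (auto simp: INF_less_iff)
    obtain c u0 where "0 < c"
      "\<And>u. u0 \<le> u \<Longrightarrow> c * exp (- ((- 2 * y') * u\<^sup>2 / 2)) \<le> excursion_prob M X \<C> u r"
      using excursion_prob_lower[OF C less_imp_le[OF \<tau>(1)] \<tau>(2) r \<tau>(3)] by blast
    from Liminf_log_prob_ge[OF this] have "ereal (- (- 2 * y') / 2) \<le> ?l" by blast
    then show ?thesis using real by simp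
  qed (use y in auto)
qed

text \<open>Monotonicity in \<open>\<tau>\<close> turns the left limit into an infimum. The range
  starts at \<open>0\<close> so that the lower bound, which asks for \<open>0 \<le> \<tau>\<close>,
  applies to each of its members.\<close>

lemma excursion_rate_tendsto_at_left:
  assumes "0 < r"
  shows "(excursion_rate M T X \<C> \<longlongrightarrow> (INF \<tau>\<in>{0<..<r}. excursion_rate M T X \<C> \<tau>)) (at_left r)"
proof (rule order_tendstoI)
  fix y assume y: "y < (INF \<tau>\<in>{0<..<r}. excursion_rate M T X \<C> \<tau>)"
  show "\<forall>\<^sub>F \<tau> in at_left r. y < excursion_rate M T X \<C> \<tau>"
    using eventually_at_left_real[OF assms]
    by eventually_elim (rule less_le_trans[OF y], rule INF_lower)
next
  fix y assume "(INF \<tau>\<in>{0<..<r}. excursion_rate M T X \<C> \<tau>) < y"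
  then obtain \<tau>0 where \<tau>0: "\<tau>0 < r" "excursion_rate M T X \<C> \<tau>0 < y" by (auto simp: INF_less_iff)
  show "\<forall>\<^sub>F \<tau> in at_left r. excursion_rate M T X \<C> \<tau> < y"
    using eventually_at_left_real[OF \<tau>0(1)]
    by eventually_elim (rule le_less_trans[OF excursion_rate_antimono \<tau>0(2)], simp)
qed

end

theorem theorem2p1:
  fixes M :: "'w measure" and T :: "(real ^ 'd) set" and X :: "real ^ 'd \<Rightarrow> 'w \<Rightarrow> real"
    and \<C> :: "((real ^ 'd) set \<times> (real ^ 'd) set) set" and r :: real
  assumes "prob_space M"
    and "compact T"
    and "gaussian_field M T X"
    and "centered_field M T X"
    and "\<And>\<omega>. \<omega> \<in> space M \<Longrightarrow> continuous_on T (\<lambda>t. X t \<omega>)"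
    and "compactin (mtopology_of (prod_metric (hausdorff_metric T) (hausdorff_metric T))) \<C>"
    and "0 < r" and "r \<le> 1"
  shows "\<exists>L. (excursion_rate M T X \<C> \<longlongrightarrow> L) (at_left r) \<and>
    ereal (-1/2) * L
      \<le> Liminf at_top (\<lambda>u::real. ereal (1 / u\<^sup>2) * log_prob (excursion_prob M X \<C> u r)) \<and>
    Liminf at_top (\<lambda>u::real. ereal (1 / u\<^sup>2) * log_prob (excursion_prob M X \<C> u r))
      \<le> Limsup at_top (\<lambda>u::real. ereal (1 / u\<^sup>2) * log_prob (excursion_prob M X \<C> u r)) \<and>
    Limsup at_top (\<lambda>u::real. ereal (1 / u\<^sup>2) * log_prob (excursion_prob M X \<C> u r))
      \<le> ereal (-1/2) * excursion_rate M T X \<C> r"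
proof -
  interpret continuous_gaussian_field M T X
    by (intro continuous_gaussian_field.intro continuous_gaussian_field_axioms.intro assms)
  show ?thesis
    using excursion_rate_tendsto_at_left[OF assms(7)] Liminf_excursion_prob[OF assms(6,8)]
      Limsup_excursion_prob[OF assms(6)]
    by (intro exI[of _ "INF \<tau>\<in>{0<..<r}. excursion_rate M T X \<C> \<tau>"] conjI Liminf_le_Limsup) auto
qed

end
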